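(* Let $\mathcal F$ be a saturated fusion system on a finite $p$-group $S$ with characteristic idempotent $\omega_{\mathcal F}\in A(S,S)_{(p)}$. A set with a left action of $S$ is the same as a $(1,S)$-biset, so the Burnside module $A(1,S)_{(p)}$ is isomorphic to the Burnside ring $A(S)_{(p)}$ (as $\mathbb Z_{(p)}$-modules). Through this isomorphism, left multiplication $X\mapsto\omega_{\mathcal F}\circ X$ in $A(1,S)_{(p)}$ coincides with the stabilization homomorphism $\pi\colon A(S)_{(p)}\to A(\mathcal F)_{(p)}$.
   Context: Here $p$ is a prime and $p$-groups are finite. A fusion system $\mathcal F$ on a $p$-group $S$ is a category whose objects are the subgroups of $S$, whose morphism sets $\mathcal F(P,Q)=\mathrm{Hom}_{\mathcal F}(P,Q)$ consist of injective group homomorphisms $P\to Q$ (composed as homomorphisms) and contain all homomorphisms $P\to Q$ induced by conjugation by elements of $S$, and such that for each $\varphi\in\mathcal F(P,Q)$ the isomorphism $\varphi\colon P\to\varphi P$ and its inverse are morphisms of $\mathcal F$. Write $\mathrm{Aut}_{\mathcal F}(P)=\mathcal F(P,P)$. Subgroups $P,Q$ are $\mathcal F$-conjugate ($P\sim_{\mathcal F}Q$) if they are isomorphic in $\mathcal F$; $[P]_{\mathcal F}$ is the set of $\mathcal F$-conjugates of $P$. $P$ is fully $\mathcal F$-normalized (resp. fully $\mathcal F$-centralized) if $|N_SP|\ge|N_SQ|$ (resp. $|C_SP|\ge|C_SQ|$) for all $Q\in[P]_{\mathcal F}$. $\mathcal F$ is saturated if for all $P\le S$: (1) if $P$ is fully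 $\mathcal F$-normalized, then $P$ is fully $\mathcal F$-centralized and $\mathrm{Aut}_S(P)$ is a Sylow $p$-subgroup of $\mathrm{Aut}_{\mathcal F}(P)$; (2) every $\varphi\in\mathcal F(P,S)$ with $\varphi(P)$ fully $\mathcal F$-centralized extends to a morphism in $\mathcal F(N_\varphi,S)$, where $N_\varphi=\{x\in N_S(P)\mid \exists y\in S:\varphi\circ c_x=c_y\circ\varphi\}$. $A(S)$ is the Burnside ring of $S$, $\Phi_Q$ the ring homomorphism counting $Q$-fixed points, $(p)$ denotes tensoring with $\mathbb Z_{(p)}$. $X\in A(S)_{(p)}$ is $\mathcal F$-stable if for all $P\le S$ and $\varphi\in\mathcal F(P,S)$ the restrictions of $X$ to $A(P)_{(p)}$ along $\varphi$ and along the inclusion agree; equivalently, $\Phi_P(X)=\Phi_Q(X)$ whenever $P\sim_{\mathcal F}Q$. $A(\mathcal F)_{(p)}$ is the subring of $\mathcal F$-stable elements of $A(S)_{(p)}$. The stabilization homomorphism $\pi\colon A(S)_{(p)}\to A(\mathcal F)_{(p)}$ sends $X$ to the (existing, unique) element with $\Phi_Q(\pi(X))=\frac1{|[Q]_{\mathcal F}|}\sum_{Q'\in[Q]_{\mathcal F}}\Phi_{Q'}(X)$ for all $Q\le S$. Bisets: for finite groups $G,H$, a $(G,H)$-biset is a finite set with commuting right $G$-action and left $H$-action, regarded as a left $(H\times G)$-set via $(h,g).x=hxg^{-1}$. $A(G,H)$ is the Grothendieck group of isomorphism classes of $(G,H)$-bisets under disjoint union. Composition $\circ\colon A(H,K)\times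 A(G,H)\to A(G,K)$ is induced by $Y\circ X=Y\times_HX$. For $U\le G$ and a homomorphism $\varphi\colon U\to H$, $\Delta(U,\varphi)=\{(\varphi(u),u)\mid u\in U\}\le H\times G$ and $[U,\varphi]_G^H=[(H\times G)/\Delta(U,\varphi)]$. Characteristic idempotent: $X\in A(S,S)_{(p)}$ is $\mathcal F$-generated if it is a $\mathbb Z_{(p)}$-linear combination of elements $[P,\varphi]_S^S$ with $P\le S$, $\varphi\in\mathcal F(P,S)$. It is right $\mathcal F$-stable if $X\circ[P,\varphi]_P^S=X\circ[P,\mathrm{id}]_P^S$, and left $\mathcal F$-stable if $[\varphi P,\varphi^{-1}]_S^P\circ X=[P,\mathrm{id}]_S^P\circ X$, for all $P\le S$, $\varphi\in\mathcal F(P,S)$. It is $\mathcal F$-characteristic if it is $\mathcal F$-generated, left and right $\mathcal F$-stable, and $\varepsilon(X)$ is invertible in $\mathbb Z_{(p)}$, where $\varepsilon$ is the $\mathbb Z_{(p)}$-linear extension of $X\mapsto|X|/|S|$ to the span of left-free bisets. For each saturated $\mathcal F$ there is exactly one idempotent (with respect to $\circ$) in $A(S,S)_{(p)}$ that is $\mathcal F$-characteristic; it is the characteristic idempotent $\omega_{\mathcal F}$. *)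

theory Defs
  imports
    Complex_Main
    "HOL-Computational_Algebra.Primes"
    "HOL-Library.Poly_Mapping"
    "HOL-Algebra.Group_Action"
    "HOL-Algebra.Left_Coset"
    "HOL-Algebra.Elementary_Groups"
    "HOL-Algebra.Module"
begin

section \<open>Modules over the integers localized at a prime\<close>

definition Z_loc :: "nat \<Rightarrow> rat ring" where
  "Z_loc p = \<lparr>carrier = {of_int a / of_int b | a b :: int. \<not> int p dvd b},
     monoid.mult = (*), one = 1, ring.zero = 0, add = (+)\<rparr>"

definition mod_homs ::
  "('r, 'm) ring_scheme \<Rightarrow> ('r, 'a, 'c) module_scheme \<Rightarrow> ('r, 'b, 'd) module_scheme \<Rightarrow> ('a \<Rightarrow> 'b) set" where
  "mod_homs R M N = {f. module R M \<and> module R N \<and> f \<in> carrier M \<rightarrow> carrier N \<and>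
     (\<forall>x\<in>carrier M. \<forall>y\<in>carrier M. f (x \<oplus>\<^bsub>M\<^esub> y) = f x \<oplus>\<^bsub>N\<^esub> f y) \<and>
     (\<forall>r\<in>carrier R. \<forall>x\<in>carrier M. f (r \<odot>\<^bsub>M\<^esub> x) = r \<odot>\<^bsub>N\<^esub> f x)}"

definition mod_isos ::
  "('r, 'm) ring_scheme \<Rightarrow> ('r, 'a, 'c) module_scheme \<Rightarrow> ('r, 'b, 'd) module_scheme \<Rightarrow> ('a \<Rightarrow> 'b) set" where
  "mod_isos R M N = {f \<in> mod_homs R M N. bij_betw f (carrier M) (carrier N)}"


section \<open>Finite sets with a left group action\<close>

type_synonym ('g, 'x) gset = "'x set \<times> ('g \<Rightarrow> 'x \<Rightarrow> 'x)"

definition is_gset :: "('g, 'm) monoid_scheme \<Rightarrow> ('g, 'x) gset \<Rightarrow> bool" where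
  "is_gset G X \<longleftrightarrow> finite (fst X) \<and> group_action G (fst X) (snd X)"

definition gset_iso :: "('g, 'm) monoid_scheme \<Rightarrow> ('g, 'x) gset \<Rightarrow> ('g, 'y) gset \<Rightarrow> bool" where
  "gset_iso G X Y \<longleftrightarrow> (\<exists>f. bij_betw f (fst X) (fst Y) \<and>
     (\<forall>g\<in>carrier G. \<forall>x\<in>fst X. f (snd X g x) = snd Y g (f x)))"

text \<open>
  Every finite \<open>G\<close>-set, whatever the type of its points, has an isomorphic copy whose points are
  natural numbers. An isomorphism class is represented by the set of all these copies.
\<close>

type_synonym 'g gset_class = "('g, nat) gset set"

definition iso_class :: "('g, 'm) monoid_scheme \<Rightarrow> ('g, 'x) gset \<Rightarrow> 'g gset_class" where
  "iso_class G X = {Y. is_gset G Y \<and> gset_iso G X Y}"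

definition iso_classes :: "('g, 'm) monoid_scheme \<Rightarrow> 'g gset_class set" where
  "iso_classes G = {iso_class G X | X :: ('g, nat) gset. is_gset G X}"

definition gset_union :: "('g, 'x) gset \<Rightarrow> ('g, 'y) gset \<Rightarrow> ('g, 'x + 'y) gset" where
  "gset_union X Y = (fst X <+> fst Y, \<lambda>g. \<lambda>z\<in>fst X <+> fst Y. map_sum (snd X g) (snd Y g) z)"

definition gset_prod :: "('g, 'x) gset \<Rightarrow> ('g, 'y) gset \<Rightarrow> ('g, 'x \<times> 'y) gset" where
  "gset_prod X Y = (fst X \<times> fst Y, \<lambda>g. \<lambda>z\<in>fst X \<times> fst Y. map_prod (snd X g) (snd Y g) z)"

definition gset_point :: "('g, unit) gset" where
  "gset_point = ({()}, \<lambda>g. \<lambda>x\<in>{()}. x)"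

definition gset_pullback :: "('h \<Rightarrow> 'g) \<Rightarrow> ('g, 'x) gset \<Rightarrow> ('h, 'x) gset" where
  "gset_pullback \<phi> X = (fst X, \<lambda>h. snd X (\<phi> h))"

definition coset_gset :: "('g, 'm) monoid_scheme \<Rightarrow> 'g set \<Rightarrow> ('g, 'g set) gset" where
  "coset_gset G D = (lcosets\<^bsub>G\<^esub> D, \<lambda>g. \<lambda>C\<in>lcosets\<^bsub>G\<^esub> D. g <#\<^bsub>G\<^esub> C)"

definition fixed_points :: "'g set \<Rightarrow> ('g, 'x) gset \<Rightarrow> 'x set" where
  "fixed_points Q X = (\<Inter>q\<in>Q. invariants (fst X) (snd X) q)"


section \<open>Burnside rings localized at a prime\<close>

text \<open>
  The Grothendieck group of finite \<open>G\<close>-sets is the free abelian group on isomorphism classes modulo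
  the relations \<open>[X \<squnion> Y] = [X] + [Y]\<close>. As the tensor product is right exact, tensoring it
  with \<open>Z_loc p\<close> gives the free \<open>Z_loc p\<close>-module on isomorphism classes modulo the
  \<open>Z_loc p\<close>-span of the same relations. Its elements are the cosets of that span.
\<close>

type_synonym 'g formal_sum = "'g gset_class \<Rightarrow>\<^sub>0 rat"

type_synonym 'g burnside_elem = "'g formal_sum set"

definition formal_sums :: "nat \<Rightarrow> ('g, 'm) monoid_scheme \<Rightarrow> 'g formal_sum set" where
  "formal_sums p G = {c. Poly_Mapping.keys c \<subseteq> iso_classes G \<and>
     range (Poly_Mapping.lookup c) \<subseteq> carrier (Z_loc p)}"

inductive_set burnside_relations :: "nat \<Rightarrow> ('g, 'm) monoid_scheme \<Rightarrow> 'g formal_sum set"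
  for p :: nat and G :: "('g, 'm) monoid_scheme" where
  zero: "0 \<in> burnside_relations p G"
| step: "c \<in> burnside_relations p G \<Longrightarrow> q \<in> carrier (Z_loc p) \<Longrightarrow>
     is_gset G (X :: ('g, nat) gset) \<Longrightarrow> is_gset G (Y :: ('g, nat) gset) \<Longrightarrow>
     c + (Poly_Mapping.single (iso_class G (gset_union X Y)) q
          - Poly_Mapping.single (iso_class G X) q
          - Poly_Mapping.single (iso_class G Y) q) \<in> burnside_relations p G"

definition burnside_coset :: "nat \<Rightarrow> ('g, 'm) monoid_scheme \<Rightarrow> 'g formal_sum \<Rightarrow> 'g burnside_elem" where
  "burnside_coset p G c = {c + r | r. r \<in> burnside_relations p G}"

definition burnside_class :: "nat \<Rightarrow> ('g, 'm) monoid_scheme \<Rightarrow> ('g, 'x) gset \<Rightarrow> 'g burnside_elem" where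
  "burnside_class p G X = burnside_coset p G (Poly_Mapping.single (iso_class G X) 1)"

text \<open>
  An operation on finite sets with action that respects isomorphisms and is additive for disjoint
  unions extends linearly to Burnside modules. The extensions below are computed on a formal sum
  representing the given element and on sets representing the isomorphism classes in that sum; for
  such operations the choices do not matter.
\<close>

definition elem_rep :: "'g burnside_elem \<Rightarrow> 'g formal_sum" where
  "elem_rep x = (SOME c. c \<in> x)"

definition class_rep :: "'g gset_class \<Rightarrow> ('g, nat) gset" where
  "class_rep K = (SOME X. X \<in> K)"

definition lift_rat :: "(('g, nat) gset \<Rightarrow> rat) \<Rightarrow> 'g burnside_elem \<Rightarrow> rat" where
  "lift_rat v x = (\<Sum>K\<in>Poly_Mapping.keys (elem_rep x).
     Poly_Mapping.lookup (elem_rep x) K * v (class_rep K))"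

definition lift_burnside :: "nat \<Rightarrow> ('h, 'm) monoid_scheme \<Rightarrow>
    (('g, nat) gset \<Rightarrow> ('h, 'x) gset) \<Rightarrow> 'g burnside_elem \<Rightarrow> 'h burnside_elem" where
  "lift_burnside p H v x = burnside_coset p H
     (\<Sum>K\<in>Poly_Mapping.keys (elem_rep x).
        Poly_Mapping.single (iso_class H (v (class_rep K))) (Poly_Mapping.lookup (elem_rep x) K))"

definition lift2_burnside :: "nat \<Rightarrow> ('k, 'm) monoid_scheme \<Rightarrow>
    (('h, nat) gset \<Rightarrow> ('g, nat) gset \<Rightarrow> ('k, 'x) gset) \<Rightarrow>
    'h burnside_elem \<Rightarrow> 'g burnside_elem \<Rightarrow> 'k burnside_elem" where
  "lift2_burnside p H v y x = burnside_coset p H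
     (\<Sum>L\<in>Poly_Mapping.keys (elem_rep y). \<Sum>K\<in>Poly_Mapping.keys (elem_rep x).
        Poly_Mapping.single (iso_class H (v (class_rep L) (class_rep K)))
          (Poly_Mapping.lookup (elem_rep y) L * Poly_Mapping.lookup (elem_rep x) K))"

definition burnside :: "nat \<Rightarrow> ('g, 'm) monoid_scheme \<Rightarrow> (rat, 'g burnside_elem) module" where
  "burnside p G =
     \<lparr>carrier = burnside_coset p G ` formal_sums p G,
      monoid.mult = lift2_burnside p G gset_prod,
      one = burnside_class p G gset_point,
      ring.zero = burnside_coset p G 0,
      add = (\<lambda>x y. burnside_coset p G (elem_rep x + elem_rep y)),
      smult = (\<lambda>q x. burnside_coset p G (Poly_Mapping.map ((*) q) (elem_rep x)))\<rparr>"

definition mark :: "'g set \<Rightarrow> 'g burnside_elem \<Rightarrow> rat" where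
  "mark Q = lift_rat (\<lambda>X. of_nat (card (fixed_points Q X)))"

text \<open>Restriction of an element along a group homomorphism \<open>\<phi>\<close> with source \<open>H\<close>.\<close>

definition burnside_restrict :: "nat \<Rightarrow> ('h, 'm) monoid_scheme \<Rightarrow> ('h \<Rightarrow> 'g) \<Rightarrow>
    'g burnside_elem \<Rightarrow> 'h burnside_elem" where
  "burnside_restrict p H \<phi> = lift_burnside p H (gset_pullback \<phi>)"


section \<open>Bisets\<close>

text \<open>
  A \<open>(G, H)\<close>-biset, with right \<open>G\<close>-action and left \<open>H\<close>-action, is encoded as the left
  \<open>H \<times>\<times> G\<close>-set with \<open>(h, g).x = h x g\<inverse>\<close>.
\<close>

abbreviation burnside_biset :: "nat \<Rightarrow> ('g, 'm) monoid_scheme \<Rightarrow> ('h, 'n) monoid_scheme \<Rightarrow>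
    (rat, ('h \<times> 'g) burnside_elem) module" where
  "burnside_biset p G H \<equiv> burnside p (H \<times>\<times> G)"

text \<open>
  For a \<open>(G, H)\<close>-biset \<open>X\<close> and an \<open>(H, K)\<close>-biset \<open>Y\<close>, the relation \<open>(y h, x) \<sim> (y, h x)\<close> on
  \<open>Y \<times> X\<close>; here \<open>y h = (1, h\<inverse>).y\<close>.
\<close>

definition balanced_rel :: "('k, 'l) monoid_scheme \<Rightarrow> ('h, 'n) monoid_scheme \<Rightarrow> ('g, 'm) monoid_scheme \<Rightarrow>
    ('k \<times> 'h, 'y) gset \<Rightarrow> ('h \<times> 'g, 'x) gset \<Rightarrow> (('y \<times> 'x) \<times> ('y \<times> 'x)) set" where
  "balanced_rel K H G Y X =
     {((snd Y (\<one>\<^bsub>K\<^esub>, inv\<^bsub>H\<^esub> h) y, x), (y, snd X (h, \<one>\<^bsub>G\<^esub>) x)) | y h x.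
        y \<in> fst Y \<and> h \<in> carrier H \<and> x \<in> fst X}"

definition biset_comp :: "('k, 'l) monoid_scheme \<Rightarrow> ('h, 'n) monoid_scheme \<Rightarrow> ('g, 'm) monoid_scheme \<Rightarrow>
    ('k \<times> 'h, 'y) gset \<Rightarrow> ('h \<times> 'g, 'x) gset \<Rightarrow> ('k \<times> 'g, ('y \<times> 'x) set) gset" where
  "biset_comp K H G Y X =
     (let E = (fst Y \<times> fst X) // balanced_rel K H G Y X in
      (E, \<lambda>(k, g). \<lambda>C\<in>E. map_prod (snd Y (k, \<one>\<^bsub>H\<^esub>)) (snd X (\<one>\<^bsub>H\<^esub>, g)) ` C))"

text \<open>\<open>burnside_comp p K H G\<close> is the composition \<open>A(H, K) \<times> A(G, H) \<rightarrow> A(G, K)\<close>, localized.\<close>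

definition burnside_comp :: "nat \<Rightarrow> ('k, 'l) monoid_scheme \<Rightarrow> ('h, 'n) monoid_scheme \<Rightarrow>
    ('g, 'm) monoid_scheme \<Rightarrow> ('k \<times> 'h) burnside_elem \<Rightarrow> ('h \<times> 'g) burnside_elem \<Rightarrow>
    ('k \<times> 'g) burnside_elem" where
  "burnside_comp p K H G = lift2_burnside p (K \<times>\<times> G) (biset_comp K H G)"

definition twisted_diagonal :: "'g set \<Rightarrow> ('g \<Rightarrow> 'h) \<Rightarrow> ('h \<times> 'g) set" where
  "twisted_diagonal U \<phi> = {(\<phi> u, u) | u. u \<in> U}"

text \<open>\<open>basic_biset p H G U \<phi>\<close> is \<open>[U, \<phi>]\<close> in \<open>A(G, H)\<close>, localized.\<close>

definition basic_biset :: "nat \<Rightarrow> ('h, 'n) monoid_scheme \<Rightarrow> ('g, 'm) monoid_scheme \<Rightarrow>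
    'g set \<Rightarrow> ('g \<Rightarrow> 'h) \<Rightarrow> ('h \<times> 'g) burnside_elem" where
  "basic_biset p H G U \<phi> =
     burnside_class p (H \<times>\<times> G) (coset_gset (H \<times>\<times> G) (twisted_diagonal U \<phi>))"

abbreviation one_group :: "unit monoid" where
  "one_group \<equiv> singleton_group ()"

text \<open>A \<open>(1, S)\<close>-biset viewed as a left \<open>S\<close>-set.\<close>

definition burnside_of_biset :: "nat \<Rightarrow> ('g, 'm) monoid_scheme \<Rightarrow>
    ('g \<times> unit) burnside_elem \<Rightarrow> 'g burnside_elem" where
  "burnside_of_biset p S = lift_burnside p S (gset_pullback (\<lambda>s. (s, ())))"


section \<open>Saturated fusion systems\<close>

text \<open>
  \<open>F P Q\<close> is the set of morphisms from \<open>P\<close> to \<open>Q\<close>, for subgroups \<open>P\<close>, \<open>Q\<close> of \<open>S\<close>. A morphism is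
  kept undefined outside \<open>P\<close>, so that equality of morphisms is equality of functions.
\<close>

type_synonym 'g fusion = "'g set \<Rightarrow> 'g set \<Rightarrow> ('g \<Rightarrow> 'g) set"

definition conj_map :: "('g, 'm) monoid_scheme \<Rightarrow> 'g \<Rightarrow> 'g set \<Rightarrow> 'g \<Rightarrow> 'g" where
  "conj_map S x P = (\<lambda>u\<in>P. x \<otimes>\<^bsub>S\<^esub> u \<otimes>\<^bsub>S\<^esub> inv\<^bsub>S\<^esub> x)"

definition inv_morphism :: "'g set \<Rightarrow> ('g \<Rightarrow> 'g) \<Rightarrow> 'g \<Rightarrow> 'g" where
  "inv_morphism P \<phi> = restrict (inv_into P \<phi>) (\<phi> ` P)"

locale fusion_system = group S for p :: nat and S (structure) +
  fixes F :: "'a fusion"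
  assumes prime_p: "prime p"
    and finite_carrier: "finite (carrier S)"
    and p_group: "\<exists>n. order S = p ^ n"
    and morphism: "\<lbrakk>subgroup P S; subgroup Q S; \<phi> \<in> F P Q\<rbrakk> \<Longrightarrow>
      \<phi> \<in> hom (S\<lparr>carrier := P\<rparr>) (S\<lparr>carrier := Q\<rparr>) \<and> \<phi> \<in> extensional P \<and> inj_on \<phi> P"
    and comp_closed: "\<lbrakk>subgroup P S; subgroup Q S; subgroup R S; \<phi> \<in> F P Q; \<psi> \<in> F Q R\<rbrakk> \<Longrightarrow>
      compose P \<psi> \<phi> \<in> F P R"
    and conj_in: "\<lbrakk>subgroup P S; subgroup Q S; s \<in> carrier S; conj_map S s P ` P \<subseteq> Q\<rbrakk> \<Longrightarrow>
      conj_map S s P \<in> F P Q"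
    and corestrict_in: "\<lbrakk>subgroup P S; subgroup Q S; \<phi> \<in> F P Q\<rbrakk> \<Longrightarrow> \<phi> \<in> F P (\<phi> ` P)"
    and inverse_in: "\<lbrakk>subgroup P S; subgroup Q S; \<phi> \<in> F P Q\<rbrakk> \<Longrightarrow>
      inv_morphism P \<phi> \<in> F (\<phi> ` P) P"

definition F_conjugates :: "('g, 'm) monoid_scheme \<Rightarrow> 'g fusion \<Rightarrow> 'g set \<Rightarrow> 'g set set" where
  "F_conjugates S F P = {Q. subgroup Q S \<and>
     (\<exists>\<phi>\<in>F P Q. \<exists>\<psi>\<in>F Q P. compose P \<psi> \<phi> = (\<lambda>x\<in>P. x) \<and> compose Q \<phi> \<psi> = (\<lambda>x\<in>Q. x))}"

definition centralizer :: "('g, 'm) monoid_scheme \<Rightarrow> 'g set \<Rightarrow> 'g set" where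
  "centralizer S P = {x \<in> carrier S. \<forall>u\<in>P. x \<otimes>\<^bsub>S\<^esub> u = u \<otimes>\<^bsub>S\<^esub> x}"

definition fully_normalized :: "('g, 'm) monoid_scheme \<Rightarrow> 'g fusion \<Rightarrow> 'g set \<Rightarrow> bool" where
  "fully_normalized S F P \<longleftrightarrow>
     (\<forall>Q\<in>F_conjugates S F P. card (normalizer S Q) \<le> card (normalizer S P))"

definition fully_centralized :: "('g, 'm) monoid_scheme \<Rightarrow> 'g fusion \<Rightarrow> 'g set \<Rightarrow> bool" where
  "fully_centralized S F P \<longleftrightarrow>
     (\<forall>Q\<in>F_conjugates S F P. card (centralizer S Q) \<le> card (centralizer S P))"

definition Aut_F :: "'g fusion \<Rightarrow> 'g set \<Rightarrow> ('g \<Rightarrow> 'g) monoid" where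
  "Aut_F F P = \<lparr>carrier = F P P, monoid.mult = compose P, one = (\<lambda>x\<in>P. x)\<rparr>"

definition Aut_S :: "('g, 'm) monoid_scheme \<Rightarrow> 'g set \<Rightarrow> ('g \<Rightarrow> 'g) set" where
  "Aut_S S P = (\<lambda>x. conj_map S x P) ` normalizer S P"

definition sylow_subgroup :: "nat \<Rightarrow> 'x set \<Rightarrow> ('x, 'm) monoid_scheme \<Rightarrow> bool" where
  "sylow_subgroup p H G \<longleftrightarrow> subgroup H G \<and> card H = p ^ multiplicity p (order G)"

definition extender :: "('g, 'm) monoid_scheme \<Rightarrow> 'g set \<Rightarrow> ('g \<Rightarrow> 'g) \<Rightarrow> 'g set" where
  "extender S P \<phi> = {x \<in> normalizer S P. \<exists>y\<in>carrier S. \<forall>u\<in>P.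
     \<phi> (conj_map S x P u) = conj_map S y (\<phi> ` P) (\<phi> u)}"

locale saturated_fusion_system = fusion_system +
  assumes sylow_axiom: "\<lbrakk>subgroup P S; fully_normalized S F P\<rbrakk> \<Longrightarrow>
      fully_centralized S F P \<and> sylow_subgroup p (Aut_S S P) (Aut_F F P)"
    and extension_axiom: "\<lbrakk>subgroup P S; \<phi> \<in> F P (carrier S); fully_centralized S F (\<phi> ` P)\<rbrakk> \<Longrightarrow>
      \<exists>\<psi>\<in>F (extender S P \<phi>) (carrier S). \<forall>u\<in>P. \<psi> u = \<phi> u"


section \<open>Stable elements and stabilization\<close>

definition F_stable :: "nat \<Rightarrow> ('g, 'm) monoid_scheme \<Rightarrow> 'g fusion \<Rightarrow> 'g burnside_elem \<Rightarrow> bool" where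
  "F_stable p S F X \<longleftrightarrow> (\<forall>P \<phi>. subgroup P S \<longrightarrow> \<phi> \<in> F P (carrier S) \<longrightarrow>
     burnside_restrict p (S\<lparr>carrier := P\<rparr>) \<phi> X = burnside_restrict p (S\<lparr>carrier := P\<rparr>) (\<lambda>u. u) X)"

definition burnside_fusion :: "nat \<Rightarrow> ('g, 'm) monoid_scheme \<Rightarrow> 'g fusion \<Rightarrow>
    (rat, 'g burnside_elem) module" where
  "burnside_fusion p S F =
     (burnside p S)\<lparr>carrier := {X \<in> carrier (burnside p S). F_stable p S F X}\<rparr>"

definition is_stabilization :: "nat \<Rightarrow> ('g, 'm) monoid_scheme \<Rightarrow> 'g fusion \<Rightarrow>
    'g burnside_elem \<Rightarrow> 'g burnside_elem \<Rightarrow> bool" where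
  "is_stabilization p S F X Y \<longleftrightarrow> Y \<in> carrier (burnside_fusion p S F) \<and>
     (\<forall>Q. subgroup Q S \<longrightarrow>
        mark Q Y = (\<Sum>Q'\<in>F_conjugates S F Q. mark Q' X) / of_nat (card (F_conjugates S F Q)))"

text \<open>For saturated \<open>F\<close> and \<open>X\<close> in the Burnside ring of \<open>S\<close>, exactly one such \<open>Y\<close> exists.\<close>

definition stabilization :: "nat \<Rightarrow> ('g, 'm) monoid_scheme \<Rightarrow> 'g fusion \<Rightarrow>
    'g burnside_elem \<Rightarrow> 'g burnside_elem" where
  "stabilization p S F X = (THE Y. is_stabilization p S F X Y)"


section \<open>Characteristic idempotents\<close>

definition F_generated :: "nat \<Rightarrow> ('g, 'm) monoid_scheme \<Rightarrow> 'g fusion \<Rightarrow>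
    ('g \<times> 'g) burnside_elem \<Rightarrow> bool" where
  "F_generated p S F X \<longleftrightarrow>
     (\<exists>I c. finite I \<and> I \<subseteq> {(P, \<phi>). subgroup P S \<and> \<phi> \<in> F P (carrier S)} \<and> c \<in> I \<rightarrow> carrier (Z_loc p) \<and>
        X = (\<Oplus>\<^bsub>burnside_biset p S S\<^esub> i\<in>I.
               c i \<odot>\<^bsub>burnside_biset p S S\<^esub> basic_biset p S S (fst i) (snd i)))"

definition right_F_stable :: "nat \<Rightarrow> ('g, 'm) monoid_scheme \<Rightarrow> 'g fusion \<Rightarrow>
    ('g \<times> 'g) burnside_elem \<Rightarrow> bool" where
  "right_F_stable p S F X \<longleftrightarrow> (\<forall>P \<phi>. subgroup P S \<longrightarrow> \<phi> \<in> F P (carrier S) \<longrightarrow>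
     burnside_comp p S S (S\<lparr>carrier := P\<rparr>) X (basic_biset p S (S\<lparr>carrier := P\<rparr>) P \<phi>) =
     burnside_comp p S S (S\<lparr>carrier := P\<rparr>) X (basic_biset p S (S\<lparr>carrier := P\<rparr>) P (\<lambda>u. u)))"

definition left_F_stable :: "nat \<Rightarrow> ('g, 'm) monoid_scheme \<Rightarrow> 'g fusion \<Rightarrow>
    ('g \<times> 'g) burnside_elem \<Rightarrow> bool" where
  "left_F_stable p S F X \<longleftrightarrow> (\<forall>P \<phi>. subgroup P S \<longrightarrow> \<phi> \<in> F P (carrier S) \<longrightarrow>
     burnside_comp p (S\<lparr>carrier := P\<rparr>) S S
       (basic_biset p (S\<lparr>carrier := P\<rparr>) S (\<phi> ` P) (inv_morphism P \<phi>)) X =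
     burnside_comp p (S\<lparr>carrier := P\<rparr>) S S (basic_biset p (S\<lparr>carrier := P\<rparr>) S P (\<lambda>u. u)) X)"

text \<open>
  The linear extension of \<open>X \<mapsto> |X| / |S|\<close>. With rational values it is defined on the whole module;
  on the span of left-free bisets, which contains all \<open>F\<close>-generated elements, the values lie in
  \<open>Z_loc p\<close>.
\<close>

definition augmentation :: "('g, 'm) monoid_scheme \<Rightarrow> ('g \<times> 'g) burnside_elem \<Rightarrow> rat" where
  "augmentation S = lift_rat (\<lambda>X. of_nat (card (fst X)) / of_nat (order S))"

definition F_characteristic :: "nat \<Rightarrow> ('g, 'm) monoid_scheme \<Rightarrow> 'g fusion \<Rightarrow>
    ('g \<times> 'g) burnside_elem \<Rightarrow> bool" where
  "F_characteristic p S F X \<longleftrightarrow> F_generated p S F X \<and> left_F_stable p S F X \<and> right_F_stable p S F X \<and>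
     augmentation S X \<in> Units (Z_loc p)"

text \<open>For saturated \<open>F\<close> there is exactly one such element.\<close>

definition characteristic_idempotent :: "nat \<Rightarrow> ('g, 'm) monoid_scheme \<Rightarrow> 'g fusion \<Rightarrow>
    ('g \<times> 'g) burnside_elem \<Rightarrow> bool" where
  "characteristic_idempotent p S F \<omega> \<longleftrightarrow> \<omega> \<in> carrier (burnside_biset p S S) \<and>
     F_characteristic p S F \<omega> \<and> burnside_comp p S S S \<omega> \<omega> = \<omega>"

end

theory Submission
  imports Defs
begin

text \<open>
  An element of a Burnside module is determined by its marks, so the claim is that
  \<open>\<Phi>\<^sub>Q(\<omega> \<circ> X)\<close> is the average of the marks of \<open>X\<close> over the \<open>F\<close>-conjugates of \<open>Q\<close>. Once this is known,
  \<open>\<omega> \<circ> X\<close> is an \<open>F\<close>-stable element with the marks required of \<open>\<pi>(X)\<close>. This proves that \<open>\<pi>(X)\<close>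
  exists and equals \<open>\<omega> \<circ> X\<close>; it is unique because marks are injective (\<open>marks_injective\<close>), and
  \<open>\<pi>\<close> is linear because marks are.

  The average comes from a formula for the marks of a composition. A fixed point of \<open>Q\<close> on
  \<open>Y \<times>\<^sub>S X\<close> is the class of a pair \<open>(y, x)\<close> for which every \<open>q \<in> Q\<close> can be corrected by some \<open>s \<in> S\<close>
  so that \<open>(q, s)\<close> fixes \<open>y\<close> and \<open>s\<close> fixes \<open>x\<close>. If \<open>Y = [P, \<phi>]\<close> with \<open>\<phi>\<close> in \<open>F\<close>, the
  stabilizer of \<open>y\<close> is the graph of a morphism of \<open>F\<close>, so \<open>s = \<alpha>(q)\<close> for a unique \<open>\<alpha> \<in> F(Q, S)\<close>.
  Summing over \<open>\<alpha>\<close> and extending linearly gives, for \<open>F\<close>-generated \<open>Y\<close>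
  (\<open>mark_comp_F_generated\<close>),
  \<open>\<Phi>\<^sub>Q(Y \<circ> X) = 1/|S| \<cdot> \<Sum>\<^sub>\<alpha> \<Phi>\<^bsub>\<Delta>(\<alpha>)\<^esub>(Y) \<cdot> \<Phi>\<^bsub>\<alpha>Q\<^esub>(X)\<close>, where \<open>\<alpha>\<close> runs over \<open>F(Q, S)\<close> and \<open>\<Delta>(\<alpha>)\<close> is the
  set of pairs \<open>(q, \<alpha> q)\<close>,
  and a similar formula for bisets \<open>X\<close>.

  For \<open>Y = \<omega>\<close>, right and left stability say that \<open>\<Phi>\<close> takes one and the same value \<open>k\<close> at the graphs of
  all \<open>\<alpha> \<in> F(Q, S)\<close> and of their inverses (\<open>mark_graph\<close>, \<open>mark_inverse_graph\<close>), because composing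
  with \<open>[Q, \<alpha>]\<close> is restricting along \<open>\<alpha>\<close>. Hence \<open>\<Phi>\<^sub>Q(\<omega> \<circ> X)\<close> is a multiple of the sum of
  \<open>\<Phi>(X)\<close> over the images \<open>\<alpha>Q\<close>, each of which occurs equally often (\<open>sum_over_morphisms\<close>). It
  remains to find the factor. The formula for \<open>\<omega> \<circ> \<omega> = \<omega>\<close> reads \<open>k = |F(Q, S)| k\<^sup>2 / |S|\<close>, so \<open>k\<close> is \<open>0\<close>
  or \<open>|S| / |F(Q, S)|\<close>, and the second value is what makes the multiple an average. The first is
  excluded by a congruence: as \<open>S\<close> is a \<open>p\<close>-group, the mark at \<open>Q\<close> of the product of \<open>\<omega>\<close> with
  the one-point set is congruent modulo \<open>p\<close> to the mark at the trivial subgroup, which is the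
  augmentation of \<open>\<omega>\<close>, a unit (\<open>graph_mark_nonzero\<close>).
\<close>


section \<open>The localized integers\<close>

lemma Z_loc_simps [simp]:
  "x \<oplus>\<^bsub>Z_loc p\<^esub> y = x + y" "x \<otimes>\<^bsub>Z_loc p\<^esub> y = x * y"
  "\<zero>\<^bsub>Z_loc p\<^esub> = 0" "\<one>\<^bsub>Z_loc p\<^esub> = 1"
  by (simp_all add: Z_loc_def)

lemma in_Z_loc_iff:
  "q \<in> carrier (Z_loc p) \<longleftrightarrow> (\<exists>a b. \<not> int p dvd b \<and> q = of_int a / of_int b)"
  by (auto simp: Z_loc_def)

lemma Z_loc_mult [intro]:
  assumes "prime p" "q \<in> carrier (Z_loc p)" "r \<in> carrier (Z_loc p)"
  shows "q * r \<in> carrier (Z_loc p)"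
proof -
  obtain a b c d where "\<not> int p dvd b" "q = of_int a / of_int b"
    "\<not> int p dvd d" "r = of_int c / of_int d"
    using assms by (auto simp: in_Z_loc_iff)
  moreover have "prime (int p)"
    using assms by simp
  ultimately show ?thesis
    unfolding in_Z_loc_iff
    by (intro exI[of _ "a * c"] exI[of _ "b * d"]) (auto simp: prime_dvd_mult_iff)
qed

lemma Z_loc_add [intro]:
  assumes "prime p" "q \<in> carrier (Z_loc p)" "r \<in> carrier (Z_loc p)"
  shows "q + r \<in> carrier (Z_loc p)"
proof -
  obtain a b c d where *: "\<not> int p dvd b" "q = of_int a / of_int b"
    "\<not> int p dvd d" "r = of_int c / of_int d"
    using assms by (auto simp: in_Z_loc_iff)
  then have "b \<noteq> 0" "d \<noteq> 0"
    by auto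
  with * have "q + r = of_int (a * d + c * b) / of_int (b * d)"
    by (simp add: field_simps)
  moreover have "\<not> int p dvd b * d"
    using * assms(1) by (simp add: prime_dvd_mult_iff)
  ultimately show ?thesis
    unfolding in_Z_loc_iff by blast
qed

lemma Z_loc_of_int [simp, intro]: "prime p \<Longrightarrow> of_int a \<in> carrier (Z_loc p)"
  unfolding in_Z_loc_iff by (intro exI[of _ a] exI[of _ 1]) (auto dest: not_prime_unit)

lemma Z_loc_of_nat [simp, intro]: "prime p \<Longrightarrow> of_nat a \<in> carrier (Z_loc p)"
  using Z_loc_of_int[of p "int a"] by simp

lemma Z_loc_0_1 [simp, intro]:
  "prime p \<Longrightarrow> 0 \<in> carrier (Z_loc p)" "prime p \<Longrightarrow> 1 \<in> carrier (Z_loc p)"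
  using Z_loc_of_int[of p 0] Z_loc_of_int[of p 1] by simp_all

lemma Z_loc_uminus [intro]: "prime p \<Longrightarrow> q \<in> carrier (Z_loc p) \<Longrightarrow> - q \<in> carrier (Z_loc p)"
  using Z_loc_mult[of p "-1" q] Z_loc_of_int[of p "-1"] by simp

lemma Z_loc_sum:
  assumes "prime p" "\<And>i. i \<in> I \<Longrightarrow> f i \<in> carrier (Z_loc p)"
  shows "sum f I \<in> carrier (Z_loc p)"
  using assms(2) by (induction I rule: infinite_finite_induct) (auto simp: assms(1))

lemma cring_Z_loc:
  assumes "prime p"
  shows "cring (Z_loc p)"
proof (rule cringI)
  show "abelian_group (Z_loc p)"
  proof (rule abelian_groupI; simp add: assms Z_loc_add add.assoc add.commute)
    fix x assume "x \<in> carrier (Z_loc p)"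
    then show "\<exists>y\<in>carrier (Z_loc p). x + y = 0"
      using assms by (intro bexI[of _ "- x"]) auto
  qed
  show "comm_monoid (Z_loc p)"
    by (rule comm_monoidI) (simp_all add: assms Z_loc_mult)
qed (simp add: algebra_simps)

lemma prime_multiple_not_unit_Z_loc:
  assumes "prime p" "z \<in> carrier (Z_loc p)"
  shows "of_nat p * z \<notin> Units (Z_loc p)"
proof
  assume "of_nat p * z \<in> Units (Z_loc p)"
  then obtain e where "e \<in> carrier (Z_loc p)" and e: "of_nat p * z * e = 1"
    by (auto simp: Units_def mult.commute)
  then have "z * e \<in> carrier (Z_loc p)"
    using assms by auto
  then obtain a b where ab: "\<not> int p dvd b" "z * e = of_int a / of_int b"
    by (auto simp: in_Z_loc_iff)
  then have "of_nat p * (of_int a / of_int b) = (1 :: rat)" "b \<noteq> 0"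
    using e by (metis mult.assoc, auto)
  then have "(of_int (int p * a) :: rat) = of_int b"
    by (simp add: divide_eq_eq)
  then have "int p * a = b"
    using of_int_eq_iff by blast
  with ab show False
    by auto
qed


section \<open>Group actions on sets with isomorphisms and disjoint unions\<close>

lemma is_gset_intro:
  fixes G (structure)
  assumes "group G" "finite (fst X)"
    and ext: "\<And>g. g \<in> carrier G \<Longrightarrow> snd X g \<in> extensional (fst X)"
    and closed: "\<And>g x. g \<in> carrier G \<Longrightarrow> x \<in> fst X \<Longrightarrow> snd X g x \<in> fst X"
    and one: "\<And>x. x \<in> fst X \<Longrightarrow> snd X \<one>\<^bsub>G\<^esub> x = x"
    and mult: "\<And>g h x. g \<in> carrier G \<Longrightarrow> h \<in> carrier G \<Longrightarrow> x \<in> fst X \<Longrightarrow>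
      snd X (g \<otimes>\<^bsub>G\<^esub> h) x = snd X g (snd X h x)"
  shows "is_gset G X"
proof -
  interpret group G by fact
  have bij: "snd X g \<in> Bij (fst X)" if g: "g \<in> carrier G" for g
  proof -
    have "bij_betw (snd X g) (fst X) (fst X)"
      by (rule bij_betw_byWitness[where f' = "snd X (inv g)"])
        (use g closed one mult[symmetric] in auto)
    with ext g show ?thesis
      by (simp add: Bij_def)
  qed
  have "snd X \<in> hom G (BijGroup (fst X))"
  proof (rule homI)
    fix g h assume gh: "g \<in> carrier G" "h \<in> carrier G"
    show "snd X (g \<otimes> h) = snd X g \<otimes>\<^bsub>BijGroup (fst X)\<^esub> snd X h"
      using gh bij ext[of "g \<otimes> h"] mult
      by (auto simp: BijGroup_def compose_def fun_eq_iff extensional_def)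
  qed (simp add: BijGroup_def bij)
  then show ?thesis
    unfolding is_gset_def group_action_def group_hom_def group_hom_axioms_def
    using assms group_BijGroup by auto
qed

lemma is_gsetD:
  assumes "is_gset G X"
  shows "finite (fst X)" "group_action G (fst X) (snd X)"
    and "\<And>g x. g \<in> carrier G \<Longrightarrow> x \<in> fst X \<Longrightarrow> snd X g x \<in> fst X"
    and "\<And>x. x \<in> fst X \<Longrightarrow> snd X \<one>\<^bsub>G\<^esub> x = x"
    and "\<And>g h x. g \<in> carrier G \<Longrightarrow> h \<in> carrier G \<Longrightarrow> x \<in> fst X \<Longrightarrow>
      snd X (g \<otimes>\<^bsub>G\<^esub> h) x = snd X g (snd X h x)"
    and "\<And>g. g \<in> carrier G \<Longrightarrow> snd X g \<in> extensional (fst X)"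
proof -
  show fin: "finite (fst X)" and act: "group_action G (fst X) (snd X)"
    using assms by (auto simp: is_gset_def)
  interpret group_action G "fst X" "snd X" by fact
  show "\<And>g x. g \<in> carrier G \<Longrightarrow> x \<in> fst X \<Longrightarrow> snd X g x \<in> fst X"
    using element_image by blast
  show "snd X \<one>\<^bsub>G\<^esub> x = x" if "x \<in> fst X" for x
    using id_eq_one that by (metis restrict_apply')
  show "\<And>g h x. g \<in> carrier G \<Longrightarrow> h \<in> carrier G \<Longrightarrow> x \<in> fst X \<Longrightarrow>
      snd X (g \<otimes>\<^bsub>G\<^esub> h) x = snd X g (snd X h x)"
    using composition_rule by blast
  show "\<And>g. g \<in> carrier G \<Longrightarrow> snd X g \<in> extensional (fst X)"
    using bij_prop0 by (simp add: Bij_def)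
qed

lemma gset_iso_sym:
  assumes "is_gset G X" "gset_iso G X Y"
  shows "gset_iso G Y X"
proof -
  obtain f where f: "bij_betw f (fst X) (fst Y)"
    "\<And>g x. g \<in> carrier G \<Longrightarrow> x \<in> fst X \<Longrightarrow> f (snd X g x) = snd Y g (f x)"
    using assms(2) by (auto simp: gset_iso_def)
  let ?f = "inv_into (fst X) f"
  have "?f (snd Y g y) = snd X g (?f y)" if "g \<in> carrier G" "y \<in> fst Y" for g y
  proof -
    have y: "?f y \<in> fst X" "f (?f y) = y"
      using f(1) that by (simp_all add: bij_betw_def inv_into_into f_inv_into_f)
    then have "f (snd X g (?f y)) = snd Y g y"
      using f(2) that by simp
    then show ?thesis
      using f(1) is_gsetD(3)[OF assms(1) that(1) y(1)]
      by (metis bij_betw_inv_into_left)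
  qed
  then show ?thesis
    unfolding gset_iso_def using bij_betw_inv_into[OF f(1)] by blast
qed

lemma gset_iso_trans:
  assumes "gset_iso G X Y" "gset_iso G Y Z"
  shows "gset_iso G X Z"
proof -
  obtain f f' where f: "bij_betw f (fst X) (fst Y)"
    "\<And>g x. g \<in> carrier G \<Longrightarrow> x \<in> fst X \<Longrightarrow> f (snd X g x) = snd Y g (f x)"
    and f': "bij_betw f' (fst Y) (fst Z)"
    "\<And>g x. g \<in> carrier G \<Longrightarrow> x \<in> fst Y \<Longrightarrow> f' (snd Y g x) = snd Z g (f' x)"
    using assms by (auto simp: gset_iso_def)
  show ?thesis
    unfolding gset_iso_def
    using bij_betw_trans[OF f(1) f'(1)] f f' bij_betwE[OF f(1)]
    by (intro exI[of _ "f' \<circ> f"]) auto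
qed

lemma gset_iso_union:
  assumes "gset_iso G X X'" "gset_iso G Y Y'"
  shows "gset_iso G (gset_union X Y) (gset_union X' Y')"
proof -
  obtain f where f: "bij_betw f (fst X) (fst X')"
    "\<And>g x. g \<in> carrier G \<Longrightarrow> x \<in> fst X \<Longrightarrow> f (snd X g x) = snd X' g (f x)"
    using assms(1) unfolding gset_iso_def by metis
  obtain f' where f': "bij_betw f' (fst Y) (fst Y')"
    "\<And>g x. g \<in> carrier G \<Longrightarrow> x \<in> fst Y \<Longrightarrow> f' (snd Y g x) = snd Y' g (f' x)"
    using assms(2) unfolding gset_iso_def by metis
  have inj: "inj_on (map_sum f f') (fst X <+> fst Y)"
  proof (rule inj_onI)
    fix a b assume "a \<in> fst X <+> fst Y" "b \<in> fst X <+> fst Y" "map_sum f f' a = map_sum f f' b"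
    then show "a = b"
      using inj_onD[OF bij_betw_imp_inj_on[OF f(1)]] inj_onD[OF bij_betw_imp_inj_on[OF f'(1)]]
      by (elim PlusE) auto
  qed
  have surj: "map_sum f f' ` (fst X <+> fst Y) = fst X' <+> fst Y'"
    unfolding bij_betw_imp_surj_on[OF f(1), symmetric] bij_betw_imp_surj_on[OF f'(1), symmetric]
    by (simp add: Plus_def image_Un image_image)
  show ?thesis
    unfolding gset_iso_def
  proof (intro exI[of _ "map_sum f f'"] conjI ballI)
    show "bij_betw (map_sum f f') (fst (gset_union X Y)) (fst (gset_union X' Y'))"
      using inj surj by (simp add: bij_betw_def gset_union_def)
    fix g z assume "g \<in> carrier G" "z \<in> fst (gset_union X Y)"
    then show "map_sum f f' (snd (gset_union X Y) g z) = snd (gset_union X' Y') g (map_sum f f' z)"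
      using f(2) f'(2) bij_betwE[OF f(1)] bij_betwE[OF f'(1)]
      by (auto simp: gset_union_def)
  qed
qed

text \<open>
  Classes are represented by sets of natural numbers, so statements about their representatives reach
  a set with points of another type through such a copy.
\<close>

lemma nat_copy:
  fixes X :: "('g, 'x) gset"
  assumes "group G" "is_gset G X"
  obtains Y :: "('g, nat) gset" where "is_gset G Y" "gset_iso G X Y"
proof -
  obtain f :: "'x \<Rightarrow> nat" and n where "f ` fst X = {i. i < n}" and inj: "inj_on f (fst X)"
    using finite_imp_inj_to_nat_seg[OF is_gsetD(1)[OF assms(2)]] by blast
  let ?h = "inv_into (fst X) f"
  define Y :: "('g, nat) gset" where
    "Y = (f ` fst X, \<lambda>g. \<lambda>n\<in>f ` fst X. f (snd X g (?h n)))"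
  have "is_gset G Y"
    using assms(1) is_gsetD(1,3-5)[OF assms(2)] inj
    by (intro is_gset_intro)
      (auto simp: Y_def group.is_monoid monoid.m_closed inj_on_eq_iff[OF inj])
  moreover have "gset_iso G X Y"
    using inj
    by (auto simp: gset_iso_def Y_def bij_betw_def inj_on_eq_iff[OF inj] intro!: exI[of _ f])
  ultimately show ?thesis
    using that by blast
qed

lemma iso_class_eqI:
  assumes "is_gset G X" "gset_iso G X Y"
  shows "iso_class G X = iso_class G Y"
  unfolding iso_class_def
  using gset_iso_trans[OF assms(2)] gset_iso_trans[OF gset_iso_sym[OF assms]] by blast

lemma iso_class_in_iso_classes:
  assumes "group G" "is_gset G X"
  shows "iso_class G X \<in> iso_classes G"
  by (rule nat_copy[OF assms]) (auto simp: iso_classes_def dest: iso_class_eqI[OF assms(2)])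

lemma class_rep_iso:
  assumes "group G" "is_gset G X"
  shows "is_gset G (class_rep (iso_class G X))" "gset_iso G X (class_rep (iso_class G X))"
proof -
  obtain Y :: "('a, nat) gset" where "is_gset G Y" "gset_iso G X Y"
    using nat_copy[OF assms] .
  then have "Y \<in> iso_class G X"
    by (simp add: iso_class_def)
  then have "class_rep (iso_class G X) \<in> iso_class G X"
    unfolding class_rep_def by (rule someI)
  then show "is_gset G (class_rep (iso_class G X))" "gset_iso G X (class_rep (iso_class G X))"
    by (auto simp: iso_class_def)
qed

lemma class_rep_gset:
  assumes "group G" "K \<in> iso_classes G"
  shows "is_gset G (class_rep K)"
  using assms class_rep_iso(1) by (auto simp: iso_classes_def)

lemma is_gset_union:
  assumes "group G" "is_gset G X" "is_gset G Y"
  shows "is_gset G (gset_union X Y)"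
  using is_gsetD(1,3-5)[OF assms(2)] is_gsetD(1,3-5)[OF assms(3)] assms(1)
  by (intro is_gset_intro) (auto simp: gset_union_def Plus_def group.is_monoid monoid.m_closed)

lemma is_gset_pullback:
  assumes "group H" "group_hom H G \<phi>" "is_gset G X"
  shows "is_gset H (gset_pullback \<phi> X)"
proof -
  interpret group_hom H G \<phi> by fact
  show ?thesis
    using is_gsetD[OF assms(3)] hom_closed
    by (intro is_gset_intro) (auto simp: gset_pullback_def)
qed


section \<open>Isotropy sums\<close>

text \<open>
  Every numerical invariant used below is a sum over the points of a set of a quantity that depends
  on the stabilizer of the point only: the number of fixed points of \<open>Q\<close> is the sum of the truth
  values of \<open>Q \<subseteq> stabilizer\<close>, and the augmentation sums a constant. Such sums are clearly invariant
  under isomorphism and additive, so they extend linearly to Burnside modules. The weight may be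
  any function of the stabilizer, which makes the class of these invariants large enough to contain
  the fixed point numbers of compositions of bisets.
\<close>

definition isotropy_sum ::
  "('g, 'm) monoid_scheme \<Rightarrow> ('g set \<Rightarrow> rat) \<Rightarrow> ('g, 'x) gset \<Rightarrow> rat" where
  "isotropy_sum G W X = (\<Sum>x\<in>fst X. W (stabilizer G (snd X) x))"

lemma isotropy_sum_iso:
  assumes "is_gset G X" "gset_iso G X Y"
  shows "isotropy_sum G W X = isotropy_sum G W Y"
proof -
  obtain f where f: "bij_betw f (fst X) (fst Y)"
    "\<And>g x. g \<in> carrier G \<Longrightarrow> x \<in> fst X \<Longrightarrow> f (snd X g x) = snd Y g (f x)"
    using assms(2) by (auto simp: gset_iso_def)
  have "stabilizer G (snd X) x = stabilizer G (snd Y) (f x)" if "x \<in> fst X" for x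
    unfolding stabilizer_def
    using f(2) that is_gsetD(3)[OF assms(1)] inj_onD[OF bij_betw_imp_inj_on[OF f(1)]]
    by (metis (no_types, lifting))
  then show ?thesis
    unfolding isotropy_sum_def by (subst sum.reindex_bij_betw[OF f(1), symmetric]) simp
qed

lemma isotropy_sum_union:
  assumes "is_gset G X" "is_gset G Y"
  shows "isotropy_sum G W (gset_union X Y) = isotropy_sum G W X + isotropy_sum G W Y"
proof -
  have "isotropy_sum G W (gset_union X Y) =
    (\<Sum>x\<in>fst X. W (stabilizer G (snd (gset_union X Y)) (Inl x))) +
    (\<Sum>y\<in>fst Y. W (stabilizer G (snd (gset_union X Y)) (Inr y)))"
    unfolding isotropy_sum_def gset_union_def
    using is_gsetD(1)[OF assms(1)] is_gsetD(1)[OF assms(2)] by (simp add: sum.Plus)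
  also have "\<dots> = isotropy_sum G W X + isotropy_sum G W Y"
    unfolding isotropy_sum_def
    by (intro arg_cong2[of _ _ _ _ "(+)"] sum.cong refl arg_cong[of _ _ W])
      (auto simp: stabilizer_def gset_union_def)
  finally show ?thesis .
qed

lemma isotropy_sum_cong:
  assumes "is_gset G X" "\<And>A. subgroup A G \<Longrightarrow> W A = W' A"
  shows "isotropy_sum G W X = isotropy_sum G W' X"
  unfolding isotropy_sum_def
  using assms group_action.stabilizer_subgroup[OF is_gsetD(2)[OF assms(1)]]
  by (auto intro!: sum.cong)

lemma card_fixed_points:
  assumes "finite (fst X)" "Q \<subseteq> carrier G" "Q \<noteq> {}"
  shows "of_nat (card (fixed_points Q X)) = isotropy_sum G (\<lambda>A. of_bool (Q \<subseteq> A)) X"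
proof -
  have "fixed_points Q X = {x \<in> fst X. Q \<subseteq> stabilizer G (snd X) x}"
    using assms(2,3) by (auto simp: fixed_points_def invariants_def stabilizer_def)
  then show ?thesis
    by (simp add: isotropy_sum_def sum.If_cases of_bool_def assms(1) Int_def)
qed


section \<open>Burnside modules\<close>

definition linear_extension :: "('k \<Rightarrow> rat) \<Rightarrow> ('k \<Rightarrow>\<^sub>0 rat) \<Rightarrow> rat" where
  "linear_extension w c = (\<Sum>K\<in>Poly_Mapping.keys c. Poly_Mapping.lookup c K * w K)"

lemma linear_extension_superset:
  assumes "finite A" "Poly_Mapping.keys c \<subseteq> A"
  shows "linear_extension w c = (\<Sum>K\<in>A. Poly_Mapping.lookup c K * w K)"
  unfolding linear_extension_def
  by (rule sum.mono_neutral_left) (use assms in \<open>auto simp: in_keys_iff\<close>)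

lemma linear_extension_add:
  "linear_extension w (c + d) = linear_extension w c + linear_extension w d"
proof -
  let ?A = "Poly_Mapping.keys c \<union> Poly_Mapping.keys d"
  have "Poly_Mapping.keys (c + d) \<subseteq> ?A"
    by (rule Poly_Mapping.keys_add)
  then show ?thesis
    by (simp add: linear_extension_superset[of ?A] lookup_add algebra_simps sum.distrib)
qed

lemma linear_extension_0 [simp]: "linear_extension w 0 = 0"
  by (simp add: linear_extension_def)

lemma linear_extension_uminus: "linear_extension w (- c) = - linear_extension w c"
  using linear_extension_add[of w c "- c"] by simp

lemma linear_extension_diff:
  "linear_extension w (c - d) = linear_extension w c - linear_extension w d"
  using linear_extension_add[of w c "- d"] by (simp add: linear_extension_uminus)

lemma linear_extension_single [simp]: "linear_extension w (Poly_Mapping.single K q) = q * w K"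
  by (simp add: linear_extension_def)

lemma linear_extension_sum:
  "linear_extension w (\<Sum>i\<in>I. c i) = (\<Sum>i\<in>I. linear_extension w (c i))"
  by (induction I rule: infinite_finite_induct) (simp_all add: linear_extension_add)

lemma linear_extension_cong:
  assumes "\<And>K. K \<in> Poly_Mapping.keys c \<Longrightarrow> w K = w' K"
  shows "linear_extension w c = linear_extension w' c"
  using assms by (simp add: linear_extension_def)

abbreviation scale :: "rat \<Rightarrow> ('k \<Rightarrow>\<^sub>0 rat) \<Rightarrow> 'k \<Rightarrow>\<^sub>0 rat" where
  "scale q \<equiv> Poly_Mapping.map ((*) q)"

lemma lookup_scale [simp]: "Poly_Mapping.lookup (scale q c) K = q * Poly_Mapping.lookup c K"
  by (simp add: Poly_Mapping.map.rep_eq when_def)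

lemma scale_simps:
  "scale q (c + d) = scale q c + scale q d" "scale q (c - d) = scale q c - scale q d"
  "scale (q + r) c = scale q c + scale r c" "scale (q * r) c = scale q (scale r c)"
  "scale 1 c = c" "scale q 0 = (0 :: 'k \<Rightarrow>\<^sub>0 rat)"
  "scale q (Poly_Mapping.single K r) = Poly_Mapping.single K (q * r)"
  by (auto intro!: poly_mapping_eqI simp: lookup_add lookup_minus lookup_single algebra_simps when_def)

lemma scale_uminus_1: "scale (-1) c = - c"
  by (rule poly_mapping_eqI) simp

lemma linear_extension_scale: "linear_extension w (scale q c) = q * linear_extension w c"
proof -
  have "Poly_Mapping.keys (scale q c) \<subseteq> Poly_Mapping.keys c"
    by (auto simp: in_keys_iff)
  then show ?thesis
    by (simp add: linear_extension_superset[of "Poly_Mapping.keys c"] sum_distrib_left mult.assoc)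
qed

definition isotropy_form ::
  "('g, 'm) monoid_scheme \<Rightarrow> ('g set \<Rightarrow> rat) \<Rightarrow> 'g burnside_elem \<Rightarrow> rat" where
  "isotropy_form G W = lift_rat (isotropy_sum G W)"

lemma lift_rat_eq:
  "lift_rat v x = linear_extension (\<lambda>K. v (class_rep K)) (elem_rep x)"
  by (simp add: lift_rat_def linear_extension_def)

locale localized_group = group G for p :: nat and G (structure) +
  assumes prime_p: "prime p" and finite_carrier: "finite (carrier G)"
begin

abbreviation class_sum :: "('a set \<Rightarrow> rat) \<Rightarrow> 'a formal_sum \<Rightarrow> rat" where
  "class_sum W \<equiv> linear_extension (\<lambda>K. isotropy_sum G W (class_rep K))"

lemma isotropy_sum_class_rep:
  "is_gset G X \<Longrightarrow> isotropy_sum G W (class_rep (iso_class G X)) = isotropy_sum G W X"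
  using isotropy_sum_iso[OF _ class_rep_iso(2)] is_group by metis

lemma class_sum_relation: "c \<in> burnside_relations p G \<Longrightarrow> class_sum W c = 0"
  by (induction rule: burnside_relations.induct)
    (simp_all add: linear_extension_add linear_extension_diff isotropy_sum_class_rep
      isotropy_sum_union is_gset_union algebra_simps)

lemma formal_sums_iff:
  "c \<in> formal_sums p G \<longleftrightarrow> Poly_Mapping.keys c \<subseteq> iso_classes G \<and>
     (\<forall>K. Poly_Mapping.lookup c K \<in> carrier (Z_loc p))"
  by (auto simp: formal_sums_def)

lemma formal_sums_0: "0 \<in> formal_sums p G"
  by (simp add: formal_sums_iff prime_p)

lemma formal_sums_add:
  "c \<in> formal_sums p G \<Longrightarrow> d \<in> formal_sums p G \<Longrightarrow> c + d \<in> formal_sums p G"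
  using Poly_Mapping.keys_add[of c d]
  by (auto simp: formal_sums_iff lookup_add Z_loc_add[OF prime_p])

lemma formal_sums_scale:
  "q \<in> carrier (Z_loc p) \<Longrightarrow> c \<in> formal_sums p G \<Longrightarrow> scale q c \<in> formal_sums p G"
  by (auto simp: formal_sums_iff in_keys_iff Z_loc_mult[OF prime_p])

lemma formal_sums_uminus: "c \<in> formal_sums p G \<Longrightarrow> - c \<in> formal_sums p G"
  using formal_sums_scale[of "-1" c] Z_loc_of_int[OF prime_p, of "-1"] by (simp add: scale_uminus_1)

lemma formal_sums_diff:
  "c \<in> formal_sums p G \<Longrightarrow> d \<in> formal_sums p G \<Longrightarrow> c - d \<in> formal_sums p G"
  using formal_sums_add[OF _ formal_sums_uminus] by force

lemma formal_sums_single: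
  "is_gset G X \<Longrightarrow> q \<in> carrier (Z_loc p) \<Longrightarrow> Poly_Mapping.single (iso_class G X) q \<in> formal_sums p G"
  by (auto simp: formal_sums_iff lookup_single when_def prime_p
      intro: iso_class_in_iso_classes is_group)

lemma formal_sums_sum:
  "(\<And>i. i \<in> I \<Longrightarrow> c i \<in> formal_sums p G) \<Longrightarrow> (\<Sum>i\<in>I. c i) \<in> formal_sums p G"
  by (induction I rule: infinite_finite_induct) (auto simp: formal_sums_0 formal_sums_add)

lemma relations_subset: "c \<in> burnside_relations p G \<Longrightarrow> c \<in> formal_sums p G"
  by (induction rule: burnside_relations.induct)
    (auto intro!: formal_sums_0 formal_sums_add formal_sums_diff formal_sums_single is_gset_union
      simp: is_group)

lemma relations_add:
  assumes "d \<in> burnside_relations p G" "c \<in> burnside_relations p G"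
  shows "c + d \<in> burnside_relations p G"
  using assms
proof (induction rule: burnside_relations.induct)
  case (step d q X Y)
  then show ?case
    using burnside_relations.step[of "c + d" p G q X Y] by (simp add: add.assoc)
qed simp

lemma relations_scale:
  assumes "c \<in> burnside_relations p G" "q \<in> carrier (Z_loc p)"
  shows "scale q c \<in> burnside_relations p G"
  using assms
proof (induction rule: burnside_relations.induct)
  case zero
  then show ?case
    by (simp add: scale_simps burnside_relations.zero)
next
  case (step c r X Y)
  then show ?case
    using burnside_relations.step[of "scale q c" p G "q * r" X Y]
    by (simp add: scale_simps Z_loc_mult[OF prime_p])
qed

lemma relations_uminus: "c \<in> burnside_relations p G \<Longrightarrow> - c \<in> burnside_relations p G"
  using relations_scale[of c "-1"] Z_loc_of_int[OF prime_p, of "-1"] by (simp add: scale_uminus_1)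

lemma relations_diff:
  "c \<in> burnside_relations p G \<Longrightarrow> d \<in> burnside_relations p G \<Longrightarrow> c - d \<in> burnside_relations p G"
  using relations_add[OF relations_uminus] by force

text \<open>
  The defining relations are stated for sets of natural numbers; passing to representatives extends
  them to points of arbitrary types.
\<close>

lemma relation_union:
  assumes "is_gset G X" "is_gset G Y" "q \<in> carrier (Z_loc p)"
  shows "Poly_Mapping.single (iso_class G (gset_union X Y)) q
    - Poly_Mapping.single (iso_class G X) q - Poly_Mapping.single (iso_class G Y) q
      \<in> burnside_relations p G"
proof -
  let ?X = "class_rep (iso_class G X)" and ?Y = "class_rep (iso_class G Y)"
  note X = class_rep_iso[OF is_group assms(1)] and Y = class_rep_iso[OF is_group assms(2)]
  have "iso_class G (gset_union X Y) = iso_class G (gset_union ?X ?Y)"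
    by (intro iso_class_eqI is_gset_union gset_iso_union X Y is_group assms)
  then show ?thesis
    using burnside_relations.step[OF burnside_relations.zero assms(3) X(1) Y(1)]
      iso_class_eqI[OF assms(1) X(2)] iso_class_eqI[OF assms(2) Y(2)] by simp
qed

lemma burnside_coset_eq_iff:
  "burnside_coset p G c = burnside_coset p G d \<longleftrightarrow> c - d \<in> burnside_relations p G"
proof
  assume "burnside_coset p G c = burnside_coset p G d"
  moreover have "c \<in> burnside_coset p G c"
    unfolding burnside_coset_def by (auto intro!: exI[of _ 0] burnside_relations.zero)
  ultimately obtain r where "c = d + r" "r \<in> burnside_relations p G"
    by (auto simp: burnside_coset_def)
  then show "c - d \<in> burnside_relations p G"
    by simp
next
  assume *: "c - d \<in> burnside_relations p G"
  show "burnside_coset p G c = burnside_coset p G d"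
  proof (intro equalityI subsetI)
    fix x assume "x \<in> burnside_coset p G c"
    then obtain r where "x = d + ((c - d) + r)" "r \<in> burnside_relations p G"
      by (auto simp: burnside_coset_def algebra_simps)
    then show "x \<in> burnside_coset p G d"
      using relations_add * unfolding burnside_coset_def by blast
  next
    fix x assume "x \<in> burnside_coset p G d"
    then obtain r where "x = c + (r - (c - d))" "r \<in> burnside_relations p G"
      by (auto simp: burnside_coset_def algebra_simps)
    then show "x \<in> burnside_coset p G c"
      using relations_diff * unfolding burnside_coset_def by blast
  qed
qed

lemma elem_rep_coset: "elem_rep (burnside_coset p G c) - c \<in> burnside_relations p G"
proof -
  have "c \<in> burnside_coset p G c"
    unfolding burnside_coset_def by (auto intro!: exI[of _ 0] burnside_relations.zero)
  then have "elem_rep (burnside_coset p G c) \<in> burnside_coset p G c"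
    unfolding elem_rep_def by (rule someI)
  then show ?thesis
    by (auto simp: burnside_coset_def)
qed

lemma coset_elem_rep_coset:
  "burnside_coset p G (elem_rep (burnside_coset p G c)) = burnside_coset p G c"
  by (simp add: burnside_coset_eq_iff elem_rep_coset)

lemma carrier_burnside: "carrier (burnside p G) = burnside_coset p G ` formal_sums p G"
  by (simp add: burnside_def)

lemma elem_rep_formal_sum:
  assumes "x \<in> carrier (burnside p G)"
  shows "elem_rep x \<in> formal_sums p G" "burnside_coset p G (elem_rep x) = x"
proof -
  obtain c where c: "c \<in> formal_sums p G" "x = burnside_coset p G c"
    using assms by (auto simp: carrier_burnside)
  then show "burnside_coset p G (elem_rep x) = x"
    by (simp add: coset_elem_rep_coset)
  have "elem_rep x = c + (elem_rep x - c)"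
    by simp
  then show "elem_rep x \<in> formal_sums p G"
    using c formal_sums_add relations_subset elem_rep_coset by metis
qed

lemma add_coset:
  "burnside_coset p G c \<oplus>\<^bsub>burnside p G\<^esub> burnside_coset p G d = burnside_coset p G (c + d)"
proof -
  have "(elem_rep (burnside_coset p G c) - c) + (elem_rep (burnside_coset p G d) - d)
    \<in> burnside_relations p G"
    by (intro relations_add elem_rep_coset)
  then show ?thesis
    by (simp add: burnside_def burnside_coset_eq_iff algebra_simps)
qed

lemma smult_coset:
  assumes "q \<in> carrier (Z_loc p)"
  shows "q \<odot>\<^bsub>burnside p G\<^esub> burnside_coset p G c = burnside_coset p G (scale q c)"
  using relations_scale[OF elem_rep_coset assms, of c]
  by (simp add: burnside_def burnside_coset_eq_iff scale_simps)

lemma zero_coset: "\<zero>\<^bsub>burnside p G\<^esub> = burnside_coset p G 0"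
  by (simp add: burnside_def)

lemma module_burnside: "module (Z_loc p) (burnside p G)"
proof (rule moduleI)
  show "cring (Z_loc p)"
    using prime_p by (rule cring_Z_loc)
  show "abelian_group (burnside p G)"
  proof (rule abelian_groupI)
    fix x assume "x \<in> carrier (burnside p G)"
    then obtain c where c: "c \<in> formal_sums p G" "x = burnside_coset p G c"
      by (auto simp: carrier_burnside)
    then show "\<exists>y\<in>carrier (burnside p G). y \<oplus>\<^bsub>burnside p G\<^esub> x = \<zero>\<^bsub>burnside p G\<^esub>"
      by (intro bexI[of _ "burnside_coset p G (- c)"])
        (auto simp: carrier_burnside add_coset zero_coset formal_sums_uminus)
  qed (auto simp: carrier_burnside add_coset zero_coset formal_sums_add formal_sums_0 add_ac)
qed (auto simp: carrier_burnside add_coset smult_coset formal_sums_scale scale_simps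
    Z_loc_add[OF prime_p] Z_loc_mult[OF prime_p] formal_sums_add prime_p)

lemma isotropy_form_coset: "isotropy_form G W (burnside_coset p G c) = class_sum W c"
  using class_sum_relation[OF elem_rep_coset[of c], of W]
  by (simp add: isotropy_form_def lift_rat_eq linear_extension_diff)

lemma isotropy_form_add:
  assumes "x \<in> carrier (burnside p G)" "y \<in> carrier (burnside p G)"
  shows "isotropy_form G W (x \<oplus>\<^bsub>burnside p G\<^esub> y) = isotropy_form G W x + isotropy_form G W y"
  using assms by (auto simp: carrier_burnside add_coset isotropy_form_coset linear_extension_add)

lemma isotropy_form_smult:
  assumes "q \<in> carrier (Z_loc p)" "x \<in> carrier (burnside p G)"
  shows "isotropy_form G W (q \<odot>\<^bsub>burnside p G\<^esub> x) = q * isotropy_form G W x"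
  using assms by (auto simp: carrier_burnside smult_coset isotropy_form_coset linear_extension_scale)

lemma isotropy_form_zero: "isotropy_form G W \<zero>\<^bsub>burnside p G\<^esub> = 0"
  by (simp add: zero_coset isotropy_form_coset)

lemma burnside_class_closed: "is_gset G X \<Longrightarrow> burnside_class p G X \<in> carrier (burnside p G)"
  unfolding burnside_class_def carrier_burnside using formal_sums_single prime_p by blast

lemma isotropy_form_class: "is_gset G X \<Longrightarrow> isotropy_form G W (burnside_class p G X) = isotropy_sum G W X"
  by (simp add: burnside_class_def isotropy_form_coset isotropy_sum_class_rep)

lemma isotropy_form_eq_sum:
  "isotropy_form G W x = linear_extension (\<lambda>K. isotropy_sum G W (class_rep K)) (elem_rep x)"
  by (simp add: isotropy_form_def lift_rat_eq)

lemma isotropy_form_cong: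
  assumes "x \<in> carrier (burnside p G)" "\<And>A. subgroup A G \<Longrightarrow> W A = W' A"
  shows "isotropy_form G W x = isotropy_form G W' x"
  unfolding isotropy_form_eq_sum
  using elem_rep_formal_sum(1)[OF assms(1)] assms(2) class_rep_gset[OF is_group]
  by (intro linear_extension_cong isotropy_sum_cong) (auto simp: formal_sums_def)

text \<open>
  Linearity in the weight: the finite sum over the weights can be exchanged with the sums over
  representatives and their points. This is how a sum over morphisms is moved out of a mark.
\<close>

lemma isotropy_form_weight_sum:
  "isotropy_form G (\<lambda>A. \<Sum>i\<in>I. W i A) x = (\<Sum>i\<in>I. isotropy_form G (W i) x)"
proof -
  have "isotropy_sum G (\<lambda>A. \<Sum>i\<in>I. W i A) X = (\<Sum>i\<in>I. isotropy_sum G (W i) X)"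
    for X :: "('a, nat) gset"
    unfolding isotropy_sum_def by (rule sum.swap)
  then show ?thesis
    unfolding isotropy_form_eq_sum linear_extension_def
    by (simp add: sum_distrib_left) (rule sum.swap)
qed

lemma isotropy_form_weight_mult:
  "isotropy_form G (\<lambda>A. q * W A) x = q * isotropy_form G W x"
  "isotropy_form G (\<lambda>A. W A * q) x = isotropy_form G W x * q"
  "isotropy_form G (\<lambda>A. W A / q) x = isotropy_form G W x / q"
  unfolding isotropy_form_eq_sum linear_extension_def isotropy_sum_def
  by (simp_all add: sum_distrib_left sum_distrib_right sum_divide_distrib mult_ac)

lemma mark_eq_isotropy_form:
  assumes "x \<in> carrier (burnside p G)" "Q \<subseteq> carrier G" "Q \<noteq> {}"
  shows "mark Q x = isotropy_form G (\<lambda>A. of_bool (Q \<subseteq> A)) x"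
  unfolding isotropy_form_eq_sum mark_def lift_rat_eq
  using elem_rep_formal_sum(1)[OF assms(1)] is_gsetD(1)[OF class_rep_gset[OF is_group]] assms(2,3)
  by (intro linear_extension_cong card_fixed_points) (auto simp: formal_sums_def)

lemma mark_add:
  assumes "x \<in> carrier (burnside p G)" "y \<in> carrier (burnside p G)" "Q \<subseteq> carrier G" "Q \<noteq> {}"
  shows "mark Q (x \<oplus>\<^bsub>burnside p G\<^esub> y) = mark Q x + mark Q y"
  using assms abelian_monoid.a_closed[OF abelian_group.axioms(1), OF module.axioms(2)[OF module_burnside]]
  by (simp add: mark_eq_isotropy_form isotropy_form_add)

lemma mark_smult:
  assumes "q \<in> carrier (Z_loc p)" "x \<in> carrier (burnside p G)" "Q \<subseteq> carrier G" "Q \<noteq> {}"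
  shows "mark Q (q \<odot>\<^bsub>burnside p G\<^esub> x) = q * mark Q x"
  using assms module.smult_closed[OF module_burnside]
  by (simp add: mark_eq_isotropy_form isotropy_form_smult)

end


section \<open>Cosets, orbits and conjugation of isotropy groups\<close>

context localized_group
begin

abbreviation conj_set :: "'a \<Rightarrow> 'a set \<Rightarrow> 'a set" where
  "conj_set g D \<equiv> (\<lambda>d. g \<otimes> d \<otimes> inv g) ` D"

lemma finite_subgroup: "subgroup D G \<Longrightarrow> finite D"
  using finite_carrier rev_finite_subset subgroup.subset by metis

lemma card_conj_set:
  assumes "g \<in> carrier G" "D \<subseteq> carrier G"
  shows "card (conj_set g D) = card D"
  by (rule card_image, rule inj_onI) (use assms in \<open>auto simp: subset_iff\<close>)

lemma lcosets_eq: "lcosets D = (\<lambda>g. g <# D) ` carrier G"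
  by (auto simp: LCOSETS_def)

lemma lcoset_assoc:
  "D \<subseteq> carrier G \<Longrightarrow> g \<in> carrier G \<Longrightarrow> h \<in> carrier G \<Longrightarrow> g <# (h <# D) = (g \<otimes> h) <# D"
  by (rule lcos_m_assoc)

lemma is_gset_coset:
  assumes "subgroup D G"
  shows "is_gset G (coset_gset G D)"
proof -
  have D: "D \<subseteq> carrier G"
    using assms by (rule subgroup.subset)
  show ?thesis
    by (intro is_gset_intro)
      (auto simp: coset_gset_def lcosets_eq lcoset_assoc[OF D] is_group finite_carrier m_assoc)
qed

lemma lcoset_in: "g \<in> carrier G \<Longrightarrow> g <# D \<in> lcosets D"
  by (auto simp: lcosets_eq)

lemma coset_action:
  "D \<subseteq> carrier G \<Longrightarrow> h \<in> carrier G \<Longrightarrow> g \<in> carrier G \<Longrightarrow>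
    snd (coset_gset G D) h (g <# D) = (h \<otimes> g) <# D"
  by (simp add: coset_gset_def lcoset_in lcoset_assoc)

lemma stabilizer_coset:
  assumes D: "subgroup D G" and g: "g \<in> carrier G"
  shows "stabilizer G (snd (coset_gset G D)) (g <# D) = conj_set g D"
proof -
  have DG: "D \<subseteq> carrier G"
    using D by (rule subgroup.subset)
  have "(h \<otimes> g) <# D = g <# D \<longleftrightarrow> h \<in> conj_set g D" if h: "h \<in> carrier G" for h
  proof
    assume "(h \<otimes> g) <# D = g <# D"
    then have "h \<otimes> g \<in> g <# D"
      using lcos_self[of "h \<otimes> g" D] D g h by auto
    then obtain d where d: "d \<in> D" "h \<otimes> g = g \<otimes> d"
      by (auto simp: l_coset_def)
    then have "h = g \<otimes> d \<otimes> inv g"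
      using g h DG by (metis inv_solve_right m_closed subsetD)
    with d show "h \<in> conj_set g D"
      by blast
  next
    assume "h \<in> conj_set g D"
    then obtain d where d: "d \<in> D" "h = g \<otimes> d \<otimes> inv g"
      by blast
    then have "h \<otimes> g = g \<otimes> d"
      using g DG by (simp add: m_assoc subset_iff)
    then have "h \<otimes> g \<in> g <# D"
      using d by (auto simp: l_coset_def)
    then show "(h \<otimes> g) <# D = g <# D"
      using l_repr_independence[OF _ g D] by simp
  qed
  moreover have "conj_set g D \<subseteq> carrier G"
    using g DG by (auto simp: subset_iff)
  moreover have "stabilizer G (snd (coset_gset G D)) (g <# D) = {h \<in> carrier G. (h \<otimes> g) <# D = g <# D}"
    unfolding stabilizer_def
    by (rule Collect_cong) (use g coset_action[OF DG _ g] in auto)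
  ultimately show ?thesis
    by blast
qed

text \<open>
  Every coset in \<open>G/D\<close> is \<open>g D\<close> for \<open>|D|\<close> elements \<open>g\<close>, and the stabilizer of \<open>g D\<close> is the
  conjugate of \<open>D\<close> by \<open>g\<close>.
\<close>

lemma isotropy_sum_coset:
  assumes D: "subgroup D G"
  shows "isotropy_sum G W (coset_gset G D) = (\<Sum>g\<in>carrier G. W (conj_set g D)) / of_nat (card D)"
proof -
  have D0: "card D \<noteq> 0"
    using finite_subgroup[OF D] subgroup.one_closed[OF D] by auto
  let ?W = "\<lambda>C. W (stabilizer G (snd (coset_gset G D)) C)"
  have fibre: "{g \<in> carrier G. (g <# D) = C} = C" "card C = card D" if C: "C \<in> lcosets D" for C
  proof -
    obtain h where h: "h \<in> carrier G" "C = h <# D"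
      using C by (auto simp: lcosets_eq)
    show "{g \<in> carrier G. (g <# D) = C} = C"
    proof (intro equalityI subsetI)
      fix g assume "g \<in> {g \<in> carrier G. (g <# D) = C}"
      then show "g \<in> C"
        using lcos_self[OF _ D] by blast
    next
      fix g assume "g \<in> C"
      moreover have "C \<subseteq> carrier G"
        unfolding h(2) by (rule l_coset_subset_G[OF subgroup.subset[OF D] h(1)])
      ultimately show "g \<in> {g \<in> carrier G. (g <# D) = C}"
        using l_repr_independence[OF _ h(1) D] h(2) by blast
    qed
    have "inj_on (\<lambda>d. h \<otimes> d) D"
      using inj_on_cmult[OF h(1)] subgroup.subset[OF D] by (rule inj_on_subset)
    moreover have "h <# D = (\<lambda>d. h \<otimes> d) ` D"
      by (auto simp: l_coset_def)
    ultimately show "card C = card D"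
      using h(2) by (simp add: card_image)
  qed
  have "(\<Sum>g\<in>carrier G. W (conj_set g D)) = (\<Sum>g\<in>carrier G. ?W (g <# D))"
    by (intro sum.cong) (simp_all add: stabilizer_coset[OF D])
  also have "\<dots> = (\<Sum>C\<in>lcosets D. \<Sum>g\<in>{g \<in> carrier G. (g <# D) = C}. ?W (g <# D))"
    by (rule sum.group[symmetric]) (auto simp: lcosets_eq finite_carrier)
  also have "\<dots> = (\<Sum>C\<in>lcosets D. of_nat (card D) * ?W C)"
  proof (rule sum.cong)
    fix C assume C: "C \<in> lcosets D"
    have "(\<Sum>g\<in>{g \<in> carrier G. (g <# D) = C}. ?W (g <# D)) = (\<Sum>g\<in>{g \<in> carrier G. (g <# D) = C}. ?W C)"
      by (rule sum.cong) auto
    then show "(\<Sum>g\<in>{g \<in> carrier G. (g <# D) = C}. ?W (g <# D)) = of_nat (card D) * ?W C"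
      using fibre[OF C] by simp
  qed simp
  also have "\<dots> = of_nat (card D) * isotropy_sum G W (coset_gset G D)"
    by (simp add: isotropy_sum_def coset_gset_def sum_distrib_left)
  finally show ?thesis
    using D0 by simp
qed

text \<open>
  Moving along the action by \<open>g\<close> permutes the points and conjugates their stabilizers.
\<close>

lemma isotropy_sum_conj:
  assumes "is_gset G X" "g \<in> carrier G"
  shows "isotropy_sum G (\<lambda>A. W (conj_set g A)) X = isotropy_sum G W X"
proof -
  interpret X: group_action G "fst X" "snd X"
    using assms(1) by (rule is_gsetD)
  have "stabilizer G (snd X) (snd X g x) = conj_set g (stabilizer G (snd X) x)" if x: "x \<in> fst X" for x
  proof (intro equalityI subsetI)
    fix h assume h: "h \<in> stabilizer G (snd X) (snd X g x)"
    then have hG: "h \<in> carrier G" and "snd X h (snd X g x) = snd X g x"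
      by (auto simp: stabilizer_def)
    then have "snd X (inv g \<otimes> h \<otimes> g) x = x"
      using x assms(2) is_gsetD(3-5)[OF assms(1)] by (metis inv_closed l_inv m_closed)
    then have "inv g \<otimes> h \<otimes> g \<in> stabilizer G (snd X) x"
      using hG assms(2) by (simp add: stabilizer_def)
    moreover have "h = g \<otimes> (inv g \<otimes> h \<otimes> g) \<otimes> inv g"
      using hG assms(2) by (simp add: m_assoc) (simp add: m_assoc[symmetric])
    ultimately show "h \<in> conj_set g (stabilizer G (snd X) x)"
      by blast
  next
    fix h assume "h \<in> conj_set g (stabilizer G (snd X) x)"
    then obtain d where d: "d \<in> carrier G" "snd X d x = x" "h = g \<otimes> d \<otimes> inv g"
      by (auto simp: stabilizer_def)
    then have "snd X h (snd X g x) = snd X g x"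
      using x assms(2) is_gsetD(3-5)[OF assms(1)] by (metis inv_closed inv_inv m_closed X.orbit_sym_aux)
    then show "h \<in> stabilizer G (snd X) (snd X g x)"
      using d assms(2) by (simp add: stabilizer_def)
  qed
  moreover have "bij_betw (snd X g) (fst X) (fst X)"
    using X.inj_prop X.surj_prop assms(2) by (simp add: bij_betw_def)
  ultimately show ?thesis
    unfolding isotropy_sum_def
    by (subst sum.reindex_bij_betw[symmetric, of "snd X g"]) auto
qed

lemma isotropy_form_conj:
  assumes "x \<in> carrier (burnside p G)" "g \<in> carrier G"
  shows "isotropy_form G (\<lambda>A. W (conj_set g A)) x = isotropy_form G W x"
proof (subst (1 2) isotropy_form_eq_sum, rule linear_extension_cong)
  fix K assume "K \<in> Poly_Mapping.keys (elem_rep x)"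
  then have "is_gset G (class_rep K)"
    using elem_rep_formal_sum(1)[OF assms(1)] class_rep_gset[OF is_group]
    by (auto simp: formal_sums_def)
  then show "isotropy_sum G (\<lambda>A. W (conj_set g A)) (class_rep K) = isotropy_sum G W (class_rep K)"
    using assms(2) by (rule isotropy_sum_conj)
qed

lemma isotropy_form_coset_class:
  assumes "subgroup D G"
  shows "isotropy_form G W (burnside_class p G (coset_gset G D)) =
    (\<Sum>g\<in>carrier G. W (conj_set g D)) / of_nat (card D)"
  using isotropy_form_class[OF is_gset_coset[OF assms]] isotropy_sum_coset[OF assms] by simp

lemma mark_conj:
  assumes x: "x \<in> carrier (burnside p G)" and D: "D \<subseteq> carrier G" "D \<noteq> {}" and g: "g \<in> carrier G"
  shows "mark (conj_set g D) x = mark D x"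
proof -
  have conj: "conj_set g D \<subseteq> carrier G" "conj_set g D \<noteq> {}"
    using D g by auto
  have "inj_on (\<lambda>d. g \<otimes> d \<otimes> inv g) (carrier G)"
    using g by (intro inj_onI) simp
  then have "D \<subseteq> A \<longleftrightarrow> conj_set g D \<subseteq> conj_set g A" if "subgroup A G" for A
    using D(1) inj_on_image_mem_iff[OF _ _ subgroup.subset[OF that]]
    by (subst image_subset_iff) blast
  then have "mark D x = isotropy_form G (\<lambda>A. of_bool (conj_set g D \<subseteq> conj_set g A)) x"
    unfolding mark_eq_isotropy_form[OF x D] by (intro isotropy_form_cong[OF x]) simp
  also have "\<dots> = isotropy_form G (\<lambda>A. of_bool (conj_set g D \<subseteq> A)) x"
    by (rule isotropy_form_conj[OF x g])
  also have "\<dots> = mark (conj_set g D) x"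
    by (rule mark_eq_isotropy_form[OF x conj, symmetric])
  finally show ?thesis ..
qed

text \<open>
  The isomorphism sends a point \<open>y\<close> to the set of the group elements that carry \<open>x\<close> to \<open>y\<close>, which is
  a coset of the stabilizer of \<open>x\<close>.
\<close>

lemma transitive_gset_iso_coset:
  assumes X: "is_gset G X" and x: "x \<in> fst X"
    and trans: "\<And>y. y \<in> fst X \<Longrightarrow> \<exists>g\<in>carrier G. snd X g x = y"
  shows "gset_iso G X (coset_gset G (stabilizer G (snd X) x))"
proof -
  interpret X: group_action G "fst X" "snd X"
    using X by (rule is_gsetD)
  note D = is_gsetD(3-5)[OF X]
  let ?D = "stabilizer G (snd X) x"
  let ?f = "\<lambda>y. {g \<in> carrier G. snd X g x = y}"
  have f: "?f (snd X g x) = (g <# ?D)" if g: "g \<in> carrier G" for g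
  proof (intro equalityI subsetI)
    fix h assume h: "h \<in> ?f (snd X g x)"
    then have "snd X (inv g \<otimes> h) x = x"
      using g x D(3) X.orbit_sym_aux[OF g x] by simp
    then have "inv g \<otimes> h \<in> ?D"
      using g h by (simp add: stabilizer_def)
    moreover have "h = g \<otimes> (inv g \<otimes> h)"
      using g h by (simp add: m_assoc[symmetric])
    ultimately show "h \<in> g <# ?D"
      unfolding l_coset_def by blast
  next
    fix h assume "h \<in> g <# ?D"
    then show "h \<in> ?f (snd X g x)"
      using g x D by (auto simp: l_coset_def stabilizer_def)
  qed
  have "inj_on ?f (fst X)"
    using trans by (intro inj_onI) blast
  moreover have "?f ` fst X = lcosets ?D"
  proof -
    have "fst X = (\<lambda>g. snd X g x) ` carrier G"
      using trans D(1) x by auto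
    then show ?thesis
      using f by (auto simp: lcosets_eq)
  qed
  moreover have "?f (snd X h y) = snd (coset_gset G ?D) h (?f y)"
    if h: "h \<in> carrier G" and y: "y \<in> fst X" for h y
  proof -
    obtain g where g: "g \<in> carrier G" "snd X g x = y"
      using trans y by blast
    then have "snd X h y = snd X (h \<otimes> g) x"
      using D h x by simp
    then have "?f (snd X h y) = ((h \<otimes> g) <# ?D)"
      using f[of "h \<otimes> g"] g h by simp
    also have "(h \<otimes> g) <# ?D = h <# (g <# ?D)"
      using g h X.stabilizer_subset by (simp add: lcoset_assoc)
    also have "g <# ?D = ?f y"
      using f[OF g(1)] g(2) by simp
    also have "h <# ?f y = snd (coset_gset G ?D) h (?f y)"
      using f[OF g(1)] g lcoset_in[of g ?D] by (simp add: coset_gset_def)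
    finally show ?thesis .
  qed
  ultimately show ?thesis
    unfolding gset_iso_def by (intro exI[of _ ?f]) (auto simp: bij_betw_def coset_gset_def)
qed

text \<open>
  \<open>G/D\<close> has a point with stabilizer \<open>g D g\<inverse>\<close>, namely \<open>g D\<close>.
\<close>

lemma iso_class_coset_conj:
  assumes "subgroup D G" "g \<in> carrier G"
  shows "iso_class G (coset_gset G (conj_set g D)) = iso_class G (coset_gset G D)"
proof -
  let ?X = "coset_gset G D"
  have "gset_iso G ?X (coset_gset G (stabilizer G (snd ?X) (g <# D)))"
  proof (rule transitive_gset_iso_coset)
    show "g <# D \<in> fst ?X"
      using assms(2) by (simp add: coset_gset_def lcoset_in)
    fix C assume "C \<in> fst ?X"
    then obtain h where h: "h \<in> carrier G" "C = h <# D"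
      by (auto simp: coset_gset_def lcosets_eq)
    then have "snd ?X (h \<otimes> inv g) (g <# D) = C"
      using assms subgroup.subset[OF assms(1)] by (simp add: coset_action m_assoc)
    then show "\<exists>h\<in>carrier G. snd ?X h (g <# D) = C"
      using h assms(2) by blast
  qed (rule is_gset_coset[OF assms(1)])
  then show ?thesis
    using iso_class_eqI[OF is_gset_coset[OF assms(1)]] stabilizer_coset[OF assms] by metis
qed


section \<open>Marks determine the elements of a Burnside module\<close>

text \<open>
  The sum runs over all subgroups, not over representatives of their conjugacy classes, so that no
  representatives have to be chosen. The price is that the coefficients are not unique, which is dealt
  with when marks are compared.
\<close>

definition coset_sum :: "('a set \<Rightarrow> rat) \<Rightarrow> 'a formal_sum" where
  "coset_sum a = (\<Sum>D\<in>{D. subgroup D G}. Poly_Mapping.single (iso_class G (coset_gset G D)) (a D))"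

lemma finite_subgroups: "finite {D. subgroup D G}"
  by (rule finite_subset[of _ "Pow (carrier G)"]) (auto simp: finite_carrier dest: subgroup.subset)

lemma coset_sum_add: "coset_sum (\<lambda>D. a D + b D) = coset_sum a + coset_sum b"
  by (simp add: coset_sum_def single_add sum.distrib)

lemma coset_sum_delta:
  assumes "subgroup D G"
  shows "coset_sum (\<lambda>E. if E = D then q else 0) = Poly_Mapping.single (iso_class G (coset_gset G D)) q"
proof -
  have "coset_sum (\<lambda>E. if E = D then q else 0) =
    (\<Sum>E\<in>{D. subgroup D G}. if E = D then Poly_Mapping.single (iso_class G (coset_gset G D)) q else 0)"
    unfolding coset_sum_def by (intro sum.cong) auto
  then show ?thesis
    using assms by (simp add: finite_subgroups)
qed

definition decomposable :: "'a formal_sum \<Rightarrow> bool" where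
  "decomposable c \<longleftrightarrow> (\<exists>a. range a \<subseteq> carrier (Z_loc p) \<and> c - coset_sum a \<in> burnside_relations p G)"

lemma decomposable_add:
  assumes "decomposable c" "decomposable d"
  shows "decomposable (c + d)"
proof -
  obtain a b where a: "range a \<subseteq> carrier (Z_loc p)" "c - coset_sum a \<in> burnside_relations p G"
    and b: "range b \<subseteq> carrier (Z_loc p)" "d - coset_sum b \<in> burnside_relations p G"
    using assms by (auto simp: decomposable_def)
  have "(c - coset_sum a) + (d - coset_sum b) \<in> burnside_relations p G"
    using a b by (intro relations_add)
  moreover have "(c - coset_sum a) + (d - coset_sum b) = (c + d) - coset_sum (\<lambda>D. a D + b D)"
    by (simp add: coset_sum_add)
  moreover have "range (\<lambda>D. a D + b D) \<subseteq> carrier (Z_loc p)"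
    using a(1) b(1) Z_loc_add[OF prime_p] by blast
  ultimately show ?thesis
    unfolding decomposable_def by metis
qed

lemma decomposable_relation: "c \<in> burnside_relations p G \<Longrightarrow> decomposable c"
  unfolding decomposable_def coset_sum_def
  by (intro exI[of _ "\<lambda>_. 0"]) (auto simp: prime_p)

text \<open>
  A nonempty set is the disjoint union of an orbit, which is isomorphic to some \<open>G/D\<close>, and a smaller
  set.
\<close>

lemma decomposable_single:
  fixes X :: "('a, 'x) gset"
  assumes "is_gset G X" "q \<in> carrier (Z_loc p)"
  shows "decomposable (Poly_Mapping.single (iso_class G X) q)"
  using assms(1)
proof (induction "card (fst X)" arbitrary: X rule: less_induct)
  case less
  note X = less.prems and D = is_gsetD[OF less.prems]
  interpret X: group_action G "fst X" "snd X"
    by (rule D)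
  show ?case
  proof (cases "fst X = {}")
    case True
    \<comment> \<open>The class of the empty set is twice itself modulo relations, so it is zero.\<close>
    have "gset_iso G X (gset_union X X)"
      unfolding gset_iso_def using True
      by (intro exI[of _ Inl]) (simp add: gset_union_def bij_betw_def Plus_def)
    then have "iso_class G (gset_union X X) = iso_class G X"
      using iso_class_eqI[OF X] by metis
    then have "- Poly_Mapping.single (iso_class G X) q \<in> burnside_relations p G"
      using relation_union[OF X X assms(2)] by simp
    then show ?thesis
      using relations_uminus decomposable_relation by fastforce
  next
    case False
    then obtain x where x: "x \<in> fst X"
      by blast
    define B where "B = orbit G (snd X) x"
    have B: "B \<subseteq> fst X"
      using D(3) x by (auto simp: B_def orbit_def)
    have xB: "x \<in> B"
      unfolding B_def by (rule X.orbit_refl[OF x])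
    define part where "part E = (E, \<lambda>g. restrict (snd X g) E)" for E
    have closed: "snd X g y \<in> B \<longleftrightarrow> y \<in> B" if g: "g \<in> carrier G" and y: "y \<in> fst X" for g y
    proof
      assume "y \<in> B"
      then obtain h where h: "h \<in> carrier G" "y = snd X h x"
        by (auto simp: B_def orbit_def)
      then have "snd X g y = snd X (g \<otimes> h) x"
        using D(5) g x by simp
      then show "snd X g y \<in> B"
        using g h unfolding B_def orbit_def by blast
    next
      assume "snd X g y \<in> B"
      then obtain h where h: "h \<in> carrier G" "snd X g y = snd X h x"
        by (auto simp: B_def orbit_def)
      then have "y = snd X (inv g) (snd X h x)"
        using X.orbit_sym_aux[OF g y] by simp
      also have "\<dots> = snd X (inv g \<otimes> h) x"
        using D(5) g h x by simp
      finally show "y \<in> B"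
        using g h unfolding B_def orbit_def by blast
    qed
    have part_gset: "is_gset G (part E)"
      if E: "E \<subseteq> fst X" "\<And>g y. g \<in> carrier G \<Longrightarrow> y \<in> E \<Longrightarrow> snd X g y \<in> E" for E
      using E D(4,5) finite_subset[OF E(1) D(1)]
      by (intro is_gset_intro) (auto simp: part_def is_group subset_iff)
    have gB: "is_gset G (part B)"
      using closed B by (intro part_gset) auto
    have gR: "is_gset G (part (fst X - B))"
      using closed D(3) by (intro part_gset) auto
    have "gset_iso G (gset_union (part B) (part (fst X - B))) X"
      unfolding gset_iso_def
    proof (intro exI[of _ "case_sum id id"] conjI ballI)
      show "bij_betw (case_sum id id) (fst (gset_union (part B) (part (fst X - B)))) (fst X)"
        by (rule bij_betw_byWitness[where f' = "\<lambda>y. if y \<in> B then Inl y else Inr y"])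
          (use B in \<open>auto simp: gset_union_def part_def\<close>)
    qed (auto simp: gset_union_def part_def)
    then have union: "iso_class G (gset_union (part B) (part (fst X - B))) = iso_class G X"
      by (intro iso_class_eqI is_gset_union is_group gB gR)
    have "gset_iso G (part B) (coset_gset G (stabilizer G (snd (part B)) x))"
      using gB xB by (intro transitive_gset_iso_coset) (auto simp: part_def B_def orbit_def)
    then have orbit: "iso_class G (part B) = iso_class G (coset_gset G (stabilizer G (snd (part B)) x))"
      by (rule iso_class_eqI[OF gB])
    have "subgroup (stabilizer G (snd (part B)) x) G"
      using group_action.stabilizer_subgroup[OF is_gsetD(2)[OF gB]] xB by (simp add: part_def)
    then have "decomposable (Poly_Mapping.single (iso_class G (part B)) q)"
      unfolding orbit decomposable_def
      using assms(2)
      by (intro exI[of _ "\<lambda>E. if E = stabilizer G (snd (part B)) x then q else 0"])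
        (auto simp: coset_sum_delta burnside_relations.zero prime_p)
    moreover have "decomposable (Poly_Mapping.single (iso_class G (part (fst X - B))) q)"
    proof (rule less.hyps[OF _ gR])
      show "card (fst (part (fst X - B))) < card (fst X)"
        using D(1) x xB by (auto simp: part_def intro!: psubset_card_mono)
    qed
    moreover note decomposable_relation[OF relation_union[OF gB gR assms(2)]]
    ultimately have "decomposable ((Poly_Mapping.single (iso_class G X) q
        - Poly_Mapping.single (iso_class G (part B)) q
        - Poly_Mapping.single (iso_class G (part (fst X - B))) q)
      + Poly_Mapping.single (iso_class G (part B)) q
      + Poly_Mapping.single (iso_class G (part (fst X - B))) q)"
      unfolding union by (intro decomposable_add)
    then show ?thesis
      by simp
  qed
qed

lemma decomposable_formal_sum:
  assumes "c \<in> formal_sums p G"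
  shows "decomposable c"
proof -
  have "decomposable (\<Sum>K\<in>A. Poly_Mapping.single K (Poly_Mapping.lookup c K))"
    if "finite A" "A \<subseteq> iso_classes G" for A
    using that
  proof (induction rule: finite_induct)
    case empty
    then show ?case
      by (simp add: decomposable_relation burnside_relations.zero)
  next
    case (insert K A)
    then obtain X :: "('a, nat) gset" where "K = iso_class G X" "is_gset G X"
      by (auto simp: iso_classes_def)
    then have "decomposable (Poly_Mapping.single K (Poly_Mapping.lookup c K))"
      using decomposable_single[of X "Poly_Mapping.lookup c K"] assms by (simp add: formal_sums_iff)
    then show ?case
      using insert by (auto intro: decomposable_add)
  qed
  moreover have "(\<Sum>K\<in>Poly_Mapping.keys c. Poly_Mapping.single K (Poly_Mapping.lookup c K)) = c"
    by (rule poly_mapping_eqI) (simp add: lookup_sum lookup_single when_def in_keys_iff)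
  ultimately show ?thesis
    using assms finite_keys[of c] by (metis formal_sums_iff)
qed

text \<open>
  If all marks of a combination of transitive sets \<open>G/D\<close> vanish, take \<open>D\<close> of maximal order among
  the subgroups that occur. A set \<open>G/E\<close> that occurs has a point fixed by \<open>D\<close> only if \<open>E\<close> is
  conjugate to \<open>D\<close>. Such sets are isomorphic to \<open>G/D\<close>, and merging two of them leaves fewer
  subgroups; if there is only \<open>D\<close>, the mark at \<open>D\<close> shows that its coefficient is zero.
\<close>

lemma coset_sum_zero_if_marks_vanish:
  assumes "\<And>Q. subgroup Q G \<Longrightarrow> class_sum (\<lambda>A. of_bool (Q \<subseteq> A)) (coset_sum a) = 0"
  shows "coset_sum a = 0"
  using assms
proof (induction "card {D. subgroup D G \<and> a D \<noteq> 0}" arbitrary: a rule: less_induct)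
  case less
  let ?supp = "\<lambda>a :: 'a set \<Rightarrow> rat. {D. subgroup D G \<and> a D \<noteq> 0}"
  have fin: "finite (?supp b)" for b
    by (rule finite_subset[OF _ finite_subgroups]) auto
  show ?case
  proof (cases "?supp a = {}")
    case True
    then show ?thesis
      unfolding coset_sum_def by (intro sum.neutral) auto
  next
    case False
    then have "Max (card ` ?supp a) \<in> card ` ?supp a"
      using fin by (intro Max_in) auto
    then obtain D where D: "subgroup D G" "a D \<noteq> 0"
      and max: "\<And>E. subgroup E G \<Longrightarrow> a E \<noteq> 0 \<Longrightarrow> card E \<le> card D"
      using fin[of a] Max_ge[of "card ` ?supp a"] by (smt (verit) finite_imageI image_iff mem_Collect_eq)
    let ?m = "\<lambda>E. \<Sum>g\<in>carrier G. of_bool (D \<subseteq> conj_set g E) :: rat"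
    show ?thesis
    proof (cases "\<exists>E g. subgroup E G \<and> a E \<noteq> 0 \<and> E \<noteq> D \<and> g \<in> carrier G \<and> D \<subseteq> conj_set g E")
      case True
      then obtain E g where E: "subgroup E G" "a E \<noteq> 0" "E \<noteq> D" "g \<in> carrier G" "D \<subseteq> conj_set g E"
        by blast
      then have "D = conj_set g E"
        using max[OF E(1,2)] card_conj_set[OF E(4) subgroup.subset[OF E(1)]] finite_subgroup[OF E(1)]
          E(5) by (intro card_seteq) auto
      then have iso: "iso_class G (coset_gset G D) = iso_class G (coset_gset G E)"
        using iso_class_coset_conj[OF E(1,4)] by simp
      \<comment> \<open>The coefficient of \<open>E\<close> is moved to \<open>D\<close>.\<close>
      define b where "b F = a F + ((if F = D then a E else 0) + (if F = E then - a E else 0))" for F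
      have sum_b: "coset_sum b = coset_sum a"
        unfolding b_def coset_sum_add coset_sum_delta[OF D(1)] coset_sum_delta[OF E(1)] iso
        by (simp add: single_add[symmetric])
      have "card (?supp b) < card (?supp a)"
      proof (rule psubset_card_mono[OF fin])
        have "b E = 0"
          using E(3) by (simp add: b_def)
        moreover have "?supp b \<subseteq> ?supp a"
          using D E by (auto simp: b_def split: if_splits)
        ultimately show "?supp b \<subset> ?supp a"
          using E(1,2) by blast
      qed
      then have "coset_sum b = 0"
        using less.hyps[of b] less.prems sum_b by simp
      then show ?thesis
        by (simp add: sum_b)
    next
      case False
      have "0 = class_sum (\<lambda>A. of_bool (D \<subseteq> A)) (coset_sum a)"
        using less.prems D(1) by simp
      also have "\<dots> = (\<Sum>E\<in>{E. subgroup E G}. a E * (?m E / of_nat (card E)))"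
        unfolding coset_sum_def linear_extension_sum linear_extension_single
        by (intro sum.cong) (simp_all add: isotropy_sum_class_rep is_gset_coset isotropy_sum_coset)
      also have "\<dots> = (\<Sum>E\<in>{D}. a E * (?m E / of_nat (card E)))"
      proof (rule sum.mono_neutral_right[OF finite_subgroups])
        show "\<forall>E\<in>{E. subgroup E G} - {D}. a E * (?m E / of_nat (card E)) = 0"
          using False by (auto intro!: sum.neutral)
      qed (use D in auto)
      finally have "?m D = 0"
        using D finite_subgroup[OF D(1)] subgroup.one_closed[OF D(1)] by auto
      \<comment> \<open>The summand at the unit element shows that \<open>D\<close> has a fixed point on \<open>G/D\<close>.\<close>
      moreover have "?m D \<ge> of_bool (D \<subseteq> conj_set \<one> D)"
        using finite_carrier by (intro member_le_sum) auto
      moreover have "conj_set \<one> D = D"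
        using subgroup.subset[OF D(1)] by force
      ultimately show ?thesis
        by simp
    qed
  qed
qed

text \<open>
  Burnside's theorem: the table of marks is nonsingular, and over the rational numbers this suffices
  for coefficients in a localization of the integers.
\<close>

theorem marks_injective:
  assumes "x \<in> carrier (burnside p G)" "y \<in> carrier (burnside p G)"
    and "\<And>Q. subgroup Q G \<Longrightarrow> mark Q x = mark Q y"
  shows "x = y"
proof -
  obtain c d where c: "c \<in> formal_sums p G" "x = burnside_coset p G c"
    and d: "d \<in> formal_sums p G" "y = burnside_coset p G d"
    using assms(1,2) by (auto simp: carrier_burnside)
  obtain a where a: "(c - d) - coset_sum a \<in> burnside_relations p G"
    using decomposable_formal_sum[OF formal_sums_diff[OF c(1) d(1)]] by (auto simp: decomposable_def)
  have "class_sum (\<lambda>A. of_bool (Q \<subseteq> A)) (coset_sum a) = 0" if Q: "subgroup Q G" for Q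
  proof -
    have Q': "Q \<subseteq> carrier G" "Q \<noteq> {}"
      using subgroup.subset[OF Q] subgroup.one_closed[OF Q] by auto
    have "class_sum (\<lambda>A. of_bool (Q \<subseteq> A)) (c - d) = 0"
      using assms(3)[OF Q] mark_eq_isotropy_form[OF assms(1) Q'] mark_eq_isotropy_form[OF assms(2) Q']
      by (simp add: c(2) d(2) isotropy_form_coset linear_extension_diff)
    then show ?thesis
      using class_sum_relation[OF a, of "\<lambda>A. of_bool (Q \<subseteq> A)"] by (simp add: linear_extension_diff)
  qed
  then have "coset_sum a = 0"
    by (rule coset_sum_zero_if_marks_vanish)
  then show ?thesis
    using a by (simp add: c(2) d(2) burnside_coset_eq_iff)
qed

end


section \<open>Restriction along homomorphisms\<close>

lemma localized_group_DirProd: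
  assumes "localized_group p G" "localized_group p H"
  shows "localized_group p (G \<times>\<times> H)"
proof -
  interpret G: localized_group p G by fact
  interpret H: localized_group p H by fact
  show ?thesis
    by (intro localized_group.intro DirProd_group G.is_group H.is_group localized_group_axioms.intro)
      (simp_all add: G.prime_p G.finite_carrier H.finite_carrier)
qed

lemma (in localized_group) localized_group_subgroup:
  assumes "subgroup P G"
  shows "localized_group p (G\<lparr>carrier := P\<rparr>)"
  by (intro localized_group.intro localized_group_axioms.intro subgroup_imp_group assms)
    (simp_all add: prime_p finite_subgroup[OF assms])

lemma (in localized_group) subgroup_nonempty_subset:
  "subgroup Q G \<Longrightarrow> Q \<subseteq> carrier G \<and> Q \<noteq> {}"
  using subgroup.subset subgroup.one_closed by blast

lemma (in localized_group) smult_closed: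
  "q \<in> carrier (Z_loc p) \<Longrightarrow> x \<in> carrier (burnside p G) \<Longrightarrow>
    q \<odot>\<^bsub>burnside p G\<^esub> x \<in> carrier (burnside p G)"
  by (rule module.smult_closed[OF module_burnside])

lemma (in localized_group) add_closed:
  "x \<in> carrier (burnside p G) \<Longrightarrow> y \<in> carrier (burnside p G) \<Longrightarrow>
    x \<oplus>\<^bsub>burnside p G\<^esub> y \<in> carrier (burnside p G)"
  by (auto simp: carrier_burnside add_coset formal_sums_add)

text \<open>
  Whatever representatives an extension of an operation on sets is computed from, the isotropy forms
  of its value are the extensions of the isotropy sums of the operation. So well-definedness and
  linearity of such extensions can be read off from their marks.
\<close>

lemma (in localized_group) lift_burnside_closed:
  assumes H: "localized_group p H" and x: "x \<in> carrier (burnside p G)"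
    and v: "\<And>X. is_gset G X \<Longrightarrow> is_gset H (v X)"
  shows "lift_burnside p H v x \<in> carrier (burnside p H)"
    and "isotropy_form H W (lift_burnside p H v x) = lift_rat (\<lambda>X. isotropy_sum H W (v X)) x"
proof -
  interpret H: localized_group p H by fact
  note x' = elem_rep_formal_sum(1)[OF x]
  have rep: "is_gset H (v (class_rep K))" if "K \<in> Poly_Mapping.keys (elem_rep x)" for K
    using x' that by (intro v class_rep_gset is_group) (auto simp: formal_sums_def)
  show "lift_burnside p H v x \<in> carrier (burnside p H)"
    unfolding lift_burnside_def H.carrier_burnside
    by (intro imageI H.formal_sums_sum H.formal_sums_single rep)
      (use x' in \<open>simp_all add: formal_sums_iff\<close>)
  show "isotropy_form H W (lift_burnside p H v x) = lift_rat (\<lambda>X. isotropy_sum H W (v X)) x"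
    unfolding lift_burnside_def lift_rat_def H.isotropy_form_coset linear_extension_sum
      linear_extension_single
    by (intro sum.cong refl) (simp add: rep H.isotropy_sum_class_rep)
qed

lemma isotropy_sum_pullback:
  assumes "group_hom H G \<phi>"
  shows "isotropy_sum H W (gset_pullback \<phi> X) = isotropy_sum G (\<lambda>A. W {h \<in> carrier H. \<phi> h \<in> A}) X"
proof -
  interpret group_hom H G \<phi> by fact
  have "stabilizer H (snd (gset_pullback \<phi> X)) x = {h \<in> carrier H. \<phi> h \<in> stabilizer G (snd X) x}" for x
    by (auto simp: stabilizer_def gset_pullback_def)
  then show ?thesis
    by (simp add: isotropy_sum_def gset_pullback_def)
qed

locale localized_group_hom =
  source: localized_group p H + target: localized_group p G + hom: group_hom H G \<phi>
  for p :: nat and H :: "('h, 'n) monoid_scheme" and G :: "('g, 'm) monoid_scheme" and \<phi>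
begin

lemma is_group_hom: "group_hom H G \<phi>"
  by unfold_locales

lemma restrict_closed:
  assumes "x \<in> carrier (burnside p G)"
  shows "burnside_restrict p H \<phi> x \<in> carrier (burnside p H)"
  unfolding burnside_restrict_def
  by (intro target.lift_burnside_closed(1) source.localized_group_axioms assms
      is_gset_pullback[OF source.is_group is_group_hom])

lemma isotropy_form_restrict:
  assumes "x \<in> carrier (burnside p G)"
  shows "isotropy_form H W (burnside_restrict p H \<phi> x) =
    isotropy_form G (\<lambda>A. W {h \<in> carrier H. \<phi> h \<in> A}) x"
proof -
  have "isotropy_form H W (burnside_restrict p H \<phi> x) =
    lift_rat (\<lambda>X. isotropy_sum H W (gset_pullback \<phi> X)) x"
    unfolding burnside_restrict_def
    by (intro target.lift_burnside_closed(2) source.localized_group_axioms assms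
        is_gset_pullback[OF source.is_group is_group_hom])
  then show ?thesis
    by (simp add: isotropy_form_def isotropy_sum_pullback[OF is_group_hom])
qed

lemma mark_restrict:
  assumes "x \<in> carrier (burnside p G)" "D \<subseteq> carrier H" "D \<noteq> {}"
  shows "mark D (burnside_restrict p H \<phi> x) = mark (\<phi> ` D) x"
proof -
  have "D \<subseteq> {h \<in> carrier H. \<phi> h \<in> A} \<longleftrightarrow> \<phi> ` D \<subseteq> A" for A
    using assms(2) by auto
  moreover have "\<phi> ` D \<subseteq> carrier G"
    using assms(2) by auto
  ultimately show ?thesis
    using assms
    by (simp add: source.mark_eq_isotropy_form restrict_closed isotropy_form_restrict
        target.mark_eq_isotropy_form)
qed

lemma restrict_mod_hom: "burnside_restrict p H \<phi> \<in> mod_homs (Z_loc p) (burnside p G) (burnside p H)"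
  unfolding mod_homs_def
proof (intro CollectI conjI ballI)
  show "burnside_restrict p H \<phi> \<in> carrier (burnside p G) \<rightarrow> carrier (burnside p H)"
    using restrict_closed by blast
next
  fix x y assume xy: "x \<in> carrier (burnside p G)" "y \<in> carrier (burnside p G)"
  show "burnside_restrict p H \<phi> (x \<oplus>\<^bsub>burnside p G\<^esub> y) =
    burnside_restrict p H \<phi> x \<oplus>\<^bsub>burnside p H\<^esub> burnside_restrict p H \<phi> y"
  proof (rule source.marks_injective)
    fix Q assume "subgroup Q H"
    then have "Q \<subseteq> carrier H" "Q \<noteq> {}" "\<phi> ` Q \<subseteq> carrier G" "\<phi> ` Q \<noteq> {}"
      using source.subgroup_nonempty_subset hom.hom_closed by blast+
    with xy show "mark Q (burnside_restrict p H \<phi> (x \<oplus>\<^bsub>burnside p G\<^esub> y)) =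
      mark Q (burnside_restrict p H \<phi> x \<oplus>\<^bsub>burnside p H\<^esub> burnside_restrict p H \<phi> y)"
      by (simp add: mark_restrict source.mark_add restrict_closed target.mark_add target.add_closed)
  qed (use xy in \<open>auto intro: restrict_closed target.add_closed source.add_closed\<close>)
next
  fix r x assume rx: "r \<in> carrier (Z_loc p)" "x \<in> carrier (burnside p G)"
  show "burnside_restrict p H \<phi> (r \<odot>\<^bsub>burnside p G\<^esub> x) =
    r \<odot>\<^bsub>burnside p H\<^esub> burnside_restrict p H \<phi> x"
  proof (rule source.marks_injective)
    fix Q assume "subgroup Q H"
    then have "Q \<subseteq> carrier H" "Q \<noteq> {}" "\<phi> ` Q \<subseteq> carrier G" "\<phi> ` Q \<noteq> {}"
      using source.subgroup_nonempty_subset hom.hom_closed by blast+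
    with rx show "mark Q (burnside_restrict p H \<phi> (r \<odot>\<^bsub>burnside p G\<^esub> x)) =
      mark Q (r \<odot>\<^bsub>burnside p H\<^esub> burnside_restrict p H \<phi> x)"
      by (simp add: mark_restrict source.mark_smult restrict_closed target.mark_smult target.smult_closed)
  qed (use rx in \<open>auto intro: restrict_closed target.smult_closed source.smult_closed\<close>)
qed (rule target.module_burnside source.module_burnside)+

end


section \<open>Composition of bisets\<close>

lemma is_gset_prod:
  assumes "group G" "is_gset G X" "is_gset G Y"
  shows "is_gset G (gset_prod X Y)"
  using is_gsetD(1,3-5)[OF assms(2)] is_gsetD(1,3-5)[OF assms(3)] assms(1)
  by (intro is_gset_intro) (auto simp: gset_prod_def group.is_monoid monoid.m_closed)

locale biset_composition =
  K: localized_group p K + H: localized_group p H + G: localized_group p G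
  for p :: nat and K :: "('k, 'l) monoid_scheme" and H :: "('h, 'n) monoid_scheme"
    and G :: "('g, 'm) monoid_scheme"
begin

sublocale KH: localized_group p "K \<times>\<times> H"
  by (rule localized_group_DirProd[OF K.localized_group_axioms H.localized_group_axioms])

sublocale HG: localized_group p "H \<times>\<times> G"
  by (rule localized_group_DirProd[OF H.localized_group_axioms G.localized_group_axioms])

sublocale KG: localized_group p "K \<times>\<times> G"
  by (rule localized_group_DirProd[OF K.localized_group_axioms G.localized_group_axioms])

text \<open>
  The composition \<open>Y \<circ> X\<close> is the set of orbits of \<open>H\<close> on \<open>Y \<times> X\<close>, where \<open>h\<close> sends \<open>(y, x)\<close> to
  \<open>(y h\<inverse>, h x)\<close>.
\<close>

definition balanced_gset :: "('k \<times> 'h, 'y) gset \<Rightarrow> ('h \<times> 'g, 'x) gset \<Rightarrow> ('h, 'y \<times> 'x) gset" where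
  "balanced_gset Y X = gset_prod
     (gset_pullback (\<lambda>h. (\<one>\<^bsub>K\<^esub>, h)) Y) (gset_pullback (\<lambda>h. (h, \<one>\<^bsub>G\<^esub>)) X)"

text \<open>
  The contribution of a pair \<open>(y, x)\<close>, with stabilizers \<open>A\<close> and \<open>B\<close>, to the number of \<open>D\<close>-fixed
  points of \<open>Y \<circ> X\<close>: its orbit is fixed by \<open>D\<close> iff every \<open>(k, g) \<in> D\<close> can be corrected
  by some \<open>h\<close> so that \<open>(k, h)\<close> fixes \<open>y\<close> and \<open>(h, g)\<close> fixes \<open>x\<close>, and every pair accounts for the
  fraction of the orbit that it makes up.
\<close>

definition composition_weight ::
  "('k \<times> 'g) set \<Rightarrow> ('k \<times> 'h) set \<Rightarrow> ('h \<times> 'g) set \<Rightarrow> rat" where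
  "composition_weight D A B =
     of_bool (\<forall>(k, g)\<in>D. \<exists>h\<in>carrier H. (k, h) \<in> A \<and> (h, g) \<in> B)
     * of_nat (card {h \<in> carrier H. (\<one>\<^bsub>K\<^esub>, h) \<in> A \<and> (h, \<one>\<^bsub>G\<^esub>) \<in> B}) / of_nat (order H)"

context
  fixes Y :: "('k \<times> 'h, 'y) gset" and X :: "('h \<times> 'g, 'x) gset"
  assumes Y: "is_gset (K \<times>\<times> H) Y" and X: "is_gset (H \<times>\<times> G) X"
begin

lemma action_simps:
  "y \<in> fst Y \<Longrightarrow> k \<in> carrier K \<Longrightarrow> k' \<in> carrier K \<Longrightarrow> h \<in> carrier H \<Longrightarrow> h' \<in> carrier H \<Longrightarrow>
    snd Y (k, h) (snd Y (k', h') y) = snd Y (k \<otimes>\<^bsub>K\<^esub> k', h \<otimes>\<^bsub>H\<^esub> h') y"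
  "x \<in> fst X \<Longrightarrow> h \<in> carrier H \<Longrightarrow> h' \<in> carrier H \<Longrightarrow> g \<in> carrier G \<Longrightarrow> g' \<in> carrier G \<Longrightarrow>
    snd X (h, g) (snd X (h', g') x) = snd X (h \<otimes>\<^bsub>H\<^esub> h', g \<otimes>\<^bsub>G\<^esub> g') x"
  "y \<in> fst Y \<Longrightarrow> k \<in> carrier K \<Longrightarrow> h \<in> carrier H \<Longrightarrow> snd Y (k, h) y \<in> fst Y"
  "x \<in> fst X \<Longrightarrow> h \<in> carrier H \<Longrightarrow> g \<in> carrier G \<Longrightarrow> snd X (h, g) x \<in> fst X"
  "y \<in> fst Y \<Longrightarrow> snd Y (\<one>\<^bsub>K\<^esub>, \<one>\<^bsub>H\<^esub>) y = y"
  "x \<in> fst X \<Longrightarrow> snd X (\<one>\<^bsub>H\<^esub>, \<one>\<^bsub>G\<^esub>) x = x"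
  using is_gsetD(3-5)[OF Y] is_gsetD(3-5)[OF X]
  by (simp_all add: mult_DirProd[symmetric] del: mult_DirProd)

lemma fst_balanced: "fst (balanced_gset Y X) = fst Y \<times> fst X"
  by (simp add: balanced_gset_def gset_prod_def gset_pullback_def)

lemma snd_balanced:
  "y \<in> fst Y \<Longrightarrow> x \<in> fst X \<Longrightarrow>
    snd (balanced_gset Y X) h (y, x) = (snd Y (\<one>\<^bsub>K\<^esub>, h) y, snd X (h, \<one>\<^bsub>G\<^esub>) x)"
  by (simp add: balanced_gset_def gset_prod_def gset_pullback_def)

lemma is_gset_balanced: "is_gset H (balanced_gset Y X)"
  unfolding balanced_gset_def
proof (intro is_gset_prod is_gset_pullback)
  show "group_hom H (K \<times>\<times> H) (\<lambda>h. (\<one>\<^bsub>K\<^esub>, h))"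
    by (intro group_hom.intro group_hom_axioms.intro H.is_group KH.is_group homI) auto
  show "group_hom H (H \<times>\<times> G) (\<lambda>h. (h, \<one>\<^bsub>G\<^esub>))"
    by (intro group_hom.intro group_hom_axioms.intro H.is_group HG.is_group homI) auto
qed (rule H.is_group Y X)+

abbreviation balanced_orbit :: "'y \<times> 'x \<Rightarrow> ('y \<times> 'x) set" where
  "balanced_orbit \<equiv> orbit H (snd (balanced_gset Y X))"

interpretation balanced: group_action H "fst Y \<times> fst X" "snd (balanced_gset Y X)"
  using is_gsetD(2)[OF is_gset_balanced] by (simp add: fst_balanced)

lemma balanced_orbit_eq:
  "y \<in> fst Y \<Longrightarrow> x \<in> fst X \<Longrightarrow>
    balanced_orbit (y, x) = {(snd Y (\<one>\<^bsub>K\<^esub>, h) y, snd X (h, \<one>\<^bsub>G\<^esub>) x) | h. h \<in> carrier H}"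
  by (auto simp: orbit_def snd_balanced)

lemma balanced_class:
  assumes "y \<in> fst Y" "x \<in> fst X"
  shows "balanced_rel K H G Y X `` {(y, x)} = balanced_orbit (y, x)"
proof (intro equalityI subsetI)
  fix z assume "z \<in> balanced_rel K H G Y X `` {(y, x)}"
  then obtain y' h where h: "y' \<in> fst Y" "h \<in> carrier H"
    and y: "y = snd Y (\<one>\<^bsub>K\<^esub>, inv\<^bsub>H\<^esub> h) y'" and z: "z = (y', snd X (h, \<one>\<^bsub>G\<^esub>) x)"
    by (auto simp: balanced_rel_def)
  have "snd Y (\<one>\<^bsub>K\<^esub>, h) y = y'"
    using h unfolding y by (simp add: action_simps)
  then show "z \<in> balanced_orbit (y, x)"
    using h z assms by (auto simp: balanced_orbit_eq)
next
  fix z assume "z \<in> balanced_orbit (y, x)"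
  then obtain h where h: "h \<in> carrier H" and z: "z = (snd Y (\<one>\<^bsub>K\<^esub>, h) y, snd X (h, \<one>\<^bsub>G\<^esub>) x)"
    using assms by (auto simp: balanced_orbit_eq)
  have "y = snd Y (\<one>\<^bsub>K\<^esub>, inv\<^bsub>H\<^esub> h) (snd Y (\<one>\<^bsub>K\<^esub>, h) y)" "snd Y (\<one>\<^bsub>K\<^esub>, h) y \<in> fst Y"
    using h assms by (simp_all add: action_simps)
  then have "((y, x), z) \<in> balanced_rel K H G Y X"
    unfolding balanced_rel_def z using h assms(2) by blast
  then show "z \<in> balanced_rel K H G Y X `` {(y, x)}"
    by blast
qed

lemma fst_biset_comp: "fst (biset_comp K H G Y X) = orbits H (fst Y \<times> fst X) (snd (balanced_gset Y X))"
  by (force simp: biset_comp_def Let_def orbits_def quotient_def balanced_class)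

lemma orbit_in_biset_comp:
  "y \<in> fst Y \<Longrightarrow> x \<in> fst X \<Longrightarrow> balanced_orbit (y, x) \<in> fst (biset_comp K H G Y X)"
  unfolding fst_biset_comp orbits_def by blast

lemma biset_comp_elem:
  assumes "C \<in> fst (biset_comp K H G Y X)"
  obtains y x where "y \<in> fst Y" "x \<in> fst X" "C = balanced_orbit (y, x)"
  using assms unfolding fst_biset_comp orbits_def by blast

lemma finite_orbits: "finite (orbits H (fst Y \<times> fst X) (snd (balanced_gset Y X)))"
proof -
  have "orbits H (fst Y \<times> fst X) (snd (balanced_gset Y X)) = balanced_orbit ` (fst Y \<times> fst X)"
    unfolding orbits_def by blast
  then show ?thesis
    using is_gsetD(1)[OF Y] is_gsetD(1)[OF X] by simp
qed

lemma snd_biset_comp: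
  assumes y: "y \<in> fst Y" and x: "x \<in> fst X" and k: "k \<in> carrier K" and g: "g \<in> carrier G"
  shows "snd (biset_comp K H G Y X) (k, g) (balanced_orbit (y, x)) =
    balanced_orbit (snd Y (k, \<one>\<^bsub>H\<^esub>) y, snd X (\<one>\<^bsub>H\<^esub>, g) x)"
proof -
  have "balanced_orbit (y, x) \<in> fst (biset_comp K H G Y X)"
    using y x by (rule orbit_in_biset_comp)
  then have "snd (biset_comp K H G Y X) (k, g) (balanced_orbit (y, x)) =
    map_prod (snd Y (k, \<one>\<^bsub>H\<^esub>)) (snd X (\<one>\<^bsub>H\<^esub>, g)) ` balanced_orbit (y, x)"
    by (simp add: biset_comp_def Let_def)
  also have "\<dots> = (\<lambda>h. (snd Y (k, h) y, snd X (h, g) x)) ` carrier H"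
    using y x k g by (force simp: balanced_orbit_eq action_simps image_def)
  also have "\<dots> = balanced_orbit (snd Y (k, \<one>\<^bsub>H\<^esub>) y, snd X (\<one>\<^bsub>H\<^esub>, g) x)"
    using y x k g by (force simp: balanced_orbit_eq action_simps image_def)
  finally show ?thesis .
qed

lemma is_gset_biset_comp: "is_gset (K \<times>\<times> G) (biset_comp K H G Y X)"
proof (rule is_gset_intro)
  show "finite (fst (biset_comp K H G Y X))"
    using is_gsetD(1)[OF Y] is_gsetD(1)[OF X]
    by (simp add: fst_biset_comp finite_orbits)
next
  fix d assume "d \<in> carrier (K \<times>\<times> G)"
  then show "snd (biset_comp K H G Y X) d \<in> extensional (fst (biset_comp K H G Y X))"
    by (cases d) (simp add: biset_comp_def Let_def)
next
  fix d C assume "d \<in> carrier (K \<times>\<times> G)" "C \<in> fst (biset_comp K H G Y X)"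
  then show "snd (biset_comp K H G Y X) d C \<in> fst (biset_comp K H G Y X)"
    by (cases d) (auto elim!: biset_comp_elem simp: snd_biset_comp action_simps intro!: orbit_in_biset_comp)
next
  fix C assume "C \<in> fst (biset_comp K H G Y X)"
  then show "snd (biset_comp K H G Y X) \<one>\<^bsub>K \<times>\<times> G\<^esub> C = C"
    by (auto simp: fst_biset_comp orbits_def snd_biset_comp action_simps)
next
  fix d e C
  assume "d \<in> carrier (K \<times>\<times> G)" "e \<in> carrier (K \<times>\<times> G)" "C \<in> fst (biset_comp K H G Y X)"
  then show "snd (biset_comp K H G Y X) (d \<otimes>\<^bsub>K \<times>\<times> G\<^esub> e) C =
    snd (biset_comp K H G Y X) d (snd (biset_comp K H G Y X) e C)"
    by (cases d; cases e) (auto simp: fst_biset_comp orbits_def snd_biset_comp action_simps)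
qed (rule KG.is_group)

lemma balanced_orbit_fixed_iff:
  assumes y: "y \<in> fst Y" and x: "x \<in> fst X" and k: "k \<in> carrier K" and g: "g \<in> carrier G"
  shows "snd (biset_comp K H G Y X) (k, g) (balanced_orbit (y, x)) = balanced_orbit (y, x) \<longleftrightarrow>
    (\<exists>h\<in>carrier H. (k, h) \<in> stabilizer (K \<times>\<times> H) (snd Y) y \<and> (h, g) \<in> stabilizer (H \<times>\<times> G) (snd X) x)"
proof -
  let ?z = "(snd Y (k, \<one>\<^bsub>H\<^esub>) y, snd X (\<one>\<^bsub>H\<^esub>, g) x)"
  have z: "?z \<in> fst Y \<times> fst X"
    using assms by (simp add: action_simps)
  have "balanced_orbit ?z = balanced_orbit (y, x) \<longleftrightarrow> ?z \<in> balanced_orbit (y, x)"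
  proof
    assume "balanced_orbit ?z = balanced_orbit (y, x)"
    then show "?z \<in> balanced_orbit (y, x)"
      using balanced.orbit_refl[OF z] by simp
  next
    assume "?z \<in> balanced_orbit (y, x)"
    moreover have "?z \<in> balanced_orbit ?z"
      using balanced.orbit_refl[OF z] .
    moreover have "balanced_orbit ?z \<in> orbits H (fst Y \<times> fst X) (snd (balanced_gset Y X))"
      "balanced_orbit (y, x) \<in> orbits H (fst Y \<times> fst X) (snd (balanced_gset Y X))"
      using z y x by (auto simp: orbits_def)
    ultimately show "balanced_orbit ?z = balanced_orbit (y, x)"
      using balanced.disjoint_union by blast
  qed
  also have "\<dots> \<longleftrightarrow> (\<exists>h\<in>carrier H. snd Y (k, h) y = y \<and> snd X (h, g) x = x)"
  proof
    assume "?z \<in> balanced_orbit (y, x)"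
    then obtain h where h: "h \<in> carrier H" "snd Y (k, \<one>\<^bsub>H\<^esub>) y = snd Y (\<one>\<^bsub>K\<^esub>, h) y"
      "snd X (\<one>\<^bsub>H\<^esub>, g) x = snd X (h, \<one>\<^bsub>G\<^esub>) x"
      using y x by (auto simp: balanced_orbit_eq)
    have "snd Y (k, inv\<^bsub>H\<^esub> h) y = snd Y (\<one>\<^bsub>K\<^esub>, inv\<^bsub>H\<^esub> h) (snd Y (k, \<one>\<^bsub>H\<^esub>) y)"
      "snd X (inv\<^bsub>H\<^esub> h, g) x = snd X (inv\<^bsub>H\<^esub> h, \<one>\<^bsub>G\<^esub>) (snd X (\<one>\<^bsub>H\<^esub>, g) x)"
      using h(1) assms by (simp_all add: action_simps)
    then have "snd Y (k, inv\<^bsub>H\<^esub> h) y = y \<and> snd X (inv\<^bsub>H\<^esub> h, g) x = x"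
      unfolding h(2,3) using h(1) assms by (simp add: action_simps)
    then show "\<exists>h\<in>carrier H. snd Y (k, h) y = y \<and> snd X (h, g) x = x"
      using h(1) by blast
  next
    assume "\<exists>h\<in>carrier H. snd Y (k, h) y = y \<and> snd X (h, g) x = x"
    then obtain h where h: "h \<in> carrier H" "snd Y (k, h) y = y" "snd X (h, g) x = x"
      by blast
    have "snd Y (\<one>\<^bsub>K\<^esub>, inv\<^bsub>H\<^esub> h) (snd Y (k, h) y) = snd Y (k, \<one>\<^bsub>H\<^esub>) y"
      "snd X (inv\<^bsub>H\<^esub> h, \<one>\<^bsub>G\<^esub>) (snd X (h, g) x) = snd X (\<one>\<^bsub>H\<^esub>, g) x"
      using h(1) assms by (simp_all add: action_simps)
    then show "?z \<in> balanced_orbit (y, x)"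
      using h y x by (auto simp: balanced_orbit_eq intro!: exI[of _ "inv\<^bsub>H\<^esub> h"])
  qed
  finally show ?thesis
    using assms by (simp add: snd_biset_comp stabilizer_def)
qed

lemma card_fixed_points_biset_comp:
  assumes D: "D \<subseteq> carrier (K \<times>\<times> G)" "D \<noteq> {}"
  shows "of_nat (card (fixed_points D (biset_comp K H G Y X))) =
    isotropy_sum (K \<times>\<times> H) (\<lambda>A. isotropy_sum (H \<times>\<times> G) (composition_weight D A) X) Y"
proof -
  let ?C = "biset_comp K H G Y X" and ?orbits = "orbits H (fst Y \<times> fst X) (snd (balanced_gset Y X))"
  have fin: "finite (fst Y \<times> fst X)"
    using is_gsetD(1)[OF Y] is_gsetD(1)[OF X] by simp
  define good where "good C \<longleftrightarrow> (\<forall>d\<in>D. snd ?C d C = C)" for C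
  define w :: "('y \<times> 'x) set \<Rightarrow> rat" where "w C = of_bool (good C) / of_nat (card C)" for C
  have orbit_sum: "(\<Sum>z\<in>C. w (balanced_orbit z)) = of_bool (good C)" if C: "C \<in> ?orbits" for C
  proof -
    obtain z where z: "z \<in> fst Y \<times> fst X" "C = balanced_orbit z"
      using C by (auto simp: orbits_def)
    have "z \<in> C" "C \<subseteq> fst Y \<times> fst X"
      using balanced.orbit_refl[OF z(1)] z(2) C balanced.orbits_coverture by auto
    then have "card C \<noteq> 0"
      using finite_subset[OF _ fin] by auto
    moreover have "balanced_orbit u = C" if "u \<in> C" for u
    proof -
      have u: "u \<in> fst Y \<times> fst X"
        using that \<open>C \<subseteq> _\<close> by blast
      then have "balanced_orbit u \<in> ?orbits"
        by (auto simp: orbits_def)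
      then show ?thesis
        using balanced.disjoint_union[OF C] balanced.orbit_refl[OF u] that by blast
    qed
    ultimately show ?thesis
      by (simp add: w_def)
  qed
  have weight: "w (balanced_orbit (y, x)) = composition_weight D
      (stabilizer (K \<times>\<times> H) (snd Y) y) (stabilizer (H \<times>\<times> G) (snd X) x)"
    if y: "y \<in> fst Y" and x: "x \<in> fst X" for y x
  proof -
    let ?stab = "{h \<in> carrier H. (\<one>\<^bsub>K\<^esub>, h) \<in> stabilizer (K \<times>\<times> H) (snd Y) y \<and>
      (h, \<one>\<^bsub>G\<^esub>) \<in> stabilizer (H \<times>\<times> G) (snd X) x}"
    have "stabilizer H (snd (balanced_gset Y X)) (y, x) = ?stab"
      using y x by (auto simp: stabilizer_def snd_balanced)
    then have os: "card (balanced_orbit (y, x)) * card ?stab = order H"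
      using balanced.orbit_stabilizer_theorem[of "(y, x)"] y x by simp
    have "order H \<noteq> 0"
      using H.finite_carrier by (simp add: order_def card_gt_0_iff) blast
    with os have "card (balanced_orbit (y, x)) \<noteq> 0"
      by (metis mult_0)
    moreover have "of_nat (card (balanced_orbit (y, x))) * of_nat (card ?stab) = (of_nat (order H) :: rat)"
      unfolding os[symmetric] by simp
    ultimately have "(1 :: rat) / of_nat (card (balanced_orbit (y, x))) =
        of_nat (card ?stab) / of_nat (order H)"
      using \<open>order H \<noteq> 0\<close> by (simp add: frac_eq_eq mult.commute)
    moreover have "good (balanced_orbit (y, x)) \<longleftrightarrow> (\<forall>(k, g)\<in>D. \<exists>h\<in>carrier H.
      (k, h) \<in> stabilizer (K \<times>\<times> H) (snd Y) y \<and> (h, g) \<in> stabilizer (H \<times>\<times> G) (snd X) x)"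
      unfolding good_def using D(1) balanced_orbit_fixed_iff[OF y x]
      by (intro ball_cong) auto
    ultimately show ?thesis
      unfolding w_def composition_weight_def by (simp add: field_simps)
  qed
  have "fixed_points D ?C = {C \<in> ?orbits. good C}"
    using D(2) by (auto simp: fixed_points_def invariants_def fst_biset_comp good_def)
  then have "of_nat (card (fixed_points D ?C)) = (\<Sum>C\<in>?orbits. of_bool (good C) :: rat)"
    by (simp add: of_bool_def sum.If_cases Int_def finite_orbits)
  also have "\<dots> = (\<Sum>C\<in>?orbits. \<Sum>z\<in>C. w (balanced_orbit z))"
    by (simp add: orbit_sum)
  also have "\<dots> = (\<Sum>z\<in>fst Y \<times> fst X. w (balanced_orbit z))"
    by (rule balanced.disjoint_sum[OF fin])
  also have "\<dots> = (\<Sum>y\<in>fst Y. \<Sum>x\<in>fst X. w (balanced_orbit (y, x)))"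
    by (simp add: sum.cartesian_product)
  also have "\<dots> = isotropy_sum (K \<times>\<times> H) (\<lambda>A. isotropy_sum (H \<times>\<times> G) (composition_weight D A) X) Y"
    unfolding isotropy_sum_def by (intro sum.cong refl weight)
  finally show ?thesis .
qed

end

lemma comp_closed:
  assumes y: "y \<in> carrier (burnside p (K \<times>\<times> H))" and x: "x \<in> carrier (burnside p (H \<times>\<times> G))"
  shows "burnside_comp p K H G y x \<in> carrier (burnside p (K \<times>\<times> G))"
proof -
  note y' = KH.elem_rep_formal_sum(1)[OF y] and x' = HG.elem_rep_formal_sum(1)[OF x]
  show ?thesis
    unfolding burnside_comp_def lift2_burnside_def KG.carrier_burnside
    by (intro imageI KG.formal_sums_sum KG.formal_sums_single is_gset_biset_comp)
      (use y' x' class_rep_gset[OF KH.is_group] class_rep_gset[OF HG.is_group] in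
        \<open>auto simp: KH.formal_sums_iff HG.formal_sums_iff intro!: Z_loc_mult K.prime_p\<close>)
qed

text \<open>
  Both extensions are sums over representatives and their points, so the double sum over pairs \<open>(y, x)\<close>
  can be arranged as one isotropy form inside another. In this shape it is linear in each argument,
  and the weight can be replaced by any other that agrees with it on the stabilizers that occur.
\<close>

theorem mark_comp:
  assumes y: "y \<in> carrier (burnside p (K \<times>\<times> H))" and x: "x \<in> carrier (burnside p (H \<times>\<times> G))"
    and D: "D \<subseteq> carrier (K \<times>\<times> G)" "D \<noteq> {}"
  shows "mark D (burnside_comp p K H G y x) =
    isotropy_form (K \<times>\<times> H) (\<lambda>A. isotropy_form (H \<times>\<times> G) (composition_weight D A) x) y"
proof -
  let ?y = "elem_rep y" and ?x = "elem_rep x"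
  let ?W = "composition_weight D"
  note y' = KH.elem_rep_formal_sum(1)[OF y] and x' = HG.elem_rep_formal_sum(1)[OF x]
  have rep: "is_gset (K \<times>\<times> H) (class_rep L)" "is_gset (H \<times>\<times> G) (class_rep M)"
    if "L \<in> Poly_Mapping.keys ?y" "M \<in> Poly_Mapping.keys ?x" for L M
    using that y' x' class_rep_gset[OF KH.is_group] class_rep_gset[OF HG.is_group]
    by (auto simp: formal_sums_def)
  have "mark D (burnside_comp p K H G y x) =
    isotropy_form (K \<times>\<times> G) (\<lambda>A. of_bool (D \<subseteq> A)) (burnside_comp p K H G y x)"
    by (rule KG.mark_eq_isotropy_form[OF comp_closed[OF y x] D])
  also have "\<dots> = (\<Sum>L\<in>Poly_Mapping.keys ?y. \<Sum>M\<in>Poly_Mapping.keys ?x.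
      Poly_Mapping.lookup ?y L * Poly_Mapping.lookup ?x M *
      isotropy_sum (K \<times>\<times> H) (\<lambda>A. isotropy_sum (H \<times>\<times> G) (?W A) (class_rep M)) (class_rep L))"
    unfolding burnside_comp_def lift2_burnside_def KG.isotropy_form_coset linear_extension_sum
      linear_extension_single
  proof (intro sum.cong refl arg_cong2[of _ _ _ _ "(*)"])
    fix L M assume LM: "L \<in> Poly_Mapping.keys ?y" "M \<in> Poly_Mapping.keys ?x"
    note g = is_gset_biset_comp[OF rep[OF LM]]
    show "isotropy_sum (K \<times>\<times> G) (\<lambda>A. of_bool (D \<subseteq> A)) (class_rep (iso_class (K \<times>\<times> G)
        (biset_comp K H G (class_rep L) (class_rep M)))) =
      isotropy_sum (K \<times>\<times> H) (\<lambda>A. isotropy_sum (H \<times>\<times> G) (?W A) (class_rep M)) (class_rep L)"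
      using card_fixed_points[OF is_gsetD(1)[OF g] D]
      by (simp add: KG.isotropy_sum_class_rep[OF g] card_fixed_points_biset_comp[OF rep[OF LM] D])
  qed
  also have "\<dots> = (\<Sum>L\<in>Poly_Mapping.keys ?y. Poly_Mapping.lookup ?y L *
      isotropy_sum (K \<times>\<times> H) (\<lambda>A. \<Sum>M\<in>Poly_Mapping.keys ?x. Poly_Mapping.lookup ?x M *
        isotropy_sum (H \<times>\<times> G) (?W A) (class_rep M)) (class_rep L))"
  proof (rule sum.cong)
    fix L
    show "(\<Sum>M\<in>Poly_Mapping.keys ?x. Poly_Mapping.lookup ?y L * Poly_Mapping.lookup ?x M *
        isotropy_sum (K \<times>\<times> H) (\<lambda>A. isotropy_sum (H \<times>\<times> G) (?W A) (class_rep M)) (class_rep L)) =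
      Poly_Mapping.lookup ?y L * isotropy_sum (K \<times>\<times> H) (\<lambda>A. \<Sum>M\<in>Poly_Mapping.keys ?x.
        Poly_Mapping.lookup ?x M * isotropy_sum (H \<times>\<times> G) (?W A) (class_rep M)) (class_rep L)"
      unfolding isotropy_sum_def[of "K \<times>\<times> H"] sum_distrib_left mult.assoc
      by (rule sum.swap)
  qed simp
  finally show ?thesis
    by (simp add: linear_extension_def KH.isotropy_form_eq_sum
        HG.isotropy_form_eq_sum)
qed

text \<open>
  Composition with \<open>[G, \<phi>]\<close> on the right is restriction along \<open>id \<times> \<phi>\<close>. As \<open>[G, \<phi>]\<close> is a
  transitive set, its stabilizers are the conjugates of the graph of \<open>\<phi>\<close>, and after the conjugation
  has been moved to the other factor, where marks do not see it, all of them contribute the same.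
\<close>

lemma mark_comp_graph_right:
  assumes hom: "group_hom G H \<phi>" and y: "y \<in> carrier (burnside p (K \<times>\<times> H))"
    and D: "D \<subseteq> carrier (K \<times>\<times> G)" "D \<noteq> {}"
  shows "mark D (burnside_comp p K H G y
      (burnside_class p (H \<times>\<times> G) (coset_gset (H \<times>\<times> G) ((\<lambda>g. (\<phi> g, g)) ` carrier G)))) =
    mark ((\<lambda>(k, g). (k, \<phi> g)) ` D) y"
proof -
  interpret hom: group_hom G H \<phi> by fact
  let ?E = "(\<lambda>g. (\<phi> g, g)) ` carrier G" and ?D = "(\<lambda>(k, g). (k, \<phi> g)) ` D"
  let ?img = "\<lambda>(s, u). (\<lambda>(k, g). (k, s \<otimes>\<^bsub>H\<^esub> \<phi> (inv\<^bsub>G\<^esub> u \<otimes>\<^bsub>G\<^esub> g \<otimes>\<^bsub>G\<^esub> u) \<otimes>\<^bsub>H\<^esub> inv\<^bsub>H\<^esub> s)) ` D"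
  have "group_hom G (H \<times>\<times> G) (\<lambda>g. (\<phi> g, g))"
    by (intro group_hom.intro group_hom_axioms.intro G.is_group HG.is_group homI) auto
  then have E: "subgroup ?E (H \<times>\<times> G)"
    by (rule group_hom.img_is_subgroup)
  have cardE: "card ?E = order G"
    unfolding order_def by (rule card_image) (auto intro: inj_onI)
  have mem: "(h, g) \<in> HG.conj_set (s, u) ?E \<longleftrightarrow>
      g \<in> carrier G \<and> h = s \<otimes>\<^bsub>H\<^esub> \<phi> (inv\<^bsub>G\<^esub> u \<otimes>\<^bsub>G\<^esub> g \<otimes>\<^bsub>G\<^esub> u) \<otimes>\<^bsub>H\<^esub> inv\<^bsub>H\<^esub> s"
    if s: "s \<in> carrier H" and u: "u \<in> carrier G" for s u h g
  proof
    assume "(h, g) \<in> HG.conj_set (s, u) ?E"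
    then obtain v where v: "v \<in> carrier G" "h = s \<otimes>\<^bsub>H\<^esub> \<phi> v \<otimes>\<^bsub>H\<^esub> inv\<^bsub>H\<^esub> s"
      "g = u \<otimes>\<^bsub>G\<^esub> v \<otimes>\<^bsub>G\<^esub> inv\<^bsub>G\<^esub> u"
      using s u by (auto simp: inv_DirProd[OF H.is_group G.is_group])
    then have veq: "v = inv\<^bsub>G\<^esub> u \<otimes>\<^bsub>G\<^esub> g \<otimes>\<^bsub>G\<^esub> u"
      using u by (simp add: G.m_assoc) (simp add: G.m_assoc[symmetric])
    show "g \<in> carrier G \<and> h = s \<otimes>\<^bsub>H\<^esub> \<phi> (inv\<^bsub>G\<^esub> u \<otimes>\<^bsub>G\<^esub> g \<otimes>\<^bsub>G\<^esub> u) \<otimes>\<^bsub>H\<^esub> inv\<^bsub>H\<^esub> s"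
      unfolding veq[symmetric] using v u by simp
  next
    assume hg: "g \<in> carrier G \<and> h = s \<otimes>\<^bsub>H\<^esub> \<phi> (inv\<^bsub>G\<^esub> u \<otimes>\<^bsub>G\<^esub> g \<otimes>\<^bsub>G\<^esub> u) \<otimes>\<^bsub>H\<^esub> inv\<^bsub>H\<^esub> s"
    let ?v = "inv\<^bsub>G\<^esub> u \<otimes>\<^bsub>G\<^esub> g \<otimes>\<^bsub>G\<^esub> u"
    have v: "g = u \<otimes>\<^bsub>G\<^esub> ?v \<otimes>\<^bsub>G\<^esub> inv\<^bsub>G\<^esub> u" "?v \<in> carrier G"
      using hg u by (simp add: G.m_assoc, simp add: G.m_assoc[symmetric]) (use hg u in simp)
    show "(h, g) \<in> HG.conj_set (s, u) ?E"
    proof (rule image_eqI)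
      show "(h, g) = (s, u) \<otimes>\<^bsub>H \<times>\<times> G\<^esub> (\<phi> ?v, ?v) \<otimes>\<^bsub>H \<times>\<times> G\<^esub> inv\<^bsub>H \<times>\<times> G\<^esub> (s, u)"
        using hg v(1) s u by (simp add: inv_DirProd[OF H.is_group G.is_group])
      show "(\<phi> ?v, ?v) \<in> ?E"
        using v(2) by (rule image_eqI[OF refl])
    qed
  qed
  have weight: "composition_weight D A (HG.conj_set z ?E) = of_bool (?img z \<subseteq> A) / of_nat (order H)"
    if A: "subgroup A (K \<times>\<times> H)" and z: "z \<in> carrier (H \<times>\<times> G)" for A z
  proof -
    obtain s u where su: "z = (s, u)" "s \<in> carrier H" "u \<in> carrier G"
      using z by auto
    have "(h, \<one>\<^bsub>G\<^esub>) \<in> HG.conj_set (s, u) ?E \<longleftrightarrow> h = \<one>\<^bsub>H\<^esub>" for h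
      unfolding mem[OF su(2,3)] using su by simp
    then have "{h \<in> carrier H. (\<one>\<^bsub>K\<^esub>, h) \<in> A \<and> (h, \<one>\<^bsub>G\<^esub>) \<in> HG.conj_set (s, u) ?E} = {\<one>\<^bsub>H\<^esub>}"
      using subgroup.one_closed[OF A] H.one_closed unfolding one_DirProd by blast
    moreover have "(\<exists>h\<in>carrier H. (k, h) \<in> A \<and> (h, g) \<in> HG.conj_set (s, u) ?E) \<longleftrightarrow>
        (k, s \<otimes>\<^bsub>H\<^esub> \<phi> (inv\<^bsub>G\<^esub> u \<otimes>\<^bsub>G\<^esub> g \<otimes>\<^bsub>G\<^esub> u) \<otimes>\<^bsub>H\<^esub> inv\<^bsub>H\<^esub> s) \<in> A" if "(k, g) \<in> D" for k g
      unfolding mem[OF su(2,3)] using that D(1) su by auto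
    then have "(\<forall>(k, g)\<in>D. \<exists>h\<in>carrier H. (k, h) \<in> A \<and> (h, g) \<in> HG.conj_set (s, u) ?E) \<longleftrightarrow>
        ?img (s, u) \<subseteq> A"
      by (simp add: image_subset_iff case_prod_unfold cong: ball_cong)
    ultimately show ?thesis
      by (simp add: composition_weight_def su(1))
  qed
  have D': "?D \<subseteq> carrier (K \<times>\<times> H)" "?D \<noteq> {}"
    using D by auto
  have mark_img: "mark (?img z) y = mark ?D y" if z: "z \<in> carrier (H \<times>\<times> G)" for z
  proof -
    obtain s u where su: "z = (s, u)" "s \<in> carrier H" "u \<in> carrier G"
      using z by auto
    \<comment> \<open>Pulling \<open>u\<close> through \<open>\<phi>\<close> turns both conjugations into a single one in \<open>H\<close>.\<close>
    let ?t = "(\<one>\<^bsub>K\<^esub>, s \<otimes>\<^bsub>H\<^esub> inv\<^bsub>H\<^esub> \<phi> u)"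
    have "(\<lambda>(k, g). (k, s \<otimes>\<^bsub>H\<^esub> \<phi> (inv\<^bsub>G\<^esub> u \<otimes>\<^bsub>G\<^esub> g \<otimes>\<^bsub>G\<^esub> u) \<otimes>\<^bsub>H\<^esub> inv\<^bsub>H\<^esub> s)) d =
        ?t \<otimes>\<^bsub>K \<times>\<times> H\<^esub> (\<lambda>(k, g). (k, \<phi> g)) d \<otimes>\<^bsub>K \<times>\<times> H\<^esub> inv\<^bsub>K \<times>\<times> H\<^esub> ?t" if "d \<in> D" for d
      using D(1) that su
      by (auto simp: inv_DirProd[OF K.is_group H.is_group] H.inv_mult_group H.m_assoc)
    then have "?img z = KH.conj_set ?t ?D"
      unfolding su(1) image_image by simp
    then show ?thesis
      using KH.mark_conj[OF y D', of ?t] su by simp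
  qed
  have img: "?img z \<subseteq> carrier (K \<times>\<times> H)" "?img z \<noteq> {}" if "z \<in> carrier (H \<times>\<times> G)" for z
    using that D by auto
  have "mark D (burnside_comp p K H G y (burnside_class p (H \<times>\<times> G) (coset_gset (H \<times>\<times> G) ?E))) =
    isotropy_form (K \<times>\<times> H) (\<lambda>A. (\<Sum>z\<in>carrier (H \<times>\<times> G). of_bool (?img z \<subseteq> A))
      / of_nat (order H) / of_nat (order G)) y"
    unfolding mark_comp[OF y HG.burnside_class_closed[OF HG.is_gset_coset[OF E]] D]
      HG.isotropy_form_coset_class[OF E] cardE
    by (intro KH.isotropy_form_cong[OF y]) (simp add: weight sum_divide_distrib del: carrier_DirProd)
  also have "\<dots> = (\<Sum>z\<in>carrier (H \<times>\<times> G). mark (?img z) y) / of_nat (order H) / of_nat (order G)"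
    unfolding KH.isotropy_form_weight_mult KH.isotropy_form_weight_sum
    using KH.mark_eq_isotropy_form[OF y img] by simp
  also have "\<dots> = mark ?D y"
    using mark_img H.finite_carrier G.finite_carrier H.one_closed G.one_closed
    by (auto simp: order_def card_cartesian_product simp del: H.one_closed G.one_closed)
  finally show ?thesis .
qed

text \<open>
  The mirror image: composition with the transposed graph of \<open>\<phi>\<close> on the left is restriction along
  \<open>\<phi> \<times> id\<close>.
\<close>

lemma mark_comp_graph_left:
  assumes hom: "group_hom K H \<phi>" and x: "x \<in> carrier (burnside p (H \<times>\<times> G))"
    and D: "D \<subseteq> carrier (K \<times>\<times> G)" "D \<noteq> {}"
  shows "mark D (burnside_comp p K H G
      (burnside_class p (K \<times>\<times> H) (coset_gset (K \<times>\<times> H) ((\<lambda>k. (k, \<phi> k)) ` carrier K))) x) =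
    mark ((\<lambda>(k, g). (\<phi> k, g)) ` D) x"
proof -
  interpret hom: group_hom K H \<phi> by fact
  let ?E = "(\<lambda>k. (k, \<phi> k)) ` carrier K" and ?D = "(\<lambda>(k, g). (\<phi> k, g)) ` D"
  let ?img = "\<lambda>(u, s). (\<lambda>(k, g). (s \<otimes>\<^bsub>H\<^esub> \<phi> (inv\<^bsub>K\<^esub> u \<otimes>\<^bsub>K\<^esub> k \<otimes>\<^bsub>K\<^esub> u) \<otimes>\<^bsub>H\<^esub> inv\<^bsub>H\<^esub> s, g)) ` D"
  have "group_hom K (K \<times>\<times> H) (\<lambda>k. (k, \<phi> k))"
    by (intro group_hom.intro group_hom_axioms.intro K.is_group KH.is_group homI) auto
  then have E: "subgroup ?E (K \<times>\<times> H)"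
    by (rule group_hom.img_is_subgroup)
  have cardE: "card ?E = order K"
    unfolding order_def by (rule card_image) (auto intro: inj_onI)
  have mem: "(k, h) \<in> KH.conj_set (u, s) ?E \<longleftrightarrow>
      k \<in> carrier K \<and> h = s \<otimes>\<^bsub>H\<^esub> \<phi> (inv\<^bsub>K\<^esub> u \<otimes>\<^bsub>K\<^esub> k \<otimes>\<^bsub>K\<^esub> u) \<otimes>\<^bsub>H\<^esub> inv\<^bsub>H\<^esub> s"
    if s: "s \<in> carrier H" and u: "u \<in> carrier K" for s u h k
  proof
    assume "(k, h) \<in> KH.conj_set (u, s) ?E"
    then obtain v where v: "v \<in> carrier K" "h = s \<otimes>\<^bsub>H\<^esub> \<phi> v \<otimes>\<^bsub>H\<^esub> inv\<^bsub>H\<^esub> s"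
      "k = u \<otimes>\<^bsub>K\<^esub> v \<otimes>\<^bsub>K\<^esub> inv\<^bsub>K\<^esub> u"
      using s u by (auto simp: inv_DirProd[OF K.is_group H.is_group])
    then have veq: "v = inv\<^bsub>K\<^esub> u \<otimes>\<^bsub>K\<^esub> k \<otimes>\<^bsub>K\<^esub> u"
      using u by (simp add: K.m_assoc) (simp add: K.m_assoc[symmetric])
    show "k \<in> carrier K \<and> h = s \<otimes>\<^bsub>H\<^esub> \<phi> (inv\<^bsub>K\<^esub> u \<otimes>\<^bsub>K\<^esub> k \<otimes>\<^bsub>K\<^esub> u) \<otimes>\<^bsub>H\<^esub> inv\<^bsub>H\<^esub> s"
      unfolding veq[symmetric] using v u by simp
  next
    assume hk: "k \<in> carrier K \<and> h = s \<otimes>\<^bsub>H\<^esub> \<phi> (inv\<^bsub>K\<^esub> u \<otimes>\<^bsub>K\<^esub> k \<otimes>\<^bsub>K\<^esub> u) \<otimes>\<^bsub>H\<^esub> inv\<^bsub>H\<^esub> s"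
    let ?v = "inv\<^bsub>K\<^esub> u \<otimes>\<^bsub>K\<^esub> k \<otimes>\<^bsub>K\<^esub> u"
    have v: "k = u \<otimes>\<^bsub>K\<^esub> ?v \<otimes>\<^bsub>K\<^esub> inv\<^bsub>K\<^esub> u" "?v \<in> carrier K"
      using hk u by (simp add: K.m_assoc, simp add: K.m_assoc[symmetric]) (use hk u in simp)
    show "(k, h) \<in> KH.conj_set (u, s) ?E"
    proof (rule image_eqI)
      show "(k, h) = (u, s) \<otimes>\<^bsub>K \<times>\<times> H\<^esub> (?v, \<phi> ?v) \<otimes>\<^bsub>K \<times>\<times> H\<^esub> inv\<^bsub>K \<times>\<times> H\<^esub> (u, s)"
        using hk v(1) s u by (simp add: inv_DirProd[OF K.is_group H.is_group])
      show "(?v, \<phi> ?v) \<in> ?E"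
        using v(2) by (rule image_eqI[OF refl])
    qed
  qed
  have weight: "composition_weight D (KH.conj_set z ?E) B = of_bool (?img z \<subseteq> B) / of_nat (order H)"
    if B: "subgroup B (H \<times>\<times> G)" and z: "z \<in> carrier (K \<times>\<times> H)" for B z
  proof -
    obtain s u where su: "z = (u, s)" "s \<in> carrier H" "u \<in> carrier K"
      using z by auto
    have "(\<one>\<^bsub>K\<^esub>, h) \<in> KH.conj_set (u, s) ?E \<longleftrightarrow> h = \<one>\<^bsub>H\<^esub>" for h
      unfolding mem[OF su(2,3)] using su by simp
    then have "{h \<in> carrier H. (\<one>\<^bsub>K\<^esub>, h) \<in> KH.conj_set (u, s) ?E \<and> (h, \<one>\<^bsub>G\<^esub>) \<in> B} = {\<one>\<^bsub>H\<^esub>}"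
      using subgroup.one_closed[OF B] H.one_closed unfolding one_DirProd by blast
    moreover have "(\<exists>h\<in>carrier H. (k, h) \<in> KH.conj_set (u, s) ?E \<and> (h, g) \<in> B) \<longleftrightarrow>
        (s \<otimes>\<^bsub>H\<^esub> \<phi> (inv\<^bsub>K\<^esub> u \<otimes>\<^bsub>K\<^esub> k \<otimes>\<^bsub>K\<^esub> u) \<otimes>\<^bsub>H\<^esub> inv\<^bsub>H\<^esub> s, g) \<in> B" if "(k, g) \<in> D" for k g
      unfolding mem[OF su(2,3)] using that D(1) su by auto
    then have "(\<forall>(k, g)\<in>D. \<exists>h\<in>carrier H. (k, h) \<in> KH.conj_set (u, s) ?E \<and> (h, g) \<in> B) \<longleftrightarrow>
        ?img (u, s) \<subseteq> B"
      by (simp add: image_subset_iff case_prod_unfold cong: ball_cong)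
    ultimately show ?thesis
      by (simp add: composition_weight_def su(1))
  qed
  have D': "?D \<subseteq> carrier (H \<times>\<times> G)" "?D \<noteq> {}"
    using D by auto
  have mark_img: "mark (?img z) x = mark ?D x" if z: "z \<in> carrier (K \<times>\<times> H)" for z
  proof -
    obtain s u where su: "z = (u, s)" "s \<in> carrier H" "u \<in> carrier K"
      using z by auto
    let ?t = "(s \<otimes>\<^bsub>H\<^esub> inv\<^bsub>H\<^esub> \<phi> u, \<one>\<^bsub>G\<^esub>)"
    have "(\<lambda>(k, g). (s \<otimes>\<^bsub>H\<^esub> \<phi> (inv\<^bsub>K\<^esub> u \<otimes>\<^bsub>K\<^esub> k \<otimes>\<^bsub>K\<^esub> u) \<otimes>\<^bsub>H\<^esub> inv\<^bsub>H\<^esub> s, g)) d =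
        ?t \<otimes>\<^bsub>H \<times>\<times> G\<^esub> (\<lambda>(k, g). (\<phi> k, g)) d \<otimes>\<^bsub>H \<times>\<times> G\<^esub> inv\<^bsub>H \<times>\<times> G\<^esub> ?t" if "d \<in> D" for d
      using D(1) that su
      by (auto simp: inv_DirProd[OF H.is_group G.is_group] H.inv_mult_group H.m_assoc)
    then have "?img z = HG.conj_set ?t ?D"
      unfolding su(1) image_image by simp
    then show ?thesis
      using HG.mark_conj[OF x D', of ?t] su by simp
  qed
  have img: "?img z \<subseteq> carrier (H \<times>\<times> G)" "?img z \<noteq> {}" if "z \<in> carrier (K \<times>\<times> H)" for z
    using that D by auto
  have "isotropy_form (H \<times>\<times> G) (composition_weight D (KH.conj_set z ?E)) x =
      mark ?D x / of_nat (order H)" if z: "z \<in> carrier (K \<times>\<times> H)" for z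
  proof -
    have "isotropy_form (H \<times>\<times> G) (composition_weight D (KH.conj_set z ?E)) x =
        isotropy_form (H \<times>\<times> G) (\<lambda>B. of_bool (?img z \<subseteq> B) / of_nat (order H)) x"
      by (intro HG.isotropy_form_cong[OF x] weight z)
    also have "\<dots> = mark (?img z) x / of_nat (order H)"
      using HG.mark_eq_isotropy_form[OF x img[OF z]] by (simp add: HG.isotropy_form_weight_mult)
    finally show ?thesis
      using mark_img[OF z] by simp
  qed
  then have "(\<Sum>z\<in>carrier (K \<times>\<times> H). isotropy_form (H \<times>\<times> G) (composition_weight D (KH.conj_set z ?E)) x)
      / of_nat (order K) = mark ?D x"
    using H.finite_carrier K.finite_carrier H.one_closed K.one_closed
    by (auto simp: order_def card_cartesian_product simp del: H.one_closed K.one_closed)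
  then show ?thesis
    unfolding mark_comp[OF KH.burnside_class_closed[OF KH.is_gset_coset[OF E]] x D]
      KH.isotropy_form_coset_class[OF E] cardE .
qed

end


section \<open>Fixed points of p-groups\<close>

text \<open>
  The points that are not fixed form orbits of length a power of \<open>p\<close> greater than \<open>1\<close>.
\<close>

lemma (in localized_group) card_fixed_points_cong:
  assumes order: "order G = p ^ n" and X: "is_gset G X" and Q: "subgroup Q G"
  shows "p dvd card (fst X - fixed_points Q X)"
proof -
  let ?Q = "G\<lparr>carrier := Q\<rparr>"
  interpret Q: localized_group p ?Q
    using Q by (rule localized_group_subgroup)
  have "group_hom ?Q G (\<lambda>u. u)"
    by (intro group_hom.intro group_hom_axioms.intro Q.is_group is_group homI)
      (use subgroup.subset[OF Q] in auto)
  then have "is_gset ?Q (gset_pullback (\<lambda>u. u) X)"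
    by (rule is_gset_pullback[OF Q.is_group _ X])
  from is_gsetD(2)[OF this] interpret act: group_action ?Q "fst X" "snd X"
    by (simp add: gset_pullback_def)
  have fin: "finite (fst X)"
    using X by (rule is_gsetD)
  have fix_iff: "x \<in> fixed_points Q X \<longleftrightarrow> orbit ?Q (snd X) x = {x}" if x: "x \<in> fst X" for x
    using act.orbit_refl[OF x] x subgroup.one_closed[OF Q]
    by (auto simp: fixed_points_def invariants_def orbit_def)
  have "p dvd (\<Sum>x\<in>C. of_bool (x \<notin> fixed_points Q X))" if C: "C \<in> orbits ?Q (fst X) (snd X)" for C
  proof (cases "\<exists>x\<in>C. x \<in> fixed_points Q X")
    case True
    then obtain x where x: "x \<in> C" "x \<in> fixed_points Q X"
      by blast
    then have xX: "x \<in> fst X"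
      using act.orbits_coverture C by blast
    then have "orbit ?Q (snd X) x \<in> orbits ?Q (fst X) (snd X)"
      by (auto simp: orbits_def)
    then have "C = orbit ?Q (snd X) x"
      using act.disjoint_union[OF C] act.orbit_refl[OF xX] x(1) by blast
    then have "C = {x}"
      using fix_iff[OF xX] x(2) by simp
    then show ?thesis
      using x by simp
  next
    case False
    obtain x where x: "x \<in> fst X" "C = orbit ?Q (snd X) x"
      using C by (auto simp: orbits_def)
    then have "card C * card (stabilizer ?Q (snd X) x) = card Q"
      using act.orbit_stabilizer_theorem[OF x(1)] by (simp add: order_def)
    then have "card C dvd p ^ n"
      using lagrange[OF Q] order by (metis dvd_triv_left dvd_triv_right dvd_trans)
    moreover have "card C \<noteq> 1"
    proof
      assume "card C = 1"
      then have "C = {x}"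
        using act.orbit_refl[OF x(1)] x(2) by (metis card_1_singletonE singletonD)
      then show False
        using False fix_iff[OF x(1)] x(2) by auto
    qed
    ultimately have "p dvd card C"
      using prime_p by (metis divides_primepow_nat dvd_triv_left nat_dvd_1_iff_1 power_0 power_Suc
          not0_implies_Suc)
    then show ?thesis
      using False by (simp add: sum.neutral)
  qed
  then have "p dvd (\<Sum>C\<in>orbits ?Q (fst X) (snd X). \<Sum>x\<in>C. of_bool (x \<notin> fixed_points Q X))"
    by (rule dvd_sum)
  also have "\<dots> = (\<Sum>x\<in>fst X. of_bool (x \<notin> fixed_points Q X))"
    by (rule act.disjoint_sum[OF fin])
  also have "\<dots> = card (fst X - fixed_points Q X)"
    using fin by (simp add: of_bool_def sum.If_cases Int_def set_diff_eq)
  finally show ?thesis .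
qed

lemma (in localized_group) mark_cong_trivial:
  assumes order: "order G = p ^ n" and x: "x \<in> carrier (burnside p G)" and Q: "subgroup Q G"
  obtains z where "z \<in> carrier (Z_loc p)" "mark {\<one>} x - mark Q x = of_nat p * z"
proof -
  let ?x = "elem_rep x"
  note x' = elem_rep_formal_sum(1)[OF x]
  define m where "m K = card (fst (class_rep K) - fixed_points Q (class_rep K)) div p"
    for K :: "'a gset_class"
  have m: "of_nat (card (fixed_points {\<one>} (class_rep K))) - of_nat (card (fixed_points Q (class_rep K)))
      = (of_nat p * of_nat (m K) :: rat)" if K: "K \<in> Poly_Mapping.keys ?x" for K
  proof -
    have X: "is_gset G (class_rep K)"
      using x' class_rep_gset[OF is_group] K by (auto simp: formal_sums_def)
    have "fixed_points {\<one>} (class_rep K) = fst (class_rep K)"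
      using is_gsetD(4)[OF X] by (auto simp: fixed_points_def invariants_def)
    moreover have "fixed_points Q (class_rep K) \<subseteq> fst (class_rep K)"
      using subgroup.one_closed[OF Q] by (auto simp: fixed_points_def invariants_def)
    ultimately have "int (card (fixed_points {\<one>} (class_rep K))) - int (card (fixed_points Q (class_rep K)))
        = int (p * m K)"
      using card_fixed_points_cong[OF order X Q] is_gsetD(1)[OF X]
      by (simp add: m_def card_Diff_subset finite_subset card_mono of_nat_diff)
    then show ?thesis
      by (metis of_int_diff of_int_of_nat_eq of_nat_mult)
  qed
  let ?z = "\<Sum>K\<in>Poly_Mapping.keys ?x. Poly_Mapping.lookup ?x K * of_nat (m K)"
  have "?z \<in> carrier (Z_loc p)"
    using x' by (intro Z_loc_sum Z_loc_mult prime_p Z_loc_of_nat) (auto simp: formal_sums_iff)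
  moreover have "mark {\<one>} x - mark Q x = of_nat p * ?z"
    unfolding mark_def lift_rat_def sum_distrib_left sum_subtractf[symmetric]
  proof (rule sum.cong)
    fix K assume "K \<in> Poly_Mapping.keys ?x"
    then show "Poly_Mapping.lookup ?x K * of_nat (card (fixed_points {\<one>} (class_rep K))) -
        Poly_Mapping.lookup ?x K * of_nat (card (fixed_points Q (class_rep K))) =
      of_nat p * (Poly_Mapping.lookup ?x K * of_nat (m K))"
      using m by (simp add: right_diff_distrib[symmetric] mult.left_commute)
  qed simp
  ultimately show ?thesis
    by (rule that)
qed


section \<open>Morphisms of a fusion system\<close>

context fusion_system
begin

sublocale S: localized_group p S
  by (intro localized_group.intro localized_group_axioms.intro is_group prime_p finite_carrier)

sublocale SS: localized_group p "S \<times>\<times> S"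
  by (rule localized_group_DirProd[OF S.localized_group_axioms S.localized_group_axioms])

lemma morphismD:
  assumes "subgroup P S" "subgroup Q S" "\<phi> \<in> F P Q"
  shows "group_hom (S\<lparr>carrier := P\<rparr>) S \<phi>" "\<phi> \<in> extensional P" "inj_on \<phi> P" "\<phi> ` P \<subseteq> Q"
    and "subgroup (\<phi> ` P) S"
proof -
  note m = morphism[OF assms]
  then show "\<phi> \<in> extensional P" "inj_on \<phi> P" and sub: "\<phi> ` P \<subseteq> Q"
    by (auto simp: hom_def)
  have "\<phi> \<in> hom (S\<lparr>carrier := P\<rparr>) S"
    using m subgroup.subset[OF assms(2)] by (auto simp: hom_def)
  then show hom: "group_hom (S\<lparr>carrier := P\<rparr>) S \<phi>"
    by (intro group_hom.intro group_hom_axioms.intro subgroup_imp_group assms is_group)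
  show "subgroup (\<phi> ` P) S"
    using group_hom.img_is_subgroup[OF hom] by simp
qed

lemma conj_map_one: "subgroup P S \<Longrightarrow> conj_map S \<one> P = (\<lambda>u\<in>P. u)"
  using subgroup.subset[of P S] by (auto simp: conj_map_def fun_eq_iff)

lemma inclusion_in: "subgroup P S \<Longrightarrow> subgroup Q S \<Longrightarrow> P \<subseteq> Q \<Longrightarrow> (\<lambda>u\<in>P. u) \<in> F P Q"
  using conj_in[of P Q \<one>] by (simp add: conj_map_one)

lemma extend_codomain:
  assumes "subgroup P S" "subgroup Q S" "subgroup R S" "\<phi> \<in> F P Q" "Q \<subseteq> R"
  shows "\<phi> \<in> F P R"
proof -
  have "compose P (\<lambda>u\<in>Q. u) \<phi> = \<phi>"
    using morphismD(2,4)[OF assms(1,2,4)] by (auto simp: compose_def fun_eq_iff extensional_def)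
  then show ?thesis
    using comp_closed[OF assms(1,2,3,4) inclusion_in[OF assms(2,3,5)]] by simp
qed

lemma into_carrier: "subgroup P S \<Longrightarrow> subgroup Q S \<Longrightarrow> \<phi> \<in> F P Q \<Longrightarrow> \<phi> \<in> F P (carrier S)"
  using extend_codomain[of P Q "carrier S" \<phi>] subgroup_self subgroup.subset by blast

lemma restrict_morphism:
  assumes "subgroup P S" "subgroup Q S" "subgroup R S" "\<phi> \<in> F P R" "Q \<subseteq> P"
  shows "restrict \<phi> Q \<in> F Q R"
proof -
  have "compose Q \<phi> (\<lambda>u\<in>Q. u) = restrict \<phi> Q"
    by (auto simp: compose_def fun_eq_iff)
  then show ?thesis
    using comp_closed[OF assms(2,1,3) inclusion_in[OF assms(2,1,5)] assms(4)] by simp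
qed

lemma finite_morphisms: "subgroup P S \<Longrightarrow> subgroup Q S \<Longrightarrow> finite (F P Q)"
proof -
  assume P: "subgroup P S" and Q: "subgroup Q S"
  have "F P Q \<subseteq> P \<rightarrow>\<^sub>E Q"
    using morphismD(2,4)[OF P Q] by (auto simp: PiE_def)
  then show "finite (F P Q)"
    by (rule finite_subset) (intro finite_PiE S.finite_subgroup P Q)
qed

lemma F_conjugatesE:
  assumes Q: "subgroup Q S" and "Q' \<in> F_conjugates S F Q"
  obtains \<phi> \<psi> where "subgroup Q' S" "\<phi> \<in> F Q Q'" "\<psi> \<in> F Q' Q" "\<phi> ` Q = Q'"
    "\<And>u. u \<in> Q \<Longrightarrow> \<psi> (\<phi> u) = u" "\<And>u. u \<in> Q' \<Longrightarrow> \<phi> (\<psi> u) = u"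
proof -
  obtain \<phi> \<psi> where *: "subgroup Q' S" "\<phi> \<in> F Q Q'" "\<psi> \<in> F Q' Q"
    "compose Q \<psi> \<phi> = (\<lambda>x\<in>Q. x)" "compose Q' \<phi> \<psi> = (\<lambda>x\<in>Q'. x)"
    using assms(2) by (auto simp: F_conjugates_def)
  have 1: "\<psi> (\<phi> u) = u" if "u \<in> Q" for u
    using fun_cong[OF *(4), of u] that by (simp add: compose_def)
  have 2: "\<phi> (\<psi> u) = u" if "u \<in> Q'" for u
    using fun_cong[OF *(5), of u] that by (simp add: compose_def)
  have "\<phi> ` Q = Q'"
    using morphismD(4)[OF Q *(1,2)] morphismD(4)[OF *(1) Q *(3)] 2 by (force simp: image_def)
  with * 1 2 show ?thesis
    using that by blast
qed

lemma image_in_F_conjugates: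
  assumes Q: "subgroup Q S" and \<phi>: "\<phi> \<in> F Q (carrier S)"
  shows "\<phi> ` Q \<in> F_conjugates S F Q"
proof -
  note \<phi>' = morphismD[OF Q subgroup_self \<phi>]
  have "compose Q (inv_morphism Q \<phi>) \<phi> = (\<lambda>x\<in>Q. x)"
    "compose (\<phi> ` Q) \<phi> (inv_morphism Q \<phi>) = (\<lambda>x\<in>\<phi> ` Q. x)"
    using \<phi>'(3) by (auto simp: compose_def inv_morphism_def fun_eq_iff)
  then show ?thesis
    unfolding F_conjugates_def
    using \<phi>'(5) corestrict_in[OF Q subgroup_self \<phi>] inverse_in[OF Q subgroup_self \<phi>] by blast
qed

lemma F_conjugates_eq:
  assumes Q: "subgroup Q S"
  shows "F_conjugates S F Q = (\<lambda>\<phi>. \<phi> ` Q) ` F Q (carrier S)"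
proof (intro equalityI subsetI)
  fix Q' assume "Q' \<in> F_conjugates S F Q"
  then obtain \<phi> where "subgroup Q' S" "\<phi> \<in> F Q Q'" "\<phi> ` Q = Q'"
    by (rule F_conjugatesE[OF Q])
  then show "Q' \<in> (\<lambda>\<phi>. \<phi> ` Q) ` F Q (carrier S)"
    using into_carrier[OF Q] by blast
qed (use image_in_F_conjugates[OF Q] in auto)

lemma finite_F_conjugates: "subgroup Q S \<Longrightarrow> finite (F_conjugates S F Q)"
  by (simp add: F_conjugates_eq finite_morphisms subgroup_self)

lemma F_conjugates_subset:
  assumes Q: "subgroup Q S" and Q': "Q' \<in> F_conjugates S F Q"
  shows "F_conjugates S F Q' \<subseteq> F_conjugates S F Q"
proof
  obtain \<phi> where \<phi>: "subgroup Q' S" "\<phi> \<in> F Q Q'" "\<phi> ` Q = Q'"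
    using Q' by (rule F_conjugatesE[OF Q])
  fix R assume "R \<in> F_conjugates S F Q'"
  then obtain \<alpha> where \<alpha>: "\<alpha> \<in> F Q' (carrier S)" "R = \<alpha> ` Q'"
    by (auto simp: F_conjugates_eq \<phi>(1))
  have "compose Q \<alpha> \<phi> \<in> F Q (carrier S)"
    by (rule comp_closed[OF Q \<phi>(1) subgroup_self \<phi>(2) \<alpha>(1)])
  moreover have "compose Q \<alpha> \<phi> ` Q = R"
    unfolding \<alpha>(2) \<phi>(3)[symmetric] by (auto simp: compose_def image_image)
  ultimately show "R \<in> F_conjugates S F Q"
    by (auto simp: F_conjugates_eq[OF Q])
qed

lemma F_conjugates_cong:
  assumes Q: "subgroup Q S" and Q': "Q' \<in> F_conjugates S F Q"
  shows "F_conjugates S F Q' = F_conjugates S F Q"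
proof
  obtain \<phi> \<psi> where \<phi>: "subgroup Q' S" "\<phi> \<in> F Q Q'" "\<psi> \<in> F Q' Q" "\<phi> ` Q = Q'"
    "\<And>u. u \<in> Q \<Longrightarrow> \<psi> (\<phi> u) = u" "\<And>u. u \<in> Q' \<Longrightarrow> \<phi> (\<psi> u) = u"
    by (rule F_conjugatesE[OF Q Q']) blast
  have "\<psi> ` Q' = Q"
    unfolding \<phi>(4)[symmetric] image_image using \<phi>(5) by simp
  then have "Q \<in> F_conjugates S F Q'"
    using image_in_F_conjugates[OF \<phi>(1) into_carrier[OF \<phi>(1) Q \<phi>(3)]] by simp
  then show "F_conjugates S F Q \<subseteq> F_conjugates S F Q'"
    by (rule F_conjugates_subset[OF \<phi>(1)])
qed (rule F_conjugates_subset[OF assms])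

text \<open>
  The morphisms \<open>Q \<rightarrow> S\<close> with a given image \<open>Q'\<close> form a coset of the automorphism group of \<open>Q\<close>, so
  every conjugate of \<open>Q\<close> is hit equally often.
\<close>

lemma sum_over_morphisms:
  fixes f :: "'a set \<Rightarrow> rat"
  assumes Q: "subgroup Q S"
  shows "(\<Sum>\<alpha>\<in>F Q (carrier S). f (\<alpha> ` Q)) = of_nat (card (F Q Q)) * (\<Sum>Q'\<in>F_conjugates S F Q. f Q')"
proof -
  have fibre: "card {\<alpha> \<in> F Q (carrier S). \<alpha> ` Q = Q'} = card (F Q Q)"
    if Q': "Q' \<in> F_conjugates S F Q" for Q'
  proof -
    obtain \<phi> \<psi> where \<phi>: "subgroup Q' S" "\<phi> \<in> F Q Q'" "\<psi> \<in> F Q' Q" "\<phi> ` Q = Q'"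
      and inv: "\<And>u. u \<in> Q \<Longrightarrow> \<psi> (\<phi> u) = u" "\<And>u. u \<in> Q' \<Longrightarrow> \<phi> (\<psi> u) = u"
      by (rule F_conjugatesE[OF Q Q']) blast
    have "bij_betw (compose Q \<phi>) (F Q Q) {\<alpha> \<in> F Q (carrier S). \<alpha> ` Q = Q'}"
    proof (rule bij_betw_byWitness[where f' = "compose Q \<psi>"])
      show "\<forall>\<theta>\<in>F Q Q. compose Q \<psi> (compose Q \<phi> \<theta>) = \<theta>"
        using morphismD(2,4)[OF Q Q] inv(1)
        by (fastforce simp: compose_def fun_eq_iff extensional_def)
      show "\<forall>\<alpha>\<in>{\<alpha> \<in> F Q (carrier S). \<alpha> ` Q = Q'}. compose Q \<phi> (compose Q \<psi> \<alpha>) = \<alpha>"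
        using morphismD(2)[OF Q subgroup_self] inv(2)
        by (fastforce simp: compose_def fun_eq_iff extensional_def)
      show "compose Q \<phi> ` F Q Q \<subseteq> {\<alpha> \<in> F Q (carrier S). \<alpha> ` Q = Q'}"
      proof
        fix \<alpha> assume "\<alpha> \<in> compose Q \<phi> ` F Q Q"
        then obtain \<theta> where \<theta>: "\<theta> \<in> F Q Q" "\<alpha> = compose Q \<phi> \<theta>"
          by blast
        have "\<theta> ` Q = Q"
          using morphismD(3,4)[OF Q Q \<theta>(1)] S.finite_subgroup[OF Q] by (simp add: endo_inj_surj)
        then have "\<alpha> ` Q = Q'"
          unfolding \<theta>(2) \<phi>(4)[symmetric] by (metis (no_types, lifting) compose_eq image_cong image_image)
        moreover have "\<alpha> \<in> F Q (carrier S)"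
          unfolding \<theta>(2) by (rule into_carrier[OF Q \<phi>(1)], rule comp_closed[OF Q Q \<phi>(1) \<theta>(1) \<phi>(2)])
        ultimately show "\<alpha> \<in> {\<alpha> \<in> F Q (carrier S). \<alpha> ` Q = Q'}"
          by blast
      qed
      show "compose Q \<psi> ` {\<alpha> \<in> F Q (carrier S). \<alpha> ` Q = Q'} \<subseteq> F Q Q"
        using corestrict_in[OF Q subgroup_self] comp_closed[OF Q \<phi>(1) Q _ \<phi>(3)] by blast
    qed
    then show ?thesis
      by (rule bij_betw_same_card[symmetric])
  qed
  have "(\<Sum>\<alpha>\<in>F Q (carrier S). f (\<alpha> ` Q)) =
    (\<Sum>Q'\<in>F_conjugates S F Q. \<Sum>\<alpha>\<in>{\<alpha> \<in> F Q (carrier S). \<alpha> ` Q = Q'}. f (\<alpha> ` Q))"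
    by (rule sum.group[symmetric])
      (auto simp: finite_morphisms subgroup_self Q finite_F_conjugates F_conjugates_eq)
  also have "\<dots> = (\<Sum>Q'\<in>F_conjugates S F Q. of_nat (card (F Q Q)) * f Q')"
    by (intro sum.cong refl) (simp add: fibre)
  finally show ?thesis
    by (simp add: sum_distrib_left)
qed


section \<open>Composition with generated bisets\<close>

lemma twisted_diagonal_subgroup:
  assumes "subgroup P S" "\<phi> \<in> F P (carrier S)"
  shows "subgroup (twisted_diagonal P \<phi>) (S \<times>\<times> S)"
proof -
  interpret \<phi>: group_hom "S\<lparr>carrier := P\<rparr>" S \<phi>
    using morphismD(1)[OF assms(1) subgroup_self assms(2)] .
  have "group_hom (S\<lparr>carrier := P\<rparr>) (S \<times>\<times> S) (\<lambda>u. (\<phi> u, u))"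
    using subgroup.subset[OF assms(1)] \<phi>.hom_mult
    by (intro group_hom.intro group_hom_axioms.intro subgroup_imp_group SS.is_group homI assms) auto
  then show ?thesis
    using group_hom.img_is_subgroup by (fastforce simp: twisted_diagonal_def Setcompr_eq_image)
qed

text \<open>
  Conjugating the graph of \<open>\<phi>\<close> by \<open>(a, b)\<close> gives the graph of \<open>c\<^sub>a \<phi> c\<^sub>b\<inverse>\<close> on \<open>b P b\<inverse>\<close>, again a morphism of
  the fusion system because conjugations are.
\<close>

lemma conj_twisted_diagonal:
  assumes P: "subgroup P S" and \<phi>: "\<phi> \<in> F P (carrier S)" and z: "z \<in> carrier (S \<times>\<times> S)"
  obtains R \<beta> where "subgroup R S" "\<beta> \<in> F R (carrier S)"
    "SS.conj_set z (twisted_diagonal P \<phi>) = twisted_diagonal R \<beta>"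
proof -
  obtain a b where ab: "z = (a, b)" "a \<in> carrier S" "b \<in> carrier S"
    using z by auto
  note \<phi>' = morphismD[OF P subgroup_self \<phi>]
  interpret \<phi>: group_hom "S\<lparr>carrier := P\<rparr>" S \<phi>
    by (rule \<phi>')
  have PS: "P \<subseteq> carrier S"
    by (rule subgroup.subset[OF P])
  define R where "R = conj_map S b P ` P"
  have into_S: "conj_map S s Q \<in> F Q (carrier S)" if "s \<in> carrier S" "subgroup Q S" for s Q
    using subgroup.subset[OF that(2)] that by (intro conj_in subgroup_self) (auto simp: conj_map_def)
  have R: "subgroup R S"
    unfolding R_def using morphismD(5)[OF P subgroup_self into_S[OF ab(3) P]] .
  have R_eq: "R = (\<lambda>u. b \<otimes> u \<otimes> inv b) ` P"
    by (auto simp: R_def conj_map_def)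
  have unconj: "inv b \<otimes> (b \<otimes> u \<otimes> inv b) \<otimes> b = u" if "u \<in> P" for u
    using that PS ab by (simp add: subset_iff m_assoc) (simp add: subset_iff m_assoc[symmetric])
  have b': "conj_map S (inv b) R \<in> F R P"
  proof (rule conj_in[OF R P])
    show "conj_map S (inv b) R ` R \<subseteq> P"
    proof
      fix v assume "v \<in> conj_map S (inv b) R ` R"
      then obtain u where "u \<in> P" "v = inv b \<otimes> (b \<otimes> u \<otimes> inv b) \<otimes> b"
        using ab(3) by (auto simp: conj_map_def R_eq)
      then show "v \<in> P"
        using unconj by simp
    qed
  qed (simp add: ab)
  define \<beta> where "\<beta> = compose R (conj_map S a (carrier S)) (compose R \<phi> (conj_map S (inv b) R))"
  have "\<beta> \<in> F R (carrier S)"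
    unfolding \<beta>_def
    by (intro comp_closed[OF R subgroup_self subgroup_self] comp_closed[OF R P subgroup_self] b' \<phi>
        into_S ab subgroup_self)
  moreover have "\<beta> (b \<otimes> u \<otimes> inv b) = a \<otimes> \<phi> u \<otimes> inv a" if u: "u \<in> P" for u
  proof -
    have "b \<otimes> u \<otimes> inv b \<in> R"
      using u by (auto simp: R_eq)
    moreover have "\<phi> u \<in> carrier S"
      using \<phi>'(4) u by blast
    ultimately show ?thesis
      using unconj[OF u] ab(3) by (simp add: \<beta>_def compose_def conj_map_def)
  qed
  then have "SS.conj_set z (twisted_diagonal P \<phi>) = twisted_diagonal R \<beta>"
    unfolding ab(1) twisted_diagonal_def R_eq Setcompr_eq_image image_image
    using ab by (intro image_cong) (simp_all add: inv_DirProd[OF is_group is_group])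
  ultimately show ?thesis
    using that R by blast
qed

text \<open>
  The stabilizers of the points of \<open>[P, \<phi>]\<close> are the conjugates of the graph of \<open>\<phi>\<close>, so the isotropy
  forms of a generated element see only graphs of morphisms of the fusion system.
\<close>

lemma isotropy_form_F_generated_cong:
  assumes y: "F_generated p S F y"
    and W: "\<And>R \<beta>. subgroup R S \<Longrightarrow> \<beta> \<in> F R (carrier S) \<Longrightarrow>
      W (twisted_diagonal R \<beta>) = W' (twisted_diagonal R \<beta>)"
  shows "isotropy_form (S \<times>\<times> S) W y = isotropy_form (S \<times>\<times> S) W' y"
proof -
  let ?M = "burnside_biset p S S"
  interpret M: module "Z_loc p" ?M
    by (rule SS.module_burnside)
  obtain I c where I: "finite I" "I \<subseteq> {(P, \<phi>). subgroup P S \<and> \<phi> \<in> F P (carrier S)}"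
    and c: "c \<in> I \<rightarrow> carrier (Z_loc p)"
    and y_eq: "y = (\<Oplus>\<^bsub>?M\<^esub> i\<in>I. c i \<odot>\<^bsub>?M\<^esub> basic_biset p S S (fst i) (snd i))"
    using y by (auto simp: F_generated_def)
  have basic: "basic_biset p S S (fst i) (snd i) \<in> carrier ?M"
    "isotropy_form (S \<times>\<times> S) W (basic_biset p S S (fst i) (snd i)) =
     isotropy_form (S \<times>\<times> S) W' (basic_biset p S S (fst i) (snd i))" if i: "i \<in> I" for i
  proof -
    obtain P \<phi> where P: "i = (P, \<phi>)" "subgroup P S" "\<phi> \<in> F P (carrier S)"
      using I(2) i by auto
    note td = twisted_diagonal_subgroup[OF P(2,3)]
    show "basic_biset p S S (fst i) (snd i) \<in> carrier ?M"
      unfolding basic_biset_def P(1) by (simp add: SS.burnside_class_closed SS.is_gset_coset td)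
    have "W (SS.conj_set z (twisted_diagonal P \<phi>)) = W' (SS.conj_set z (twisted_diagonal P \<phi>))"
      if "z \<in> carrier (S \<times>\<times> S)" for z
      by (rule conj_twisted_diagonal[OF P(2,3) that]) (simp add: W)
    then show "isotropy_form (S \<times>\<times> S) W (basic_biset p S S (fst i) (snd i)) =
      isotropy_form (S \<times>\<times> S) W' (basic_biset p S S (fst i) (snd i))"
      unfolding basic_biset_def P(1) by (simp add: SS.isotropy_form_coset_class td del: carrier_DirProd)
  qed
  have "(\<Oplus>\<^bsub>?M\<^esub> i\<in>J. c i \<odot>\<^bsub>?M\<^esub> basic_biset p S S (fst i) (snd i)) \<in> carrier ?M \<and>
    isotropy_form (S \<times>\<times> S) W (\<Oplus>\<^bsub>?M\<^esub> i\<in>J. c i \<odot>\<^bsub>?M\<^esub> basic_biset p S S (fst i) (snd i)) =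
    isotropy_form (S \<times>\<times> S) W' (\<Oplus>\<^bsub>?M\<^esub> i\<in>J. c i \<odot>\<^bsub>?M\<^esub> basic_biset p S S (fst i) (snd i))"
    if "finite J" "J \<subseteq> I" for J
    using that
  proof (induction rule: finite_induct)
    case empty
    then show ?case
      by (simp add: SS.isotropy_form_zero)
  next
    case (insert i J)
    have terms: "c j \<odot>\<^bsub>?M\<^esub> basic_biset p S S (fst j) (snd j) \<in> carrier ?M" if "j \<in> I" for j
      using c basic(1)[OF that] that by auto
    have "(\<Oplus>\<^bsub>?M\<^esub> j\<in>insert i J. c j \<odot>\<^bsub>?M\<^esub> basic_biset p S S (fst j) (snd j)) =
      c i \<odot>\<^bsub>?M\<^esub> basic_biset p S S (fst i) (snd i) \<oplus>\<^bsub>?M\<^esub>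
        (\<Oplus>\<^bsub>?M\<^esub> j\<in>J. c j \<odot>\<^bsub>?M\<^esub> basic_biset p S S (fst j) (snd j))"
      using insert terms by (intro M.finsum_insert) auto
    moreover have "c i \<in> carrier (Z_loc p)"
      using c insert.prems by auto
    ultimately show ?case
      using insert terms[of i] basic[of i]
      by (simp add: SS.isotropy_form_add SS.isotropy_form_smult SS.add_closed)
  qed
  from this[OF I(1)] show ?thesis
    by (simp add: y_eq)
qed

text \<open>
  If \<open>A\<close> is the graph of an isomorphism \<open>\<beta>\<close> and \<open>D\<close> that of a map \<open>\<gamma>\<close> on \<open>Q\<close>, the correction \<open>h\<close> of
  \<open>q \<in> Q\<close> can only be \<open>\<beta>\<inverse> q\<close>. So, up to the factor \<open>1/|S|\<close>, the weight counts the morphisms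
  \<open>\<alpha> : Q \<rightarrow> S\<close> of the fusion system that are contained in \<open>\<beta>\<inverse>\<close> and for which \<open>B\<close> contains all
  \<open>(\<alpha> q, \<gamma> q)\<close>. There is at most one.
\<close>

lemma composition_weight_twisted_diagonal:
  assumes G: "localized_group p G" and Q: "subgroup Q S" and R: "subgroup R S"
    and \<beta>: "\<beta> \<in> F R (carrier S)" and B: "subgroup B (S \<times>\<times> G)"
  shows "biset_composition.composition_weight S S G ((\<lambda>q. (q, \<gamma> q)) ` Q) (twisted_diagonal R \<beta>) B =
    (\<Sum>\<alpha>\<in>F Q (carrier S). of_bool ((\<lambda>q. (q, \<alpha> q)) ` Q \<subseteq> twisted_diagonal R \<beta>) *
      of_bool ((\<lambda>q. (\<alpha> q, \<gamma> q)) ` Q \<subseteq> B)) / of_nat (order S)"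
proof -
  interpret biset_composition p S S G
    by (intro biset_composition.intro S.localized_group_axioms G)
  let ?A = "twisted_diagonal R \<beta>"
  note \<beta>' = morphismD[OF R subgroup_self \<beta>]
  have A_iff: "(q, h) \<in> ?A \<longleftrightarrow> h \<in> R \<and> q = \<beta> h" for q h
    by (auto simp: twisted_diagonal_def)
  have unique: "h = h'" if "(q, h) \<in> ?A" "(q, h') \<in> ?A" for q h h'
    using that \<beta>'(3) by (auto simp: A_iff inj_on_def)
  have RS: "R \<subseteq> carrier S"
    by (rule subgroup.subset[OF R])
  have "(\<one>, \<one>) \<in> ?A"
    using subgroup.one_closed[OF twisted_diagonal_subgroup[OF R \<beta>]] by simp
  then have "{h \<in> carrier S. (\<one>, h) \<in> ?A \<and> (h, \<one>\<^bsub>G\<^esub>) \<in> B} = {\<one>}"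
    using unique subgroup.one_closed[OF B] by auto
  then have weight: "composition_weight ((\<lambda>q. (q, \<gamma> q)) ` Q) ?A B =
      of_bool (\<forall>q\<in>Q. \<exists>h\<in>carrier S. (q, h) \<in> ?A \<and> (h, \<gamma> q) \<in> B) / of_nat (order S)"
    by (simp add: composition_weight_def)
  let ?set = "{\<alpha> \<in> F Q (carrier S). (\<lambda>q. (q, \<alpha> q)) ` Q \<subseteq> ?A \<and> (\<lambda>q. (\<alpha> q, \<gamma> q)) ` Q \<subseteq> B}"
  have "of_bool (\<forall>q\<in>Q. \<exists>h\<in>carrier S. (q, h) \<in> ?A \<and> (h, \<gamma> q) \<in> B) = (of_nat (card ?set) :: rat)"
  proof (cases "\<forall>q\<in>Q. \<exists>h\<in>carrier S. (q, h) \<in> ?A \<and> (h, \<gamma> q) \<in> B")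
    case True
    define \<alpha> where "\<alpha> = restrict (inv_morphism R \<beta>) Q"
    have QR: "Q \<subseteq> \<beta> ` R"
      using True by (force simp: A_iff)
    have "inv_morphism R \<beta> \<in> F (\<beta> ` R) (carrier S)"
      using into_carrier[OF \<beta>'(5) R inverse_in[OF R subgroup_self \<beta>]] .
    then have \<alpha>: "\<alpha> \<in> F Q (carrier S)"
      unfolding \<alpha>_def by (rule restrict_morphism[OF \<beta>'(5) Q subgroup_self _ QR])
    have \<alpha>A: "(q, \<alpha> q) \<in> ?A" if "q \<in> Q" for q
      using that QR by (auto simp: \<alpha>_def inv_morphism_def A_iff inv_into_into f_inv_into_f subset_iff)
    moreover have "(\<alpha> q, \<gamma> q) \<in> B" if q: "q \<in> Q" for q
      using True q unique[OF \<alpha>A[OF q]] by blast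
    moreover have "\<alpha>' = \<alpha>" if \<alpha>': "\<alpha>' \<in> F Q (carrier S)" "(\<lambda>q. (q, \<alpha>' q)) ` Q \<subseteq> ?A" for \<alpha>'
    proof (rule extensionalityI[OF morphismD(2)[OF Q subgroup_self \<alpha>'(1)] morphismD(2)[OF Q subgroup_self \<alpha>]])
      fix q assume "q \<in> Q"
      then show "\<alpha>' q = \<alpha> q"
        using unique \<alpha>A \<alpha>'(2) by blast
    qed
    ultimately have "?set = {\<alpha>}"
      using \<alpha> by auto
    then show ?thesis
      using True by simp
  next
    case False
    have empty: "?set = {}"
    proof (rule ccontr)
      assume "?set \<noteq> {}"
      then obtain \<alpha> where "(\<lambda>q. (q, \<alpha> q)) ` Q \<subseteq> ?A" "(\<lambda>q. (\<alpha> q, \<gamma> q)) ` Q \<subseteq> B"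
        by blast
      then have "(q, \<alpha> q) \<in> ?A \<and> (\<alpha> q, \<gamma> q) \<in> B" if "q \<in> Q" for q
        using that by blast
      then show False
        using False RS unfolding A_iff by blast
    qed
    show ?thesis
      unfolding empty using False by simp
  qed
  also have "(of_nat (card ?set) :: rat) = (\<Sum>\<alpha>\<in>F Q (carrier S).
      of_bool ((\<lambda>q. (q, \<alpha> q)) ` Q \<subseteq> ?A) * of_bool ((\<lambda>q. (\<alpha> q, \<gamma> q)) ` Q \<subseteq> B))"
    using finite_morphisms[OF Q subgroup_self] unfolding of_bool_conj[symmetric]
    by (simp add: of_bool_def sum.If_cases Int_def)
  finally show ?thesis
    by (simp add: weight)
qed

text \<open>
  The weight of a pair of points has become a sum of products, one factor for each point, so the nested
  isotropy form becomes a sum of products of marks. The map \<open>\<gamma>\<close> is the identity for compositions of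
  \<open>(S, S)\<close>-bisets and the constant map for left \<open>S\<close>-sets.
\<close>

lemma mark_comp_F_generated:
  assumes G: "localized_group p G" and y: "y \<in> carrier (burnside_biset p S S)" "F_generated p S F y"
    and x: "x \<in> carrier (burnside_biset p G S)" and Q: "subgroup Q S" and \<gamma>: "\<gamma> ` Q \<subseteq> carrier G"
  shows "mark ((\<lambda>q. (q, \<gamma> q)) ` Q) (burnside_comp p S S G y x) =
    (\<Sum>\<alpha>\<in>F Q (carrier S). mark ((\<lambda>q. (q, \<alpha> q)) ` Q) y * mark ((\<lambda>q. (\<alpha> q, \<gamma> q)) ` Q) x)
      / of_nat (order S)"
proof -
  interpret biset_composition p S S G
    by (intro biset_composition.intro S.localized_group_axioms G)
  let ?D = "(\<lambda>q. (q, \<gamma> q)) ` Q"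
  have Q': "Q \<subseteq> carrier S" "Q \<noteq> {}"
    using S.subgroup_nonempty_subset[OF Q] by auto
  have D: "?D \<subseteq> carrier (S \<times>\<times> G)" "?D \<noteq> {}"
    using Q' \<gamma> by auto
  have \<alpha>: "(\<lambda>q. (q, \<alpha> q)) ` Q \<subseteq> carrier (S \<times>\<times> S)" "(\<lambda>q. (\<alpha> q, \<gamma> q)) ` Q \<subseteq> carrier (S \<times>\<times> G)"
    if "\<alpha> \<in> F Q (carrier S)" for \<alpha>
    using morphismD(4)[OF Q subgroup_self that] Q' \<gamma> by auto
  have "mark ?D (burnside_comp p S S G y x) =
    isotropy_form (S \<times>\<times> S) (\<lambda>A. isotropy_form (S \<times>\<times> G) (composition_weight ?D A) x) y"
    by (rule mark_comp[OF y(1) x D])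
  also have "\<dots> = isotropy_form (S \<times>\<times> S) (\<lambda>A. (\<Sum>\<alpha>\<in>F Q (carrier S).
      of_bool ((\<lambda>q. (q, \<alpha> q)) ` Q \<subseteq> A) * mark ((\<lambda>q. (\<alpha> q, \<gamma> q)) ` Q) x) / of_nat (order S)) y"
  proof (rule isotropy_form_F_generated_cong[OF y(2)])
    fix R \<beta> assume R: "subgroup R S" and \<beta>: "\<beta> \<in> F R (carrier S)"
    let ?A = "twisted_diagonal R \<beta>"
    have "isotropy_form (S \<times>\<times> G) (composition_weight ?D ?A) x =
      isotropy_form (S \<times>\<times> G) (\<lambda>B. (\<Sum>\<alpha>\<in>F Q (carrier S). of_bool ((\<lambda>q. (q, \<alpha> q)) ` Q \<subseteq> ?A) *
        of_bool ((\<lambda>q. (\<alpha> q, \<gamma> q)) ` Q \<subseteq> B)) / of_nat (order S)) x"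
      by (intro HG.isotropy_form_cong[OF x] composition_weight_twisted_diagonal G Q R \<beta>)
    also have "\<dots> = (\<Sum>\<alpha>\<in>F Q (carrier S). of_bool ((\<lambda>q. (q, \<alpha> q)) ` Q \<subseteq> ?A) *
        mark ((\<lambda>q. (\<alpha> q, \<gamma> q)) ` Q) x) / of_nat (order S)"
      unfolding HG.isotropy_form_weight_mult HG.isotropy_form_weight_sum
      using HG.mark_eq_isotropy_form[OF x \<alpha>(2)] Q'(2) by simp
    finally show "isotropy_form (S \<times>\<times> G) (composition_weight ?D ?A) x =
      (\<Sum>\<alpha>\<in>F Q (carrier S). of_bool ((\<lambda>q. (q, \<alpha> q)) ` Q \<subseteq> ?A) *
        mark ((\<lambda>q. (\<alpha> q, \<gamma> q)) ` Q) x) / of_nat (order S)" .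
  qed
  also have "\<dots> = (\<Sum>\<alpha>\<in>F Q (carrier S). mark ((\<lambda>q. (q, \<alpha> q)) ` Q) y *
      mark ((\<lambda>q. (\<alpha> q, \<gamma> q)) ` Q) x) / of_nat (order S)"
    unfolding SS.isotropy_form_weight_mult SS.isotropy_form_weight_sum
    using SS.mark_eq_isotropy_form[OF y(1) \<alpha>(1)] Q'(2) by simp
  finally show ?thesis .
qed

end


section \<open>Marks of the characteristic idempotent\<close>

locale fusion_system_idempotent = fusion_system +
  fixes \<omega> :: "('a \<times> 'a) burnside_elem"
  assumes \<omega>: "characteristic_idempotent p S F \<omega>"
begin

lemma idempotentD:
  "\<omega> \<in> carrier (burnside_biset p S S)" "F_generated p S F \<omega>" "left_F_stable p S F \<omega>"
  "right_F_stable p S F \<omega>" "augmentation S \<omega> \<in> Units (Z_loc p)" "burnside_comp p S S S \<omega> \<omega> = \<omega>"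
  using \<omega> by (auto simp: characteristic_idempotent_def F_characteristic_def)

text \<open>
  By right and left stability, the mark of \<open>\<omega>\<close> at the graph of a morphism of the fusion system, and
  at the graph of its inverse, depends on the source \<open>Q\<close> only.
\<close>

definition graph_mark :: "'a set \<Rightarrow> rat" where
  "graph_mark Q = mark ((\<lambda>q. (q, q)) ` Q) \<omega>"

lemma mark_graph:
  assumes Q: "subgroup Q S" and \<alpha>: "\<alpha> \<in> F Q (carrier S)"
  shows "mark ((\<lambda>q. (q, \<alpha> q)) ` Q) \<omega> = graph_mark Q"
proof -
  let ?Q = "S\<lparr>carrier := Q\<rparr>" and ?D = "(\<lambda>q. (q, q)) ` Q"
  interpret biset_composition p S S ?Q
    by (intro biset_composition.intro S.localized_group_axioms S.localized_group_subgroup Q)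
  have D: "?D \<subseteq> carrier (S \<times>\<times> ?Q)" "?D \<noteq> {}"
    using S.subgroup_nonempty_subset[OF Q] by auto
  have comp: "mark ?D (burnside_comp p S S ?Q \<omega> (basic_biset p S ?Q Q \<phi>)) = mark ((\<lambda>q. (q, \<phi> q)) ` Q) \<omega>"
    if "group_hom ?Q S \<phi>" for \<phi>
    using mark_comp_graph_right[OF that idempotentD(1) D]
    by (simp add: basic_biset_def twisted_diagonal_def Setcompr_eq_image image_image)
  have "group_hom ?Q S (\<lambda>u. u)"
    using subgroup.subset[OF Q]
    by (intro group_hom.intro group_hom_axioms.intro subgroup_imp_group is_group Q homI) auto
  then show ?thesis
    using comp[OF morphismD(1)[OF Q subgroup_self \<alpha>]] comp[of "\<lambda>u. u"] idempotentD(4) Q \<alpha>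
    by (simp add: right_F_stable_def graph_mark_def)
qed

lemma mark_inverse_graph:
  assumes Q: "subgroup Q S" and \<alpha>: "\<alpha> \<in> F Q (carrier S)"
  shows "mark ((\<lambda>q. (\<alpha> q, q)) ` Q) \<omega> = graph_mark Q"
proof -
  let ?Q = "S\<lparr>carrier := Q\<rparr>" and ?D = "(\<lambda>q. (q, q)) ` Q"
  interpret biset_composition p ?Q S S
    by (intro biset_composition.intro S.localized_group_axioms S.localized_group_subgroup Q)
  have D: "?D \<subseteq> carrier (?Q \<times>\<times> S)" "?D \<noteq> {}"
    using S.subgroup_nonempty_subset[OF Q] by auto
  have comp: "mark ?D (burnside_comp p ?Q S S (burnside_class p (?Q \<times>\<times> S)
      (coset_gset (?Q \<times>\<times> S) ((\<lambda>q. (q, \<phi> q)) ` Q))) \<omega>) = mark ((\<lambda>q. (\<phi> q, q)) ` Q) \<omega>"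
    if "group_hom ?Q S \<phi>" for \<phi>
    using mark_comp_graph_left[OF that idempotentD(1) D] by (simp add: image_image)
  have "twisted_diagonal (\<alpha> ` Q) (inv_morphism Q \<alpha>) = (\<lambda>q. (q, \<alpha> q)) ` Q"
    unfolding twisted_diagonal_def Setcompr_eq_image image_image
    using morphismD(3)[OF Q subgroup_self \<alpha>] by (intro image_cong) (simp_all add: inv_morphism_def)
  moreover have "twisted_diagonal Q (\<lambda>u. u) = (\<lambda>q. (q, q)) ` Q"
    by (auto simp: twisted_diagonal_def)
  moreover have "group_hom ?Q S (\<lambda>u. u)"
    using subgroup.subset[OF Q]
    by (intro group_hom.intro group_hom_axioms.intro subgroup_imp_group is_group Q homI) auto
  moreover have "burnside_comp p ?Q S S (basic_biset p ?Q S (\<alpha> ` Q) (inv_morphism Q \<alpha>)) \<omega> =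
      burnside_comp p ?Q S S (basic_biset p ?Q S Q (\<lambda>u. u)) \<omega>"
    using idempotentD(3) Q \<alpha> unfolding left_F_stable_def by blast
  ultimately show ?thesis
    using comp[OF morphismD(1)[OF Q subgroup_self \<alpha>]] comp[of "\<lambda>u. u"]
    by (simp add: graph_mark_def basic_biset_def)
qed

text \<open>
  The mark of \<open>\<omega> \<circ> \<omega>\<close> at the diagonal is a sum over \<open>\<alpha>\<close> of the product of the marks of \<open>\<omega>\<close> at the
  graph of \<open>\<alpha>\<close> and at the inverse graph, and all these marks agree.
\<close>

lemma graph_mark_idempotent:
  assumes Q: "subgroup Q S"
  shows "graph_mark Q = of_nat (card (F Q (carrier S))) * graph_mark Q ^ 2 / of_nat (order S)"
proof -
  have "graph_mark Q = mark ((\<lambda>q. (q, q)) ` Q) (burnside_comp p S S S \<omega> \<omega>)"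
    by (simp add: graph_mark_def idempotentD(6))
  also have "\<dots> = (\<Sum>\<alpha>\<in>F Q (carrier S). mark ((\<lambda>q. (q, \<alpha> q)) ` Q) \<omega> * mark ((\<lambda>q. (\<alpha> q, q)) ` Q) \<omega>)
      / of_nat (order S)"
    using subgroup.subset[OF Q] idempotentD(1,2)
    by (intro mark_comp_F_generated S.localized_group_axioms Q) auto
  also have "\<dots> = (\<Sum>\<alpha>\<in>F Q (carrier S). graph_mark Q ^ 2) / of_nat (order S)"
    by (simp add: mark_graph mark_inverse_graph Q power2_eq_square)
  finally show ?thesis
    by simp
qed

lemma localized_one_group: "localized_group p one_group"
  by (intro localized_group.intro localized_group_axioms.intro) (simp_all add: prime_p)

sublocale S1: localized_group p "S \<times>\<times> one_group"
  by (rule localized_group_DirProd[OF S.localized_group_axioms localized_one_group])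

sublocale comp: biset_composition p S S one_group
  by (intro biset_composition.intro S.localized_group_axioms localized_one_group)

lemma group_hom_one_group:
  "group_hom S (S \<times>\<times> one_group) (\<lambda>s. (s, ()))" "group_hom (S \<times>\<times> one_group) S fst"
  by (intro group_hom.intro group_hom_axioms.intro is_group S1.is_group homI; auto)+

sublocale of_biset: localized_group_hom p S "S \<times>\<times> one_group" "\<lambda>s. (s, ())"
  by (intro localized_group_hom.intro S.localized_group_axioms S1.localized_group_axioms
      group_hom_one_group)

sublocale to_biset: localized_group_hom p "S \<times>\<times> one_group" S fst
  by (intro localized_group_hom.intro S.localized_group_axioms S1.localized_group_axioms
      group_hom_one_group)

lemma burnside_of_biset_eq: "burnside_of_biset p S = burnside_restrict p S (\<lambda>s. (s, ()))"
  by (simp add: burnside_of_biset_def burnside_restrict_def fun_eq_iff)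

lemma burnside_of_biset_closed:
  "x \<in> carrier (burnside_biset p one_group S) \<Longrightarrow> burnside_of_biset p S x \<in> carrier (burnside p S)"
  unfolding burnside_of_biset_eq by (rule of_biset.restrict_closed)

lemma mark_burnside_of_biset:
  assumes "x \<in> carrier (burnside_biset p one_group S)" "subgroup Q S"
  shows "mark Q (burnside_of_biset p S x) = mark ((\<lambda>q. (q, ())) ` Q) x"
  unfolding burnside_of_biset_eq
  using of_biset.mark_restrict[OF assms(1)] S.subgroup_nonempty_subset[OF assms(2)] by simp

lemma of_biset_to_biset:
  assumes "x \<in> carrier (burnside p S)"
  shows "burnside_of_biset p S (burnside_restrict p (S \<times>\<times> one_group) fst x) = x"
proof (rule S.marks_injective)
  fix Q assume Q: "subgroup Q S"
  have "(\<lambda>q. (q, ())) ` Q \<subseteq> carrier (S \<times>\<times> one_group)" "(\<lambda>q. (q, ())) ` Q \<noteq> {}"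
    using S.subgroup_nonempty_subset[OF Q] by auto
  then show "mark Q (burnside_of_biset p S (burnside_restrict p (S \<times>\<times> one_group) fst x)) = mark Q x"
    using mark_burnside_of_biset[OF to_biset.restrict_closed[OF assms] Q] to_biset.mark_restrict[OF assms]
    by (simp add: image_image)
qed (simp_all add: assms burnside_of_biset_closed to_biset.restrict_closed)

lemma to_biset_of_biset:
  assumes "x \<in> carrier (burnside_biset p one_group S)"
  shows "burnside_restrict p (S \<times>\<times> one_group) fst (burnside_of_biset p S x) = x"
proof (rule S1.marks_injective)
  fix D assume D: "subgroup D (S \<times>\<times> one_group)"
  note D' = S1.subgroup_nonempty_subset[OF D]
  then have "fst ` D \<subseteq> carrier S" "fst ` D \<noteq> {}"
    by auto
  moreover have "(\<lambda>s. (s, ())) ` fst ` D = D"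
    by (force simp: image_iff)
  ultimately show "mark D (burnside_restrict p (S \<times>\<times> one_group) fst (burnside_of_biset p S x)) = mark D x"
    unfolding burnside_of_biset_eq
    using to_biset.mark_restrict[OF of_biset.restrict_closed[OF assms]] of_biset.mark_restrict[OF assms] D'
    by simp
qed (simp_all add: assms burnside_of_biset_closed to_biset.restrict_closed)

theorem burnside_of_biset_iso:
  "burnside_of_biset p S \<in> mod_isos (Z_loc p) (burnside_biset p one_group S) (burnside p S)"
  unfolding mod_isos_def
proof (intro CollectI conjI)
  show "burnside_of_biset p S \<in> mod_homs (Z_loc p) (burnside_biset p one_group S) (burnside p S)"
    unfolding burnside_of_biset_eq by (rule of_biset.restrict_mod_hom)
  show "bij_betw (burnside_of_biset p S) (carrier (burnside_biset p one_group S)) (carrier (burnside p S))"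
    by (rule bij_betw_byWitness[where f' = "burnside_restrict p (S \<times>\<times> one_group) fst"])
      (auto simp: of_biset_to_biset to_biset_of_biset to_biset.restrict_closed
        burnside_of_biset_closed)
qed


section \<open>Multiplication by the idempotent averages marks\<close>

lemma mark_idempotent_comp:
  assumes x: "x \<in> carrier (burnside_biset p one_group S)" and Q: "subgroup Q S"
  shows "mark Q (burnside_of_biset p S (burnside_comp p S S one_group \<omega> x)) =
    graph_mark Q / of_nat (order S) *
      (\<Sum>\<alpha>\<in>F Q (carrier S). mark (\<alpha> ` Q) (burnside_of_biset p S x))"
proof -
  have "mark Q (burnside_of_biset p S (burnside_comp p S S one_group \<omega> x)) =
    mark ((\<lambda>q. (q, ())) ` Q) (burnside_comp p S S one_group \<omega> x)"
    by (rule mark_burnside_of_biset[OF comp.comp_closed[OF idempotentD(1) x] Q])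
  also have "\<dots> = (\<Sum>\<alpha>\<in>F Q (carrier S). mark ((\<lambda>q. (q, \<alpha> q)) ` Q) \<omega> * mark ((\<lambda>q. (\<alpha> q, ())) ` Q) x)
      / of_nat (order S)"
    using idempotentD(1,2) x by (intro mark_comp_F_generated localized_one_group Q) auto
  also have "\<dots> = (\<Sum>\<alpha>\<in>F Q (carrier S). graph_mark Q * mark (\<alpha> ` Q) (burnside_of_biset p S x))
      / of_nat (order S)"
    by (intro arg_cong2[of _ _ _ _ "(/)"] sum.cong refl)
      (simp add: mark_graph Q mark_burnside_of_biset[OF x] morphismD(5)[OF Q subgroup_self] image_image)
  finally show ?thesis
    by (simp add: sum_distrib_left sum_divide_distrib)
qed

text \<open>
  Applied to the one-point set, the multiplication by \<open>\<omega>\<close> gives an element whose mark at the trivial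
  subgroup is the augmentation of \<open>\<omega>\<close>. The marks at the subgroups of a \<open>p\<close>-group are all congruent
  to that one, so none of them is zero.
\<close>

lemma graph_mark_nonzero:
  assumes Q: "subgroup Q S"
  shows "graph_mark Q \<noteq> 0"
proof
  assume zero: "graph_mark Q = 0"
  let ?pt = "burnside_class p S (gset_point :: ('a, unit) gset)"
  have pt_gset: "is_gset S (gset_point :: ('a, unit) gset)"
    by (intro is_gset_intro is_group) (auto simp: gset_point_def)
  then have pt: "?pt \<in> carrier (burnside p S)"
    by (rule S.burnside_class_closed)
  define x where "x = burnside_restrict p (S \<times>\<times> one_group) fst ?pt"
  have x: "x \<in> carrier (burnside_biset p one_group S)" "burnside_of_biset p S x = ?pt"
    unfolding x_def by (rule to_biset.restrict_closed[OF pt], rule of_biset_to_biset[OF pt])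
  define z where "z = burnside_of_biset p S (burnside_comp p S S one_group \<omega> x)"
  have z: "z \<in> carrier (burnside p S)"
    unfolding z_def by (rule burnside_of_biset_closed[OF comp.comp_closed[OF idempotentD(1) x(1)]])
  obtain n where n: "order S = p ^ n"
    using p_group by blast
  have one: "subgroup {\<one>} S"
    by (rule triv_subgroup)
  have "\<alpha> \<one> = \<one>" if "\<alpha> \<in> F {\<one>} (carrier S)" for \<alpha>
    using group_hom.hom_one[OF morphismD(1)[OF one subgroup_self that]] by simp
  then have F1: "F {\<one>} (carrier S) = {\<lambda>u\<in>{\<one>}. u}"
    using inclusion_in[OF one subgroup_self] morphismD(2)[OF one subgroup_self]
    by (auto intro!: extensionalityI[of _ "{\<one>}"])
  have "mark {\<one>} ?pt = 1"
    using S.mark_eq_isotropy_form[OF pt, of "{\<one>}"] S.isotropy_form_class[OF pt_gset]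
    by (simp add: isotropy_sum_def gset_point_def stabilizer_def)
  then have "mark {\<one>} z = graph_mark {\<one>} / of_nat (order S)"
    unfolding z_def mark_idempotent_comp[OF x(1) one] x(2) by (simp add: F1)
  also have "graph_mark {\<one>} = isotropy_form (S \<times>\<times> S) (\<lambda>A. 1) \<omega>"
  proof -
    have "graph_mark {\<one>} = isotropy_form (S \<times>\<times> S) (\<lambda>A. of_bool ({(\<one>, \<one>)} \<subseteq> A)) \<omega>"
      unfolding graph_mark_def using SS.mark_eq_isotropy_form[OF idempotentD(1)] by simp
    also have "\<dots> = isotropy_form (S \<times>\<times> S) (\<lambda>A. 1) \<omega>"
      using subgroup.one_closed by (intro SS.isotropy_form_cong[OF idempotentD(1)]) fastforce
    finally show ?thesis .
  qed
  also have "isotropy_form (S \<times>\<times> S) (\<lambda>A. 1) \<omega> / of_nat (order S) =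
      isotropy_form (S \<times>\<times> S) (\<lambda>A. 1 / of_nat (order S)) \<omega>"
    by (rule SS.isotropy_form_weight_mult(3)[symmetric])
  also have "\<dots> = augmentation S \<omega>"
    unfolding augmentation_def isotropy_form_def
    by (intro arg_cong2[of _ _ _ _ lift_rat] ext refl) (simp add: isotropy_sum_def)
  finally have aug: "mark {\<one>} z = augmentation S \<omega>" .
  have "mark Q z = 0"
    unfolding z_def mark_idempotent_comp[OF x(1) Q] by (simp add: zero)
  moreover obtain w where "w \<in> carrier (Z_loc p)" "mark {\<one>} z - mark Q z = of_nat p * w"
    using S.mark_cong_trivial[OF n z Q] .
  ultimately show False
    using aug idempotentD(5) prime_multiple_not_unit_Z_loc[OF prime_p] by auto
qed

text \<open>
  As the common mark is not zero, the quadratic equation for it gives \<open>|S| / |F(Q, S)|\<close>, and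
  \<open>|F(Q, S)|\<close> is the number of conjugates of \<open>Q\<close> times the order of its automorphism group.
\<close>

lemma mark_idempotent_comp_average:
  assumes x: "x \<in> carrier (burnside_biset p one_group S)" and Q: "subgroup Q S"
  shows "mark Q (burnside_of_biset p S (burnside_comp p S S one_group \<omega> x)) =
    (\<Sum>Q'\<in>F_conjugates S F Q. mark Q' (burnside_of_biset p S x)) / of_nat (card (F_conjugates S F Q))"
proof -
  have "order S \<noteq> 0"
    using finite_carrier by (simp add: order_def card_gt_0_iff) blast
  have card: "of_nat (card (F Q (carrier S))) =
      of_nat (card (F Q Q)) * (of_nat (card (F_conjugates S F Q)) :: rat)"
    using sum_over_morphisms[OF Q, of "\<lambda>_. 1"] by simp
  have k: "graph_mark Q * of_nat (card (F Q (carrier S))) = of_nat (order S)"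
    using graph_mark_idempotent[OF Q] graph_mark_nonzero[OF Q] \<open>order S \<noteq> 0\<close>
    by (simp add: field_simps power2_eq_square)
  then have "card (F_conjugates S F Q) \<noteq> 0"
    using \<open>order S \<noteq> 0\<close> unfolding card by (metis mult_zero_right of_nat_0 of_nat_eq_iff)
  then have average: "graph_mark Q * of_nat (card (F Q Q)) / of_nat (order S) =
      1 / of_nat (card (F_conjugates S F Q))"
    using k \<open>order S \<noteq> 0\<close> unfolding card by (simp add: frac_eq_eq mult.assoc)
  let ?X = "burnside_of_biset p S x"
  have "mark Q (burnside_of_biset p S (burnside_comp p S S one_group \<omega> x)) =
    graph_mark Q * of_nat (card (F Q Q)) / of_nat (order S) * (\<Sum>Q'\<in>F_conjugates S F Q. mark Q' ?X)"
    unfolding mark_idempotent_comp[OF x Q] sum_over_morphisms[OF Q, of "\<lambda>Q'. mark Q' ?X"] by simp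
  then show ?thesis
    unfolding average by simp
qed


section \<open>Stable elements and stabilization\<close>

text \<open>
  Restriction along \<open>\<phi>\<close> turns the mark at \<open>D\<close> into the mark at \<open>\<phi> D\<close>, and the restriction of \<open>\<phi>\<close> to
  \<open>D\<close> is a morphism, so \<open>\<phi> D\<close> is a conjugate of \<open>D\<close>; conversely, the marks at \<open>Q\<close> itself are compared
  by restricting to \<open>Q\<close>.
\<close>

lemma F_stable_iff:
  assumes X: "X \<in> carrier (burnside p S)"
  shows "F_stable p S F X \<longleftrightarrow>
    (\<forall>Q Q'. subgroup Q S \<longrightarrow> Q' \<in> F_conjugates S F Q \<longrightarrow> mark Q' X = mark Q X)"
proof -
  have mark_restrict: "localized_group_hom p (S\<lparr>carrier := P\<rparr>) S \<phi>"
    if "subgroup P S" "group_hom (S\<lparr>carrier := P\<rparr>) S \<phi>" for P \<phi>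
    by (intro localized_group_hom.intro S.localized_group_subgroup S.localized_group_axioms that)
  have incl: "group_hom (S\<lparr>carrier := P\<rparr>) S (\<lambda>u. u)" if "subgroup P S" for P
    using subgroup.subset[OF that]
    by (intro group_hom.intro group_hom_axioms.intro subgroup_imp_group is_group that homI) auto
  show ?thesis
  proof (intro iffI allI impI)
    fix Q Q' assume stable: "F_stable p S F X" and Q: "subgroup Q S" "Q' \<in> F_conjugates S F Q"
    then obtain \<phi> where \<phi>: "\<phi> \<in> F Q (carrier S)" "Q' = \<phi> ` Q"
      by (auto simp: F_conjugates_eq)
    have "Q \<subseteq> carrier (S\<lparr>carrier := Q\<rparr>)" "Q \<noteq> {}"
      using S.subgroup_nonempty_subset[OF Q(1)] by auto
    then have "mark Q' X = mark Q (burnside_restrict p (S\<lparr>carrier := Q\<rparr>) \<phi> X)"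
      "mark Q X = mark Q (burnside_restrict p (S\<lparr>carrier := Q\<rparr>) (\<lambda>u. u) X)"
      using localized_group_hom.mark_restrict[OF mark_restrict[OF Q(1) incl[OF Q(1)]] X]
        localized_group_hom.mark_restrict[OF mark_restrict[OF Q(1) morphismD(1)[OF Q(1) subgroup_self \<phi>(1)]] X]
        \<phi>(2) by simp_all
    then show "mark Q' X = mark Q X"
      using stable Q(1) \<phi>(1) by (simp add: F_stable_def)
  next
    assume marks: "\<forall>Q Q'. subgroup Q S \<longrightarrow> Q' \<in> F_conjugates S F Q \<longrightarrow> mark Q' X = mark Q X"
    show "F_stable p S F X"
      unfolding F_stable_def
    proof (intro allI impI)
      fix P \<phi> assume P: "subgroup P S" and \<phi>: "\<phi> \<in> F P (carrier S)"
      let ?P = "S\<lparr>carrier := P\<rparr>"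
      interpret P: localized_group p ?P
        using P by (rule S.localized_group_subgroup)
      interpret \<phi>: localized_group_hom p ?P S \<phi>
        by (rule mark_restrict[OF P morphismD(1)[OF P subgroup_self \<phi>]])
      interpret incl: localized_group_hom p ?P S "\<lambda>u. u"
        by (rule mark_restrict[OF P incl[OF P]])
      show "burnside_restrict p ?P \<phi> X = burnside_restrict p ?P (\<lambda>u. u) X"
      proof (rule P.marks_injective)
        fix D assume D: "subgroup D ?P"
        note D' = P.subgroup_nonempty_subset[OF D]
        have DS: "subgroup D S" "D \<subseteq> P"
          using incl_subgroup[OF P D] D' by auto
        have "restrict \<phi> D \<in> F D (carrier S)"
          by (rule restrict_morphism[OF P DS(1) subgroup_self \<phi> DS(2)])
        then have "restrict \<phi> D ` D \<in> F_conjugates S F D"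
          by (rule image_in_F_conjugates[OF DS(1)])
        moreover have "restrict \<phi> D ` D = \<phi> ` D"
          by auto
        ultimately have "mark (\<phi> ` D) X = mark D X"
          using marks DS(1) by metis
        then show "mark D (burnside_restrict p ?P \<phi> X) = mark D (burnside_restrict p ?P (\<lambda>u. u) X)"
          using \<phi>.mark_restrict[OF X] incl.mark_restrict[OF X] D' by simp
      qed (use X \<phi>.restrict_closed incl.restrict_closed in auto)
    qed
  qed
qed

lemma subgroup_F_conjugate:
  "subgroup Q S \<Longrightarrow> Q' \<in> F_conjugates S F Q \<Longrightarrow> subgroup Q' S"
  by (simp add: F_conjugates_def)

lemma mark_add_subgroup:
  "X \<in> carrier (burnside p S) \<Longrightarrow> Y \<in> carrier (burnside p S) \<Longrightarrow> subgroup Q S \<Longrightarrow>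
    mark Q (X \<oplus>\<^bsub>burnside p S\<^esub> Y) = mark Q X + mark Q Y"
  using S.mark_add S.subgroup_nonempty_subset by blast

lemma mark_smult_subgroup:
  "q \<in> carrier (Z_loc p) \<Longrightarrow> X \<in> carrier (burnside p S) \<Longrightarrow> subgroup Q S \<Longrightarrow>
    mark Q (q \<odot>\<^bsub>burnside p S\<^esub> X) = q * mark Q X"
  using S.mark_smult S.subgroup_nonempty_subset by blast

lemma module_burnside_fusion: "module (Z_loc p) (burnside_fusion p S F)"
proof -
  interpret M: module "Z_loc p" "burnside p S"
    by (rule S.module_burnside)
  let ?H = "{X \<in> carrier (burnside p S). F_stable p S F X}"
  have smult: "q \<odot>\<^bsub>burnside p S\<^esub> X \<in> ?H" if "q \<in> carrier (Z_loc p)" "X \<in> ?H" for q X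
    using that by (auto simp: F_stable_iff mark_smult_subgroup subgroup_F_conjugate)
  have "submodule ?H (Z_loc p) (burnside p S)"
  proof (rule M.submoduleI)
    have "mark Q \<zero>\<^bsub>burnside p S\<^esub> = 0" if "subgroup Q S" for Q
      using S.mark_eq_isotropy_form[OF M.zero_closed] S.subgroup_nonempty_subset[OF that]
      by (simp add: S.isotropy_form_zero)
    then show "\<zero>\<^bsub>burnside p S\<^esub> \<in> ?H"
      by (auto simp: F_stable_iff subgroup_F_conjugate)
    fix X Y assume X: "X \<in> ?H"
    have "(- 1) \<odot>\<^bsub>burnside p S\<^esub> X \<oplus>\<^bsub>burnside p S\<^esub> X = \<zero>\<^bsub>burnside p S\<^esub>"
      using X M.smult_l_distr[of "-1" 1 X] Z_loc_of_int[OF prime_p, of "-1"] M.smult_l_null[of X]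
        M.smult_one[of X] prime_p by simp
    then have "\<ominus>\<^bsub>burnside p S\<^esub> X = (- 1) \<odot>\<^bsub>burnside p S\<^esub> X"
      using X smult[of "-1" X] Z_loc_of_int[OF prime_p, of "-1"] M.minus_equality by simp
    then show "\<ominus>\<^bsub>burnside p S\<^esub> X \<in> ?H"
      using smult[OF _ X, of "-1"] Z_loc_of_int[OF prime_p, of "-1"] by simp
    assume "Y \<in> ?H"
    with X show "X \<oplus>\<^bsub>burnside p S\<^esub> Y \<in> ?H"
      by (auto simp: F_stable_iff mark_add_subgroup subgroup_F_conjugate)
  qed (use smult in auto)
  then show ?thesis
    unfolding burnside_fusion_def using S.module_burnside by (rule submodule.submodule_is_module)
qed

lemma is_stabilization_unique:
  assumes "is_stabilization p S F X Y" "is_stabilization p S F X Y'"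
  shows "Y = Y'"
  using assms by (intro S.marks_injective) (auto simp: is_stabilization_def burnside_fusion_def)

lemma stabilization_eqI: "is_stabilization p S F X Y \<Longrightarrow> stabilization p S F X = Y"
  unfolding stabilization_def by (rule the_equality, assumption) (rule is_stabilization_unique)

theorem is_stabilization_idempotent_comp:
  assumes x: "x \<in> carrier (burnside_biset p one_group S)"
  shows "is_stabilization p S F (burnside_of_biset p S x)
    (burnside_of_biset p S (burnside_comp p S S one_group \<omega> x))"
proof -
  let ?Y = "burnside_of_biset p S (burnside_comp p S S one_group \<omega> x)"
  have Y: "?Y \<in> carrier (burnside p S)"
    by (rule burnside_of_biset_closed[OF comp.comp_closed[OF idempotentD(1) x]])
  have "F_stable p S F ?Y"
    unfolding F_stable_iff[OF Y]
  proof (intro allI impI)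
    fix Q Q' assume Q: "subgroup Q S" and Q': "Q' \<in> F_conjugates S F Q"
    show "mark Q' ?Y = mark Q ?Y"
      unfolding mark_idempotent_comp_average[OF x Q]
        mark_idempotent_comp_average[OF x subgroup_F_conjugate[OF Q Q']] F_conjugates_cong[OF Q Q'] ..
  qed
  then show ?thesis
    using Y by (simp add: is_stabilization_def burnside_fusion_def mark_idempotent_comp_average[OF x])
qed

lemma is_stabilization_stabilization:
  assumes X: "X \<in> carrier (burnside p S)"
  shows "is_stabilization p S F X (stabilization p S F X)"
proof -
  have "is_stabilization p S F X (burnside_of_biset p S (burnside_comp p S S one_group \<omega>
      (burnside_restrict p (S \<times>\<times> one_group) fst X)))"
    using is_stabilization_idempotent_comp[OF to_biset.restrict_closed[OF X]] of_biset_to_biset[OF X]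
    by simp
  then show ?thesis
    using stabilization_eqI by metis
qed

theorem stabilization_mod_hom:
  "stabilization p S F \<in> mod_homs (Z_loc p) (burnside p S) (burnside_fusion p S F)"
proof -
  interpret M: module "Z_loc p" "burnside_fusion p S F"
    by (rule module_burnside_fusion)
  have ops: "X \<oplus>\<^bsub>burnside_fusion p S F\<^esub> Y = X \<oplus>\<^bsub>burnside p S\<^esub> Y"
    "q \<odot>\<^bsub>burnside_fusion p S F\<^esub> X = q \<odot>\<^bsub>burnside p S\<^esub> X" for X Y q
    by (simp_all add: burnside_fusion_def)
  have carrier: "X \<in> carrier (burnside p S)" if "X \<in> carrier (burnside_fusion p S F)" for X
    using that by (simp add: burnside_fusion_def)
  have stab: "stabilization p S F X \<in> carrier (burnside_fusion p S F)"
    "\<And>Q. subgroup Q S \<Longrightarrow> mark Q (stabilization p S F X) =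
      (\<Sum>Q'\<in>F_conjugates S F Q. mark Q' X) / of_nat (card (F_conjugates S F Q))"
    if "X \<in> carrier (burnside p S)" for X
    using is_stabilization_stabilization[OF that] by (auto simp: is_stabilization_def)
  show ?thesis
    unfolding mod_homs_def
  proof (intro CollectI conjI ballI funcsetI)
    fix X Y assume X: "X \<in> carrier (burnside p S)" and Y: "Y \<in> carrier (burnside p S)"
    show "stabilization p S F (X \<oplus>\<^bsub>burnside p S\<^esub> Y) =
      stabilization p S F X \<oplus>\<^bsub>burnside_fusion p S F\<^esub> stabilization p S F Y"
    proof (rule stabilization_eqI, unfold is_stabilization_def, intro conjI allI impI)
      fix Q assume Q: "subgroup Q S"
      have "(\<Sum>Q'\<in>F_conjugates S F Q. mark Q' (X \<oplus>\<^bsub>burnside p S\<^esub> Y)) =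
        (\<Sum>Q'\<in>F_conjugates S F Q. mark Q' X + mark Q' Y)"
        by (intro sum.cong refl mark_add_subgroup X Y subgroup_F_conjugate[OF Q])
      then show "mark Q (stabilization p S F X \<oplus>\<^bsub>burnside_fusion p S F\<^esub> stabilization p S F Y) =
        (\<Sum>Q'\<in>F_conjugates S F Q. mark Q' (X \<oplus>\<^bsub>burnside p S\<^esub> Y)) / of_nat (card (F_conjugates S F Q))"
        using mark_add_subgroup[OF carrier[OF stab(1)[OF X]] carrier[OF stab(1)[OF Y]] Q]
        by (simp add: ops stab(2)[OF _ Q] X Y sum.distrib add_divide_distrib)
    qed (simp add: stab(1) X Y)
  next
    fix q X assume q: "q \<in> carrier (Z_loc p)" and X: "X \<in> carrier (burnside p S)"
    show "stabilization p S F (q \<odot>\<^bsub>burnside p S\<^esub> X) =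
      q \<odot>\<^bsub>burnside_fusion p S F\<^esub> stabilization p S F X"
    proof (rule stabilization_eqI, unfold is_stabilization_def, intro conjI allI impI)
      fix Q assume Q: "subgroup Q S"
      have "(\<Sum>Q'\<in>F_conjugates S F Q. mark Q' (q \<odot>\<^bsub>burnside p S\<^esub> X)) =
        (\<Sum>Q'\<in>F_conjugates S F Q. q * mark Q' X)"
        by (intro sum.cong refl mark_smult_subgroup q X subgroup_F_conjugate[OF Q])
      then show "mark Q (q \<odot>\<^bsub>burnside_fusion p S F\<^esub> stabilization p S F X) =
        (\<Sum>Q'\<in>F_conjugates S F Q. mark Q' (q \<odot>\<^bsub>burnside p S\<^esub> X)) / of_nat (card (F_conjugates S F Q))"
        using mark_smult_subgroup[OF q carrier[OF stab(1)[OF X]] Q]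
        by (simp add: ops stab(2)[OF _ Q] X sum_distrib_left)
    qed (simp add: stab(1) q X)
  qed (simp_all add: stab(1) S.module_burnside module_burnside_fusion)
qed

end


section \<open>Left multiplication by the characteristic idempotent is stabilization\<close>

theorem corollary5p14:
  fixes p :: nat and S :: "('a, 'b) monoid_scheme" and F :: "'a fusion"
    and \<omega> :: "('a \<times> 'a) burnside_elem"
  assumes "saturated_fusion_system p S F"
    and "characteristic_idempotent p S F \<omega>"
  shows "burnside_of_biset p S
           \<in> mod_isos (Z_loc p) (burnside_biset p one_group S) (burnside p S)
    \<and> stabilization p S F \<in> mod_homs (Z_loc p) (burnside p S) (burnside_fusion p S F)
    \<and> (\<forall>x \<in> carrier (burnside_biset p one_group S).
         burnside_of_biset p S (burnside_comp p S S one_group \<omega> x)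
           = stabilization p S F (burnside_of_biset p S x))"
proof -
  interpret fusion_system_idempotent p S F \<omega>
    by (intro fusion_system_idempotent.intro fusion_system_idempotent_axioms.intro assms
        saturated_fusion_system.axioms(1)[OF assms(1)])
  show ?thesis
    using burnside_of_biset_iso stabilization_mod_hom
      stabilization_eqI[OF is_stabilization_idempotent_comp] by simp
qed

end
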